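(* Let $1<\alpha<2$, $0\le r\le 1$, let $\beta\in[\alpha-1,1]$ be determined by $r=\frac{\sin(\pi\beta)}{\sin(\pi(\alpha-\beta))+\sin(\pi\beta)}$, and let $0<K_m\le K(x)\le K_M<\infty$ on $(0,1)$. For $f\in L^2_{\omega^{(\beta,\alpha-\beta)}}(0,1)$, put $f_1(x)=\frac1{K(x)}\int_0^x f(y)\,dy$ and $f_2(x)=\frac1{K(x)}$. Then the problem $$L_r^\alpha u(x)=f_1(x)-A\,f_2(x),\quad x\in(0,1),\qquad u(0)=u(1)=0,$$ has a solution $u\in L^2_{\omega^{(-(\alpha-\beta),-\beta)}}(0,1)$, in which the constant $A$ is expressed in terms of the data $f$ and $K$ as $$A=\frac{\big(f_1,1\big)_{\omega^{(\beta-1,\alpha-\beta-1)}}}{\big(K^{-1},1\big)_{\omega^{(\beta-1,\alpha-\beta-1)}}}=\frac{\Big(\frac1{K(x)}\int_0^x f(y)\,dy,\,1\Big)_{\omega^{(\beta-1,\alpha-\beta-1)}}}{\Big(\frac1{K(x)},\,1\Big)_{\omega^{(\beta-1,\alpha-\beta-1)}}}.$$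
   Context: Weights and spaces: $\omega^{(a,b)}(x)=(1-x)^a x^b$ on $(0,1)$; $(g,h)_\omega=\int_0^1\omega\, g\,h\,dx$, $\|g\|_\omega=(g,g)_\omega^{1/2}$, $L^2_\omega(0,1)=\{g:\|g\|_\omega<\infty\}$. Fractional integrals for $0<\sigma<1$: ${}_0I_x^\sigma w(x)=\frac1{\Gamma(\sigma)}\int_0^x w(s)(x-s)^{\sigma-1}ds$ and ${}_xI_1^\sigma w(x)=\frac1{\Gamma(\sigma)}\int_x^1 w(s)(s-x)^{\sigma-1}ds$. $D$ is the first derivative. Operator: $L_r^\alpha u=-\big(r\,{}_0I_x^{2-\alpha}+(1-r)\,{}_xI_1^{2-\alpha}\big)Du$. In the problem, $A$ is the constant (depending on $u$) $A=K(0)\big[\big(r\,{}_0I_x^{2-\alpha}+(1-r)\,{}_xI_1^{2-\alpha}\big)Du(x)\big]\big|_{x=0}$, which is formally what the equation gives when multiplied by $K$ and evaluated at $x=0$; thus one seeks $u$ together with the constant $A$. Jacobi polynomials on $(0,1)$: $G_n^{(a,b)}(x)=P_n^{(a,b)}(2x-1)$, with $P_n^{(a,b)}$ the standard Jacobi polynomials on $[-1,1]$ (orthogonal for $(1-x)^a(1+x)^b$). Sense of solution: every $u\in L^2_{\omega^{(-(\alpha-\beta),-\beta)}}(0,1)$ has a unique expansion $u=\omega^{(\alpha-\beta,\beta)}\sum_{j\ge0}c_jG_j^{(\alpha-\beta,\beta)}$ converging in that space. With $u_N=\omega^{(\alpha-\beta,\beta)}\sum_{j=0}^N c_jG_j^{(\alpha-\beta,\beta)}$,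 $L_r^\alpha u$ is the limit of $L_r^\alpha u_N$ in $L^2_{\omega^{(\beta-1,\alpha-\beta-1)}}(0,1)$ when this limit exists; the homogeneous boundary conditions are understood as those carried by the truncations $u_N$ (each vanishing at $0$ and $1$). *)

theory Defs
  imports "HOL-Analysis.Analysis"
begin

abbreviation unit_ivl_measure :: "real measure" where
  "unit_ivl_measure \<equiv> lebesgue_on {0<..<1}"

definition wt :: "real \<Rightarrow> real \<Rightarrow> real \<Rightarrow> real" where
  "wt a b x = (1 - x) powr a * x powr b"

definition w_inner :: "real \<Rightarrow> real \<Rightarrow> (real \<Rightarrow> real) \<Rightarrow> (real \<Rightarrow> real) \<Rightarrow> real" where
  "w_inner a b g h = (\<integral>x. wt a b x * g x * h x \<partial>unit_ivl_measure)"

definition w_norm :: "real \<Rightarrow> real \<Rightarrow> (real \<Rightarrow> real) \<Rightarrow> real" where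
  "w_norm a b g = sqrt (w_inner a b g g)"

text \<open>The weighted \<open>L\<^sup>2\<close> space, with functions as representatives. Finiteness of the norm
  has to be stated as integrability, since the Bochner integral of a non-integrable function is 0.\<close>

definition w_L2 :: "real \<Rightarrow> real \<Rightarrow> (real \<Rightarrow> real) set" where
  "w_L2 a b = {g. g \<in> borel_measurable unit_ivl_measure \<and>
                  integrable unit_ivl_measure (\<lambda>x. wt a b x * g x * g x)}"

definition converges_in_w_L2 ::
  "real \<Rightarrow> real \<Rightarrow> (nat \<Rightarrow> real \<Rightarrow> real) \<Rightarrow> (real \<Rightarrow> real) \<Rightarrow> bool" where
  "converges_in_w_L2 a b g h \<longleftrightarrow>
     (\<forall>n. g n \<in> w_L2 a b) \<and> h \<in> w_L2 a b \<and>
     (\<lambda>n. w_norm a b (\<lambda>x. g n x - h x)) \<longlonglongrightarrow> 0"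

definition frac_int_left :: "real \<Rightarrow> (real \<Rightarrow> real) \<Rightarrow> real \<Rightarrow> real" where
  "frac_int_left \<sigma> w x =
     1 / Gamma \<sigma> * (\<integral>s. w s * (x - s) powr (\<sigma> - 1) \<partial>lebesgue_on {0<..<x})"

definition frac_int_right :: "real \<Rightarrow> (real \<Rightarrow> real) \<Rightarrow> real \<Rightarrow> real" where
  "frac_int_right \<sigma> w x =
     1 / Gamma \<sigma> * (\<integral>s. w s * (s - x) powr (\<sigma> - 1) \<partial>lebesgue_on {x<..<1})"

definition L_op :: "real \<Rightarrow> real \<Rightarrow> (real \<Rightarrow> real) \<Rightarrow> real \<Rightarrow> real" where
  "L_op r \<alpha> u x =
     - (r * frac_int_left (2 - \<alpha>) (deriv u) x + (1 - r) * frac_int_right (2 - \<alpha>) (deriv u) x)"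

text \<open>Jacobi polynomials \<open>P\<^sub>n\<close> on \<open>[-1,1]\<close> in the standard normalisation
  \<open>P\<^sub>n(1) = (n + a) gchoose n\<close>, by the explicit form of Rodrigues' formula.\<close>

definition jacobi_P :: "nat \<Rightarrow> real \<Rightarrow> real \<Rightarrow> real \<Rightarrow> real" where
  "jacobi_P n a b t =
     (\<Sum>s\<le>n. ((real n + a) gchoose (n - s)) * ((real n + b) gchoose s) *
             ((t - 1) / 2) ^ s * ((t + 1) / 2) ^ (n - s))"

definition jacobi_G :: "nat \<Rightarrow> real \<Rightarrow> real \<Rightarrow> real \<Rightarrow> real" where
  "jacobi_G n a b x = jacobi_P n a b (2 * x - 1)"

definition truncation :: "real \<Rightarrow> real \<Rightarrow> (nat \<Rightarrow> real) \<Rightarrow> nat \<Rightarrow> real \<Rightarrow> real" where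
  "truncation \<alpha> \<beta> c N x =
     wt (\<alpha> - \<beta>) \<beta> x * (\<Sum>j\<le>N. c j * jacobi_G j (\<alpha> - \<beta>) \<beta> x)"

definition is_expansion :: "real \<Rightarrow> real \<Rightarrow> (real \<Rightarrow> real) \<Rightarrow> (nat \<Rightarrow> real) \<Rightarrow> bool" where
  "is_expansion \<alpha> \<beta> u c \<longleftrightarrow> converges_in_w_L2 (- (\<alpha> - \<beta>)) (- \<beta>) (truncation \<alpha> \<beta> c) u"

text \<open>\<open>u\<close>, together with the constant \<open>A\<close>, solves \<open>L u = f1 - A f2\<close> on \<open>(0,1)\<close> with
  \<open>u(0) = u(1) = 0\<close>. The coefficients of an expansion of \<open>u\<close> are unique, so quantifying over
  \<open>c\<close> only names them. Continuity on \<open>[0,1]\<close> is required of the truncations so that their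
  boundary values are genuine limits and not an effect of the convention \<open>0 powr a = 0\<close>.\<close>

definition solves_problem ::
  "real \<Rightarrow> real \<Rightarrow> real \<Rightarrow> (real \<Rightarrow> real) \<Rightarrow> (real \<Rightarrow> real) \<Rightarrow> (real \<Rightarrow> real) \<Rightarrow> real \<Rightarrow> bool" where
  "solves_problem r \<alpha> \<beta> f1 f2 u A \<longleftrightarrow>
     (\<exists>c. is_expansion \<alpha> \<beta> u c \<and>
          converges_in_w_L2 (\<beta> - 1) (\<alpha> - \<beta> - 1)
            (\<lambda>N. L_op r \<alpha> (truncation \<alpha> \<beta> c N)) (\<lambda>x. f1 x - A * f2 x) \<and>
          (\<forall>N. continuous_on {0..1} (truncation \<alpha> \<beta> c N) \<and>
               truncation \<alpha> \<beta> c N 0 = 0 \<and> truncation \<alpha> \<beta> c N 1 = 0))"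

end

theory Submission
  imports Defs
begin

text \<open>Put \<open>p = \<alpha> - \<beta> - 1\<close>, \<open>q = \<beta> - 1\<close> and \<open>\<sigma> = 2 - \<alpha> = - p - q\<close>. Differentiating
\<open>wt (p + 1) (q + 1)\<close> times its Jacobi polynomial of degree \<open>n\<close> gives \<open>- (n + 1)\<close> times \<open>wt p q\<close> times the
Jacobi polynomial of degree \<open>n + 1\<close> for the lowered weight. On truncated expansions the operator is therefore
governed by the potential \<open>T \<phi> x = \<integral> \<phi> s * k (x - s) * wt p q s ds\<close> over the unit interval, where \<open>k z\<close> is
\<open>r * z powr (\<sigma> - 1) / Gamma \<sigma>\<close> for \<open>z > 0\<close> and \<open>(1 - r) * (- z) powr (\<sigma> - 1) / Gamma \<sigma>\<close> for \<open>z < 0\<close>.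

The analytic core is that \<open>T 1\<close> is a positive constant (\<open>riesz_potential_constant\<close>). In the one-sided cases
\<open>r = 0\<close> and \<open>r = 1\<close> this is plain scaling. Otherwise \<open>p\<close> and \<open>q\<close> are negative, the two one-sided integrals are
multiples of the incomplete Beta integrals of one and the same function over \<open>(0, x)\<close> and \<open>(x, 1)\<close>
(\<open>abel_integral_incomplete_beta\<close>), and the prescribed \<open>r\<close> is exactly the value for which the two multiples agree,
by the reflection formula of the Gamma function (\<open>Beta_balance\<close>).

The function \<open>z * k z\<close> is an antiderivative of \<open>\<sigma> * k z\<close>. Hence \<open>T (s * \<phi>)\<close> differs from \<open>x * T \<phi>\<close> only by a
multiple of an antiderivative of \<open>T \<phi>\<close>, and by induction \<open>T\<close> maps polynomials of degree at most \<open>n\<close> to such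
polynomials, multiplying the coefficient of degree \<open>n\<close> by an explicit positive number (\<open>riesz_potential_poly\<close>).
The adjoint of \<open>T\<close> is the same kind of operator with \<open>p\<close>, \<open>q\<close> interchanged and \<open>r\<close> replaced by \<open>1 - r\<close>
(\<open>riesz_potential_adjoint\<close>). So the image of the Jacobi polynomial of degree \<open>n\<close> for \<open>wt p q\<close> is orthogonal,
with respect to \<open>wt q p\<close>, to everything of smaller degree, and its norm is known (\<open>riesz_potential_jacobi\<close>).

These images form a complete orthogonal system for \<open>wt q p\<close>, and the operator reaches precisely those of positive
degree. A right-hand side is therefore reached as soon as it is orthogonal to the constants
(\<open>riesz_equation_solvable\<close>); for \<open>f1 - A * f2\<close> this condition is the stated formula for \<open>A\<close>. The coefficients of the
solution are square summable against the norms for \<open>wt (p + 1) (q + 1)\<close> because the ratio of the norms of the Jacobi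
polynomials to those of their images under the operator stays bounded. What remains is that \<open>f1\<close> itself is square
integrable, a weighted estimate for primitives (\<open>square_integrable_primitive_div\<close>).\<close>

section \<open>Square-integrable functions and orthogonal series\<close>

definition square_integrable :: "'a measure \<Rightarrow> ('a \<Rightarrow> real) \<Rightarrow> bool" where
  "square_integrable M f \<longleftrightarrow> f \<in> borel_measurable M \<and> integrable M (\<lambda>x. f x * f x)"

lemma square_integrable_square:
  "square_integrable M f \<Longrightarrow> integrable M (\<lambda>x. (f x)\<^sup>2)"
  by (simp add: square_integrable_def power2_eq_square)

lemma square_integrableI:
  "f \<in> borel_measurable M \<Longrightarrow> integrable M (\<lambda>x. (f x)\<^sup>2) \<Longrightarrow> square_integrable M f"
  by (simp add: square_integrable_def power2_eq_square)

lemma integrable_mult_square_integrable: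
  assumes "square_integrable M f" "square_integrable M g"
  shows "integrable M (\<lambda>x. f x * g x)"
proof (rule Bochner_Integration.integrable_bound)
  show "integrable M (\<lambda>x. (f x)\<^sup>2 + (g x)\<^sup>2)"
    using assms by (intro Bochner_Integration.integrable_add square_integrable_square)
  show "(\<lambda>x. f x * g x) \<in> borel_measurable M"
    using assms by (auto simp: square_integrable_def)
  show "AE x in M. norm (f x * g x) \<le> norm ((f x)\<^sup>2 + (g x)\<^sup>2)"
  proof (rule AE_I2)
    fix x
    have "2 * (\<bar>f x\<bar> * \<bar>g x\<bar>) \<le> (f x)\<^sup>2 + (g x)\<^sup>2"
      using sum_squares_bound[of "\<bar>f x\<bar>" "\<bar>g x\<bar>"] by simp
    moreover have "0 \<le> \<bar>f x\<bar> * \<bar>g x\<bar>" by simp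
    ultimately show "norm (f x * g x) \<le> norm ((f x)\<^sup>2 + (g x)\<^sup>2)"
      unfolding real_norm_def abs_mult by linarith
  qed
qed

lemma square_integrable_add:
  assumes "square_integrable M f" "square_integrable M g"
  shows "square_integrable M (\<lambda>x. f x + g x)"
proof (rule square_integrableI)
  show "(\<lambda>x. f x + g x) \<in> borel_measurable M"
    using assms by (auto simp: square_integrable_def)
  have "integrable M (\<lambda>x. (f x)\<^sup>2 + (g x)\<^sup>2 + 2 * (f x * g x))"
    using assms by (intro Bochner_Integration.integrable_add square_integrable_square
        integrable_mult_right integrable_mult_square_integrable)
  then show "integrable M (\<lambda>x. (f x + g x)\<^sup>2)"
    by (simp add: power2_sum mult.assoc)
qed

lemma square_integrable_cmult:
  "square_integrable M f \<Longrightarrow> square_integrable M (\<lambda>x. c * f x)"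
  unfolding square_integrable_def by (auto simp: mult.assoc mult.left_commute)

lemma square_integrable_diff:
  assumes "square_integrable M f" "square_integrable M g"
  shows "square_integrable M (\<lambda>x. f x - g x)"
  using square_integrable_add[OF assms(1) square_integrable_cmult[OF assms(2), of "-1"]] by simp

lemma square_integrable_sum:
  "(\<And>i. i \<in> I \<Longrightarrow> square_integrable M (f i)) \<Longrightarrow> square_integrable M (\<lambda>x. \<Sum>i\<in>I. f i x)"
proof (induction I rule: infinite_finite_induct)
  case (insert i I)
  then show ?case by (simp add: square_integrable_add)
qed (simp_all add: square_integrable_def)

text \<open>A subsequence whose consecutive differences \<open>d k\<close> satisfy \<open>\<integral> (d k)\<^sup>2 < 4 ^ (- k)\<close> makes \<open>\<Sum>k. 2 ^ k * (d k)\<^sup>2\<close>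
integrable, so this series is finite almost everywhere. Since \<open>\<bar>d k\<bar> \<le> 2 ^ k * (d k)\<^sup>2 + 2 ^ (- k)\<close>, the subsequence
then converges almost everywhere, and Fatou's lemma turns the Cauchy property into convergence in the mean.\<close>

theorem riesz_fischer:
  fixes f :: "nat \<Rightarrow> 'a \<Rightarrow> real"
  assumes f: "\<And>n. square_integrable M (f n)"
    and cauchy: "\<And>e. e > 0 \<Longrightarrow> \<exists>N. \<forall>m\<ge>N. \<forall>n\<ge>N. (\<integral>x. (f m x - f n x)\<^sup>2 \<partial>M) < e"
  obtains F where "square_integrable M F" "(\<lambda>n. \<integral>x. (f n x - F x)\<^sup>2 \<partial>M) \<longlonglongrightarrow> 0"
proof -
  have [measurable]: "f n \<in> borel_measurable M" for n
    using f by (simp add: square_integrable_def)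
  have int_diff: "integrable M (\<lambda>x. (f m x - f n x)\<^sup>2)" for m n
    by (intro square_integrable_square square_integrable_diff f)
  have "\<forall>k. \<exists>N. \<forall>m\<ge>N. \<forall>n\<ge>N. (\<integral>x. (f m x - f n x)\<^sup>2 \<partial>M) < (1/4) ^ k"
    using cauchy by simp
  then obtain N where N: "\<And>k m n. m \<ge> N k \<Longrightarrow> n \<ge> N k \<Longrightarrow> (\<integral>x. (f m x - f n x)\<^sup>2 \<partial>M) < (1/4) ^ k"
    by metis
  \<comment> \<open>The partial sums dominate all earlier thresholds at once.\<close>
  define \<phi> where "\<phi> k = (\<Sum>i\<le>k. N i)" for k
  have \<phi>_ge: "\<phi> l \<ge> N k" if "k \<le> l" for k l
    unfolding \<phi>_def using that by (intro member_le_sum) auto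
  define d where "d k x = f (\<phi> (Suc k)) x - f (\<phi> k) x" for k x
  have [measurable]: "d k \<in> borel_measurable M" for k
    unfolding d_def by measurable
  have d_int: "integrable M (\<lambda>x. 2 ^ k * (d k x)\<^sup>2)" for k
    unfolding d_def by (intro integrable_mult_right int_diff)
  have d_bound: "(\<integral>\<^sup>+x. ennreal (2 ^ k * (d k x)\<^sup>2) \<partial>M) \<le> ennreal ((1/2) ^ k)" for k
  proof -
    have "(\<integral>\<^sup>+x. ennreal (2 ^ k * (d k x)\<^sup>2) \<partial>M) = ennreal (\<integral>x. 2 ^ k * (d k x)\<^sup>2 \<partial>M)"
      by (intro nn_integral_eq_integral d_int) auto
    also have "(\<integral>x. 2 ^ k * (d k x)\<^sup>2 \<partial>M) \<le> 2 ^ k * (1/4) ^ k"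
      using N[of k "\<phi> (Suc k)" "\<phi> k"] \<phi>_ge[of k k] \<phi>_ge[of k "Suc k"]
      unfolding d_def by simp
    also have "2 ^ k * (1/4) ^ k = ((1/2)::real) ^ k"
      by (simp flip: power_mult_distrib)
    finally show ?thesis by (simp add: ennreal_leI)
  qed
  have "(\<integral>\<^sup>+x. (\<Sum>k. ennreal (2 ^ k * (d k x)\<^sup>2)) \<partial>M) = (\<Sum>k. \<integral>\<^sup>+x. ennreal (2 ^ k * (d k x)\<^sup>2) \<partial>M)"
    by (intro nn_integral_suminf) measurable
  also have "\<dots> \<le> (\<Sum>k. ennreal ((1/2) ^ k))"
    by (intro suminf_le d_bound) auto
  also have "\<dots> = ennreal (\<Sum>k. (1/2) ^ k)"
    by (intro suminf_ennreal2) (auto intro: summable_geometric)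
  also have "\<dots> < \<infinity>" by simp
  finally have "AE x in M. (\<Sum>k. ennreal (2 ^ k * (d k x)\<^sup>2)) \<noteq> \<infinity>"
    by (intro nn_integral_PInf_AE) auto
  then have conv: "AE x in M. convergent (\<lambda>k. f (\<phi> k) x)"
  proof (rule AE_mp, intro AE_I2 impI)
    fix x assume fin: "(\<Sum>k. ennreal (2 ^ k * (d k x)\<^sup>2)) \<noteq> \<infinity>"
    have s: "summable (\<lambda>k. 2 ^ k * (d k x)\<^sup>2)"
      using fin by (intro summable_suminf_not_top) auto
    have "summable (\<lambda>k. d k x)"
    proof (rule summable_comparison_test')
      show "summable (\<lambda>k. (2 ^ k * (d k x)\<^sup>2 + (1/2) ^ k))"
        by (intro summable_add s summable_geometric) auto
      fix k :: nat assume "k \<ge> 0"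
      \<comment> \<open>The weighted inequality of arithmetic and geometric means.\<close>
      have "0 \<le> 2 ^ k * (\<bar>d k x\<bar> - (1/2) ^ k)\<^sup>2" by simp
      also have "\<dots> = 2 ^ k * (d k x)\<^sup>2 + (2 ^ k * (1/2) ^ k) * (1/2) ^ k - 2 * (2 ^ k * (1/2) ^ k) * \<bar>d k x\<bar>"
        by (simp add: power2_eq_square algebra_simps)
      also have "2 ^ k * (1/2) ^ k = (1::real)" by (simp flip: power_mult_distrib)
      finally show "norm (d k x) \<le> 2 ^ k * (d k x)\<^sup>2 + (1/2) ^ k" by simp
    qed
    then have "convergent (\<lambda>n. \<Sum>k<n. d k x)" by (simp add: summable_iff_convergent)
    then have "convergent (\<lambda>n. f (\<phi> 0) x + (\<Sum>k<n. d k x))"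
      by (intro convergent_add convergent_const)
    moreover have "f (\<phi> 0) x + (\<Sum>k<n. d k x) = f (\<phi> n) x" for n
      by (induction n) (auto simp: d_def)
    ultimately show "convergent (\<lambda>k. f (\<phi> k) x)" by simp
  qed
  define F where "F x = lim (\<lambda>k. f (\<phi> k) x)" for x
  have [measurable]: "F \<in> borel_measurable M"
    unfolding F_def by measurable
  have F_lim: "AE x in M. (\<lambda>k. f (\<phi> k) x) \<longlonglongrightarrow> F x"
    using conv by eventually_elim (simp add: F_def convergent_LIMSEQ_iff)
  have fatou: "(\<integral>\<^sup>+x. ennreal ((f n x - F x)\<^sup>2) \<partial>M) \<le> ennreal ((1/4) ^ k)" if "n \<ge> N k" for n k
  proof -
    have "(\<integral>\<^sup>+x. ennreal ((f n x - F x)\<^sup>2) \<partial>M)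
        = (\<integral>\<^sup>+x. liminf (\<lambda>j. ennreal ((f n x - f (\<phi> j) x)\<^sup>2)) \<partial>M)"
    proof (rule nn_integral_cong_AE, use F_lim in eventually_elim)
      fix x assume "(\<lambda>k. f (\<phi> k) x) \<longlonglongrightarrow> F x"
      then have "(\<lambda>j. ennreal ((f n x - f (\<phi> j) x)\<^sup>2)) \<longlonglongrightarrow> ennreal ((f n x - F x)\<^sup>2)"
        by (intro tendsto_ennrealI tendsto_intros)
      then show "ennreal ((f n x - F x)\<^sup>2) = liminf (\<lambda>j. ennreal ((f n x - f (\<phi> j) x)\<^sup>2))"
        by (intro lim_imp_Liminf[symmetric]) auto
    qed
    also have "\<dots> \<le> liminf (\<lambda>j. \<integral>\<^sup>+x. ennreal ((f n x - f (\<phi> j) x)\<^sup>2) \<partial>M)"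
      by (intro nn_integral_liminf) measurable
    also have "\<dots> \<le> liminf (\<lambda>j. ennreal ((1/4) ^ k))"
    proof (rule Liminf_mono, rule eventually_sequentiallyI[of k])
      fix j assume "j \<ge> k"
      have "(\<integral>\<^sup>+x. ennreal ((f n x - f (\<phi> j) x)\<^sup>2) \<partial>M) = ennreal (\<integral>x. (f n x - f (\<phi> j) x)\<^sup>2 \<partial>M)"
        by (intro nn_integral_eq_integral int_diff) auto
      also have "\<dots> \<le> ennreal ((1/4) ^ k)"
        using N[of k n "\<phi> j"] that \<phi>_ge[OF \<open>j \<ge> k\<close>] by (intro ennreal_leI) simp
      finally show "(\<integral>\<^sup>+x. ennreal ((f n x - f (\<phi> j) x)\<^sup>2) \<partial>M) \<le> ennreal ((1/4) ^ k)" .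
    qed
    finally show ?thesis by (simp add: Liminf_const)
  qed
  have si_diff: "square_integrable M (\<lambda>x. f n x - F x)" if "n \<ge> N k" for n k
  proof (rule square_integrableI)
    have "(\<integral>\<^sup>+x. ennreal (norm ((f n x - F x)\<^sup>2)) \<partial>M) \<le> ennreal ((1/4) ^ k)"
      using fatou[OF that] by simp
    also have "\<dots> < \<infinity>" by simp
    finally show "integrable M (\<lambda>x. (f n x - F x)\<^sup>2)"
      by (intro integrableI_bounded) auto
  qed measurable
  have F_si: "square_integrable M F"
    using square_integrable_diff[OF f[of "N 0"] si_diff[OF order_refl, of 0]] by simp
  have "(\<lambda>n. \<integral>x. (f n x - F x)\<^sup>2 \<partial>M) \<longlonglongrightarrow> 0"
  proof (rule LIMSEQ_I)
    fix e :: real assume "e > 0"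
    then obtain k where k: "(1/4) ^ k < e"
      using real_arch_pow_inv[of e "1/4"] by auto
    show "\<exists>no. \<forall>n\<ge>no. norm ((\<integral>x. (f n x - F x)\<^sup>2 \<partial>M) - 0) < e"
    proof (intro exI allI impI)
      fix n assume n: "n \<ge> N k"
      have "ennreal (\<integral>x. (f n x - F x)\<^sup>2 \<partial>M) = (\<integral>\<^sup>+x. ennreal ((f n x - F x)\<^sup>2) \<partial>M)"
        by (intro nn_integral_eq_integral[symmetric] square_integrable_square
            square_integrable_diff f F_si) auto
      also have "\<dots> \<le> ennreal ((1/4) ^ k)" by (rule fatou[OF n])
      finally have "(\<integral>x. (f n x - F x)\<^sup>2 \<partial>M) \<le> (1/4) ^ k" by simp
      with k show "norm ((\<integral>x. (f n x - F x)\<^sup>2 \<partial>M) - 0) < e" by simp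
    qed
  qed
  with F_si show thesis by (rule that)
qed

text \<open>The quadratic form \<open>\<integral> (s * f - t * g)\<^sup>2\<close> in \<open>s\<close> and \<open>t\<close> is nonnegative, so its discriminant is not positive.\<close>

lemma integral_Cauchy_Schwarz:
  assumes f: "square_integrable M f" and g: "square_integrable M g"
  shows "(\<integral>x. f x * g x \<partial>M)\<^sup>2 \<le> (\<integral>x. (f x)\<^sup>2 \<partial>M) * (\<integral>x. (g x)\<^sup>2 \<partial>M)"
proof -
  define A B C where "A = (\<integral>x. (f x)\<^sup>2 \<partial>M)" and "B = (\<integral>x. f x * g x \<partial>M)" and "C = (\<integral>x. (g x)\<^sup>2 \<partial>M)"
  note ints = square_integrable_square[OF f] square_integrable_square[OF g]
    integrable_mult_square_integrable[OF f g]
  have "0 \<le> (\<integral>x. (s * f x - t * g x)\<^sup>2 \<partial>M)" for s t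
    by (rule integral_nonneg_AE) auto
  also have "\<And>s t. (\<integral>x. (s * f x - t * g x)\<^sup>2 \<partial>M)
     = (\<integral>x. s\<^sup>2 * (f x)\<^sup>2 - (2 * s * t) * (f x * g x) + t\<^sup>2 * (g x)\<^sup>2 \<partial>M)"
    by (intro Bochner_Integration.integral_cong) (auto simp: power2_eq_square algebra_simps)
  also have "\<And>s t. \<dots> s t = s\<^sup>2 * A - 2 * s * t * B + t\<^sup>2 * C"
    unfolding A_def B_def C_def using ints by simp
  finally have quad: "0 \<le> s\<^sup>2 * A - 2 * s * t * B + t\<^sup>2 * C" for s t by simp
  have nn: "A \<ge> 0" "C \<ge> 0" unfolding A_def C_def by (auto intro: integral_nonneg_AE)
  have "B\<^sup>2 \<le> A * C"
  proof (cases "C = 0")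
    case True
    have "B = 0"
    proof (rule ccontr)
      assume "B \<noteq> 0"
      \<comment> \<open>If the form is linear in the second variable, this choice would make it equal to -1.\<close>
      have "0 \<le> A - 2 * ((A + 1) / (2 * B)) * B" using quad[of 1 "(A + 1) / (2 * B)"] True by simp
      then show False using \<open>B \<noteq> 0\<close> by (simp add: field_simps)
    qed
    then show ?thesis using True by simp
  next
    case False
    then have "C > 0" using nn by simp
    have "0 \<le> C * (A * C - B\<^sup>2)"
      using quad[of C B] by (simp add: power2_eq_square algebra_simps)
    then show ?thesis using \<open>C > 0\<close> by (simp add: zero_le_mult_iff)
  qed
  then show ?thesis unfolding A_def B_def C_def .
qed

context
  fixes M :: "'a measure" and e :: "nat \<Rightarrow> 'a \<Rightarrow> real"
  assumes e: "\<And>i. square_integrable M (e i)"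
    and orth: "\<And>i j. i \<noteq> j \<Longrightarrow> (\<integral>x. e i x * e j x \<partial>M) = 0"
begin

lemma integral_sum_orthogonal:
  assumes "finite I"
  shows "(\<integral>x. (\<Sum>i\<in>I. c i * e i x)\<^sup>2 \<partial>M) = (\<Sum>i\<in>I. (c i)\<^sup>2 * (\<integral>x. (e i x)\<^sup>2 \<partial>M))"
proof -
  have ints: "integrable M (\<lambda>x. c i * c j * (e i x * e j x))" for i j
    by (intro integrable_mult_right integrable_mult_square_integrable e)
  have "(\<integral>x. (\<Sum>i\<in>I. c i * e i x)\<^sup>2 \<partial>M) = (\<integral>x. (\<Sum>i\<in>I. \<Sum>j\<in>I. c i * c j * (e i x * e j x)) \<partial>M)"
    by (intro Bochner_Integration.integral_cong refl)
       (simp add: power2_eq_square sum_product mult_ac)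
  also have "\<dots> = (\<Sum>i\<in>I. \<Sum>j\<in>I. c i * c j * (\<integral>x. e i x * e j x \<partial>M))"
    using ints by (simp add: Bochner_Integration.integral_sum)
  also have "\<dots> = (\<Sum>i\<in>I. \<Sum>j\<in>I. if j = i then (c i)\<^sup>2 * (\<integral>x. (e i x)\<^sup>2 \<partial>M) else 0)"
    by (intro sum.cong refl) (auto simp: orth power2_eq_square)
  also have "\<dots> = (\<Sum>i\<in>I. (c i)\<^sup>2 * (\<integral>x. (e i x)\<^sup>2 \<partial>M))"
    using assms by (simp add: sum.delta)
  finally show ?thesis .
qed

lemma orthogonal_series_converges:
  assumes sm: "summable (\<lambda>i. (c i)\<^sup>2 * (\<integral>x. (e i x)\<^sup>2 \<partial>M))"
  obtains F where "square_integrable M F"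
    "(\<lambda>n. \<integral>x. ((\<Sum>i\<le>n. c i * e i x) - F x)\<^sup>2 \<partial>M) \<longlonglongrightarrow> 0"
proof (rule riesz_fischer[where f = "\<lambda>n x. \<Sum>i\<le>n. c i * e i x" and M = M])
  show "square_integrable M (\<lambda>x. \<Sum>i\<le>n. c i * e i x)" for n
    by (intro square_integrable_sum square_integrable_cmult e)
  fix \<epsilon> :: real assume "\<epsilon> > 0"
  let ?a = "\<lambda>i. (c i)\<^sup>2 * (\<integral>x. (e i x)\<^sup>2 \<partial>M)"
  have "?a i \<ge> 0" for i by (simp add: integral_nonneg_AE)
  obtain N where N: "\<And>m n. m \<ge> N \<Longrightarrow> norm (sum ?a {m..<n}) < \<epsilon>"
    using sm[unfolded summable_Cauchy, rule_format, OF \<open>\<epsilon> > 0\<close>] by blast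
  have *: "(\<integral>x. ((\<Sum>i\<le>m. c i * e i x) - (\<Sum>i\<le>n. c i * e i x))\<^sup>2 \<partial>M) < \<epsilon>" if "m \<ge> N" "n \<ge> m" for m n
  proof -
    have "(\<Sum>i\<le>m. c i * e i x) - (\<Sum>i\<le>n. c i * e i x) = - (\<Sum>i\<in>{Suc m..<Suc n}. c i * e i x)" for x
    proof -
      have "{..n} = {..m} \<union> {Suc m..<Suc n}" using that by auto
      then have "(\<Sum>i\<le>n. c i * e i x) = (\<Sum>i\<le>m. c i * e i x) + (\<Sum>i\<in>{Suc m..<Suc n}. c i * e i x)"
        by (simp only:) (rule sum.union_disjoint, auto)
      then show ?thesis by simp
    qed
    then have "(\<integral>x. ((\<Sum>i\<le>m. c i * e i x) - (\<Sum>i\<le>n. c i * e i x))\<^sup>2 \<partial>M) = sum ?a {Suc m..<Suc n}"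
      by (simp add: integral_sum_orthogonal del: sum.op_ivl_Suc)
    then show ?thesis using N[of "Suc m" "Suc n"] that by (simp del: sum.op_ivl_Suc)
  qed
  show "\<exists>N. \<forall>m\<ge>N. \<forall>n\<ge>N. (\<integral>x. ((\<Sum>i\<le>m. c i * e i x) - (\<Sum>i\<le>n. c i * e i x))\<^sup>2 \<partial>M) < \<epsilon>"
  proof (intro exI allI impI)
    fix m n assume "m \<ge> N" "n \<ge> N"
    then show "(\<integral>x. ((\<Sum>i\<le>m. c i * e i x) - (\<Sum>i\<le>n. c i * e i x))\<^sup>2 \<partial>M) < \<epsilon>"
      using *[of m n] *[of n m] by (cases "m \<le> n") (auto simp: power2_commute)
  qed
qed (use that in blast)

text \<open>Bessel's inequality bounds the partial sums.\<close>

lemma fourier_coefficients_square_summable: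
  assumes g: "square_integrable M g" and pos: "\<And>i. (\<integral>x. (e i x)\<^sup>2 \<partial>M) > 0"
  defines "c \<equiv> \<lambda>i. (\<integral>x. g x * e i x \<partial>M) / (\<integral>x. (e i x)\<^sup>2 \<partial>M)"
  shows "summable (\<lambda>i. (c i)\<^sup>2 * (\<integral>x. (e i x)\<^sup>2 \<partial>M))"
proof (rule bounded_imp_summable)
  show "0 \<le> (c i)\<^sup>2 * (\<integral>x. (e i x)\<^sup>2 \<partial>M)" for i by (simp add: integral_nonneg_AE)
  fix n
  let ?S = "\<lambda>x. \<Sum>i\<le>n. c i * e i x"
  let ?s = "\<Sum>i\<le>n. (c i)\<^sup>2 * (\<integral>x. (e i x)\<^sup>2 \<partial>M)"
  have S: "square_integrable M ?S" by (intro square_integrable_sum square_integrable_cmult e)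
  have inner: "(\<integral>x. g x * ?S x \<partial>M) = ?s"
  proof -
    have "(\<integral>x. g x * ?S x \<partial>M) = (\<integral>x. (\<Sum>i\<le>n. c i * (g x * e i x)) \<partial>M)"
      by (intro Bochner_Integration.integral_cong refl) (simp add: sum_distrib_left mult_ac)
    also have "\<dots> = (\<Sum>i\<le>n. c i * (\<integral>x. g x * e i x \<partial>M))"
      using integrable_mult_square_integrable[OF g e] by (simp add: Bochner_Integration.integral_sum)
    also have "\<dots> = ?s"
    proof (intro sum.cong refl)
      fix i
      show "c i * (\<integral>x. g x * e i x \<partial>M) = (c i)\<^sup>2 * (\<integral>x. (e i x)\<^sup>2 \<partial>M)"
        using pos[of i] unfolding c_def by (simp add: power2_eq_square)
    qed
    finally show ?thesis .
  qed
  have "0 \<le> (\<integral>x. (g x - ?S x)\<^sup>2 \<partial>M)" by (rule integral_nonneg_AE) auto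
  also have "\<dots> = (\<integral>x. (g x)\<^sup>2 - 2 * (g x * ?S x) + (?S x)\<^sup>2 \<partial>M)"
    by (intro Bochner_Integration.integral_cong refl) (simp add: power2_eq_square algebra_simps)
  also have "\<dots> = (\<integral>x. (g x)\<^sup>2 \<partial>M) - 2 * (\<integral>x. g x * ?S x \<partial>M) + (\<integral>x. (?S x)\<^sup>2 \<partial>M)"
    using square_integrable_square[OF g] square_integrable_square[OF S]
      integrable_mult_square_integrable[OF g S] by simp
  also have "\<dots> = (\<integral>x. (g x)\<^sup>2 \<partial>M) - ?s"
    unfolding inner integral_sum_orthogonal[OF finite_atMost] by simp
  finally show "?s \<le> (\<integral>x. (g x)\<^sup>2 \<partial>M)" by simp
qed

text \<open>By Bessel's inequality and the Riesz--Fischer theorem the Fourier series converges to some \<open>F\<close>. The difference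
\<open>g - F\<close> has vanishing coefficients, hence is null by completeness.\<close>

theorem fourier_series_converges:
  assumes g: "square_integrable M g" and pos: "\<And>i. (\<integral>x. (e i x)\<^sup>2 \<partial>M) > 0"
    and complete: "\<And>h. square_integrable M h \<Longrightarrow> (\<And>i. (\<integral>x. h x * e i x \<partial>M) = 0) \<Longrightarrow> AE x in M. h x = 0"
  defines "c \<equiv> \<lambda>i. (\<integral>x. g x * e i x \<partial>M) / (\<integral>x. (e i x)\<^sup>2 \<partial>M)"
  shows "(\<lambda>n. \<integral>x. ((\<Sum>i\<le>n. c i * e i x) - g x)\<^sup>2 \<partial>M) \<longlonglongrightarrow> 0"
proof -
  let ?S = "\<lambda>n x. \<Sum>i\<le>n. c i * e i x"
  have S: "square_integrable M (?S n)" for n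
    by (intro square_integrable_sum square_integrable_cmult e)
  have sm: "summable (\<lambda>i. (c i)\<^sup>2 * (\<integral>x. (e i x)\<^sup>2 \<partial>M))"
    unfolding c_def by (rule fourier_coefficients_square_summable[OF g pos])
  obtain F where F: "square_integrable M F" and lim: "(\<lambda>n. \<integral>x. (?S n x - F x)\<^sup>2 \<partial>M) \<longlonglongrightarrow> 0"
    by (rule orthogonal_series_converges[OF sm])
  have "AE x in M. g x - F x = 0"
  proof (rule complete)
    show "square_integrable M (\<lambda>x. g x - F x)" by (intro square_integrable_diff g F)
    fix i
    let ?h = "\<integral>x. (e i x)\<^sup>2 \<partial>M"
    have SF: "square_integrable M (\<lambda>x. ?S n x - F x)" for n by (intro square_integrable_diff S F)
    have in_S: "(\<integral>x. ?S n x * e i x \<partial>M) = (\<integral>x. g x * e i x \<partial>M)" if "n \<ge> i" for n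
    proof -
      have "(\<integral>x. ?S n x * e i x \<partial>M) = (\<integral>x. (\<Sum>j\<le>n. c j * (e j x * e i x)) \<partial>M)"
        by (intro Bochner_Integration.integral_cong refl) (simp only: sum_distrib_right mult.assoc)
      also have "\<dots> = (\<Sum>j\<le>n. c j * (\<integral>x. e j x * e i x \<partial>M))"
        using integrable_mult_square_integrable[OF e e] by (simp add: Bochner_Integration.integral_sum)
      also have "\<dots> = (\<Sum>j\<le>n. if j = i then c i * ?h else 0)"
        by (intro sum.cong refl) (auto simp: orth power2_eq_square)
      also have "\<dots> = c i * ?h" using that by simp
      also have "\<dots> = (\<integral>x. g x * e i x \<partial>M)" using pos[of i] by (simp add: c_def)
      finally show ?thesis .
    qed
    have "(\<lambda>n. (\<integral>x. (?S n x - F x)\<^sup>2 \<partial>M) * ?h) \<longlonglongrightarrow> 0 * ?h"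
      by (intro tendsto_intros lim)
    moreover have "eventually (\<lambda>n. (\<integral>x. (g x - F x) * e i x \<partial>M)\<^sup>2 \<le> (\<integral>x. (?S n x - F x)\<^sup>2 \<partial>M) * ?h) sequentially"
    proof (rule eventually_sequentiallyI[of i])
      fix n assume n: "n \<ge> i"
      have "(\<integral>x. (g x - F x) * e i x \<partial>M) = (\<integral>x. (?S n x - F x) * e i x \<partial>M)"
        using in_S[OF n] integrable_mult_square_integrable[OF g e] integrable_mult_square_integrable[OF F e]
          integrable_mult_square_integrable[OF S e] by (simp add: left_diff_distrib)
      then show "(\<integral>x. (g x - F x) * e i x \<partial>M)\<^sup>2 \<le> (\<integral>x. (?S n x - F x)\<^sup>2 \<partial>M) * ?h"
        using integral_Cauchy_Schwarz[OF SF e] by simp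
    qed
    ultimately have "(\<integral>x. (g x - F x) * e i x \<partial>M)\<^sup>2 \<le> 0"
      by (intro tendsto_lowerbound[where F = sequentially]) auto
    then show "(\<integral>x. (g x - F x) * e i x \<partial>M) = 0" by simp
  qed
  then have "(\<integral>x. (?S n x - F x)\<^sup>2 \<partial>M) = (\<integral>x. (?S n x - g x)\<^sup>2 \<partial>M)" for n
  proof (intro integral_cong_AE)
    have [measurable]: "?S n \<in> borel_measurable M" "F \<in> borel_measurable M" "g \<in> borel_measurable M"
      using S F g by (auto simp: square_integrable_def)
    show "(\<lambda>x. (?S n x - F x)\<^sup>2) \<in> borel_measurable M" "(\<lambda>x. (?S n x - g x)\<^sup>2) \<in> borel_measurable M"
      by measurable
  qed (auto elim: eventually_mono)
  with lim show ?thesis by simp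
qed

end

section \<open>Functions on the unit interval with vanishing moments\<close>

text \<open>Bernstein polynomials approximate \<open>\<phi>\<close> uniformly, and \<open>k\<close> is integrable.\<close>

lemma integral_mult_continuous_eq_0:
  fixes k :: "real \<Rightarrow> real"
  assumes k: "integrable (lebesgue_on {0<..<1}) k"
    and mom: "\<And>P. (\<integral>x. k x * poly P x \<partial>lebesgue_on {0<..<1}) = 0"
    and \<phi>: "continuous_on {0..1} \<phi>"
  shows "(\<integral>x. k x * \<phi> x \<partial>lebesgue_on {0<..<1}) = 0"
proof -
  let ?\<mu> = "lebesgue_on {0<..<1::real}"
  define I where "I = (\<integral>x. \<bar>k x\<bar> \<partial>?\<mu>)"
  have "I \<ge> 0" unfolding I_def by (rule integral_nonneg_AE) auto
  have [measurable]: "k \<in> borel_measurable ?\<mu>" using k by auto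
  have [measurable]: "\<phi> \<in> borel_measurable ?\<mu>"
    by (rule continuous_imp_measurable_on_sets_lebesgue)
       (auto intro: continuous_on_subset[OF \<phi>])
  have [measurable]: "poly P \<in> borel_measurable ?\<mu>" for P :: "real poly"
    by (rule continuous_imp_measurable_on_sets_lebesgue) (auto intro: continuous_intros)
  have "\<bar>\<integral>x. k x * \<phi> x \<partial>?\<mu>\<bar> \<le> \<epsilon> * I" if "\<epsilon> > 0" for \<epsilon>
  proof -
    obtain n where n: "\<And>x. x \<in> {0..1} \<Longrightarrow> \<bar>\<phi> x - (\<Sum>i\<le>n. \<phi> (i / n) * Bernstein n i x)\<bar> < \<epsilon>"
      using Bernstein_Weierstrass[OF \<phi> \<open>\<epsilon> > 0\<close>] by (metis order_refl)
    define P where "P = (\<Sum>i\<le>n. smult (\<phi> (i / n) * of_nat (n choose i)) ([:0, 1:] ^ i * [:1, -1:] ^ (n - i)))"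
    have P: "poly P x = (\<Sum>i\<le>n. \<phi> (i / n) * Bernstein n i x)" for x
      by (simp add: P_def poly_sum Bernstein_def mult_ac)
    have close: "\<bar>k x * (\<phi> x - poly P x)\<bar> \<le> \<epsilon> * \<bar>k x\<bar>" if "x \<in> space ?\<mu>" for x
      using n[of x] that mult_left_mono[of "\<bar>\<phi> x - poly P x\<bar>" \<epsilon> "\<bar>k x\<bar>"]
      by (simp add: P abs_mult mult.commute[of \<epsilon>])
    have i1: "integrable ?\<mu> (\<lambda>x. k x * (\<phi> x - poly P x))"
    proof (rule Bochner_Integration.integrable_bound)
      show "integrable ?\<mu> (\<lambda>x. \<epsilon> * \<bar>k x\<bar>)" using k by simp
    qed (use close \<open>\<epsilon> > 0\<close> in \<open>auto simp: abs_mult\<close>)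
    have "bounded (poly P ` {0..1})"
      by (intro compact_imp_bounded compact_continuous_image continuous_intros) auto
    then obtain B where B: "\<And>x. x \<in> {0..1} \<Longrightarrow> \<bar>poly P x\<bar> \<le> B"
      unfolding bounded_iff by force
    have i2: "integrable ?\<mu> (\<lambda>x. k x * poly P x)"
    proof (rule Bochner_Integration.integrable_bound)
      show "integrable ?\<mu> (\<lambda>x. B * \<bar>k x\<bar>)" using k by simp
      show "AE x in ?\<mu>. norm (k x * poly P x) \<le> norm (B * \<bar>k x\<bar>)"
      proof (rule AE_I2)
        fix x assume "x \<in> space ?\<mu>"
        then have "\<bar>poly P x\<bar> \<le> B" by (intro B) auto
        then show "norm (k x * poly P x) \<le> norm (B * \<bar>k x\<bar>)"
          using mult_right_mono[of "\<bar>poly P x\<bar>" "\<bar>B\<bar>" "\<bar>k x\<bar>"] by (simp add: abs_mult mult.commute)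
      qed
    qed measurable
    have "(\<integral>x. k x * \<phi> x \<partial>?\<mu>) = (\<integral>x. k x * (\<phi> x - poly P x) + k x * poly P x \<partial>?\<mu>)"
      by (simp add: algebra_simps)
    also have "\<dots> = (\<integral>x. k x * (\<phi> x - poly P x) \<partial>?\<mu>) + (\<integral>x. k x * poly P x \<partial>?\<mu>)"
      by (rule Bochner_Integration.integral_add[OF i1 i2])
    finally have "(\<integral>x. k x * \<phi> x \<partial>?\<mu>) = (\<integral>x. k x * (\<phi> x - poly P x) \<partial>?\<mu>)"
      by (simp add: mom)
    also have "\<bar>\<dots>\<bar> \<le> (\<integral>x. \<epsilon> * \<bar>k x\<bar> \<partial>?\<mu>)"
      by (rule order_trans[OF integral_abs_bound])
         (intro integral_mono integrable_abs i1 integrable_mult_right k close)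
    finally show ?thesis by (simp add: I_def)
  qed
  note * = this
  show ?thesis
  proof (rule ccontr)
    assume "(\<integral>x. k x * \<phi> x \<partial>?\<mu>) \<noteq> 0" (is "?J \<noteq> 0")
    then have "\<bar>?J\<bar> \<le> \<bar>?J\<bar> / (2 * (I + 1)) * I" using \<open>I \<ge> 0\<close> by (intro *) auto
    then have "\<bar>?J\<bar> * (2 * (I + 1)) \<le> \<bar>?J\<bar> * I" using \<open>I \<ge> 0\<close> by (simp add: field_simps)
    then have "2 * (I + 1) \<le> I" using \<open>?J \<noteq> 0\<close> by (subst (asm) mult_le_cancel_left_pos) auto
    then show False using \<open>I \<ge> 0\<close> by simp
  qed
qed

text \<open>Approximating the indicator of a half-line by continuous ramps shows that \<open>k\<close> integrates to 0 over every half-line.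
So the positive and the negative part of \<open>k\<close> are densities of the same finite measure.\<close>

theorem all_moments_zero_imp_AE_zero:
  fixes k :: "real \<Rightarrow> real"
  assumes k: "integrable (lebesgue_on {0<..<1}) k"
    and mom: "\<And>P. (\<integral>x. k x * poly P x \<partial>lebesgue_on {0<..<1}) = 0"
  shows "AE x in lebesgue_on {0<..<1}. k x = 0"
proof -
  let ?\<mu> = "lebesgue_on {0<..<1::real}"
  have [measurable]: "k \<in> borel_measurable ?\<mu>" using k by auto
  have tail: "(\<integral>x. k x * indicator {c<..} x \<partial>?\<mu>) = 0" for c
  proof (rule LIMSEQ_unique)
    define \<phi> where "\<phi> n x = max 0 (min 1 (real n * (x - c)))" for n x
    have cont: "continuous_on S (\<phi> n)" for n S unfolding \<phi>_def by (intro continuous_intros)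
    have [measurable]: "\<phi> n \<in> borel_measurable ?\<mu>" for n
      by (rule continuous_imp_measurable_on_sets_lebesgue) (auto intro: cont)
    have [measurable]: "indicator {c<..} \<in> borel_measurable ?\<mu>"
      by (simp add: borel_measurable_if_lebesgue_on measurable_restrict_space1 borel_measurable_indicator)
    have "(\<lambda>n. \<integral>x. k x * \<phi> n x \<partial>?\<mu>) \<longlonglongrightarrow> (\<integral>x. k x * indicator {c<..} x \<partial>?\<mu>)"
    proof (rule integral_dominated_convergence)
      show "integrable ?\<mu> (\<lambda>x. \<bar>k x\<bar>)" using k by simp
      show "AE x in ?\<mu>. (\<lambda>n. k x * \<phi> n x) \<longlonglongrightarrow> k x * indicator {c<..} x"
      proof (rule AE_I2)
        fix x
        have "(\<lambda>n. \<phi> n x) \<longlonglongrightarrow> indicator {c<..} x"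
        proof (cases "x > c")
          case True
          obtain n where n: "1 / (x - c) < real n" using reals_Archimedean2 by blast
          have "\<phi> m x = 1" if "m \<ge> n" for m
          proof -
            have "1 < real n * (x - c)" using n True by (simp add: field_simps)
            also have "\<dots> \<le> real m * (x - c)" using that True by (intro mult_right_mono) auto
            finally show ?thesis by (simp add: \<phi>_def)
          qed
          then show ?thesis using True
            by (intro tendsto_eventually eventually_sequentiallyI[of n]) auto
        next
          case False
          then have le: "real m * (x - c) \<le> 0" for m by (intro mult_nonneg_nonpos) auto
          have "\<phi> m x = 0" for m unfolding \<phi>_def using le[of m] by linarith
          then show ?thesis using False by simp
        qed
        then show "(\<lambda>n. k x * \<phi> n x) \<longlonglongrightarrow> k x * indicator {c<..} x" by (intro tendsto_intros)
      qed
      show "AE x in ?\<mu>. norm (k x * \<phi> n x) \<le> \<bar>k x\<bar>" for n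
        by (rule AE_I2) (auto simp: \<phi>_def abs_mult intro!: mult_left_le)
    qed measurable
    then show "(\<lambda>n. 0) \<longlonglongrightarrow> (\<integral>x. k x * indicator {c<..} x \<partial>?\<mu>)"
      using integral_mult_continuous_eq_0[OF k mom cont] by simp
  qed auto
  \<comment> \<open>Uniqueness of measures is applied on Borel sets, hence to a Borel version of k.\<close>
  define k0 where "k0 x = indicator {0<..<1} x * k x" for x
  have k0_int: "integrable lebesgue k0"
    using k integrable_restrict_space[of "{0<..<1::real}" lebesgue k] by (simp add: k0_def[abs_def])
  then obtain k' where [measurable]: "k' \<in> borel_measurable borel" and k': "AE x in lborel. k0 x = k' x"
    using completion_ex_borel_measurable_real[of k0 lborel] by auto
  have k'_int: "integrable lborel k'"
  proof -
    have "integrable lebesgue k'"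
    proof (rule integrable_cong_AE_imp[OF k0_int])
      show "AE x in lebesgue. k0 x = k' x" using AE_completion[OF k'] by auto
    qed (auto intro: measurable_completion)
    then show ?thesis by (simp add: integrable_completion)
  qed
  have tail': "(\<integral>x. k' x * indicator {c<..} x \<partial>lborel) = 0" for c
  proof -
    have "(\<integral>x. k' x * indicator {c<..} x \<partial>lborel) = (\<integral>x. k' x * indicator {c<..} x \<partial>lebesgue)"
      by (simp add: integral_completion)
    also have "\<dots> = (\<integral>x. k0 x * indicator {c<..} x \<partial>lebesgue)"
    proof (rule integral_cong_AE)
      show "AE x in lebesgue. k' x * indicator {c<..} x = k0 x * indicator {c<..} x"
        using AE_completion[OF k'] by auto
      have "k0 \<in> borel_measurable lebesgue" using k0_int by auto
      moreover have "indicator {c<..} \<in> borel_measurable (lebesgue :: real measure)"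
        by (rule borel_measurable_indicator) auto
      ultimately show "(\<lambda>x. k0 x * indicator {c<..} x) \<in> borel_measurable lebesgue"
        by (rule borel_measurable_times)
    qed (auto intro: measurable_completion)
    also have "\<dots> = (\<integral>x. indicator {0<..<1} x *\<^sub>R (k x * indicator {c<..} x) \<partial>lebesgue)"
      by (simp add: k0_def mult_ac)
    also have "\<dots> = (\<integral>x. k x * indicator {c<..} x \<partial>?\<mu>)"
      by (rule integral_restrict_space[symmetric]) auto
    finally show ?thesis by (simp add: tail)
  qed
  have "density lborel (\<lambda>x. ennreal (k' x)) = density lborel (\<lambda>x. ennreal (- k' x))"
  proof (rule measure_eqI_lessThan)
    have ip: "integrable lborel (\<lambda>x. max 0 (k' x) * indicator {c<..} x)" 
      and im: "integrable lborel (\<lambda>x. max 0 (- k' x) * indicator {c<..} x)" for c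
      by (rule Bochner_Integration.integrable_bound[OF k'_int], auto split: split_indicator)+
    have em: "emeasure (density lborel (\<lambda>x. ennreal (h x))) {c<..} = ennreal (\<integral>x. max 0 (h x) * indicator {c<..} x \<partial>lborel)"
      if [measurable]: "h \<in> borel_measurable borel" and h: "integrable lborel (\<lambda>x. max 0 (h x) * indicator {c<..} x)" for h and c :: real
    proof -
      have "emeasure (density lborel (\<lambda>x. ennreal (h x))) {c<..} = (\<integral>\<^sup>+x. ennreal (h x) * indicator {c<..} x \<partial>lborel)"
        by (rule emeasure_density) simp_all
      also have "\<dots> = (\<integral>\<^sup>+x. ennreal (max 0 (h x) * indicator {c<..} x) \<partial>lborel)"
        by (intro nn_integral_cong) (auto split: split_indicator simp: max_def ennreal_neg)
      also have "\<dots> = ennreal (\<integral>x. max 0 (h x) * indicator {c<..} x \<partial>lborel)"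
        by (intro nn_integral_eq_integral h) auto
      finally show ?thesis .
    qed
    show "emeasure (density lborel (\<lambda>x. ennreal (k' x))) {c<..} = emeasure (density lborel (\<lambda>x. ennreal (- k' x))) {c<..}" for c
    proof -
      have "(\<integral>x. max 0 (k' x) * indicator {c<..} x \<partial>lborel) - (\<integral>x. max 0 (- k' x) * indicator {c<..} x \<partial>lborel)
        = (\<integral>x. max 0 (k' x) * indicator {c<..} x - max 0 (- k' x) * indicator {c<..} x \<partial>lborel)"
        by (rule Bochner_Integration.integral_diff[OF ip im, symmetric])
      also have "\<dots> = (\<integral>x. k' x * indicator {c<..} x \<partial>lborel)"
        by (intro Bochner_Integration.integral_cong refl) (auto split: split_indicator)
      finally show ?thesis by (simp add: em[OF _ ip] em[OF _ im] tail')
    qed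
    show "emeasure (density lborel (\<lambda>x. ennreal (k' x))) {c<..} < \<infinity>" for c
      by (simp add: em[OF _ ip])
  qed auto
  moreover have "integral\<^sup>N lborel (\<lambda>x. ennreal (k' x)) \<noteq> \<infinity>"
  proof -
    have "integral\<^sup>N lborel (\<lambda>x. ennreal (k' x)) \<le> integral\<^sup>N lborel (\<lambda>x. ennreal (norm (k' x)))"
      by (intro nn_integral_mono) (auto intro: ennreal_leI)
    also have "\<dots> < \<infinity>" using k'_int by (simp add: integrable_iff_bounded)
    finally show ?thesis by simp
  qed
  ultimately have "AE x in lborel. ennreal (k' x) = ennreal (- k' x)"
    by (subst (asm) finite_density_unique) auto
  moreover have "t = 0" if "ennreal t = ennreal (- t)" for t
    using that by (cases "t \<ge> 0") (auto simp: ennreal_neg ennreal_eq_0_iff dest!: sym[of 0])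
  ultimately have "AE x in lborel. k0 x = 0"
    using k' by (auto elim: eventually_elim2)
  then have "AE x in lebesgue. k0 x = 0" by (rule AE_completion)
  then show ?thesis
    by (subst AE_restrict_space_iff) (auto simp: k0_def elim: eventually_mono)
qed

section \<open>The Jacobi measures on the unit interval\<close>

text \<open>With the weight absorbed into the measure, the weighted spaces and inner products become ordinary ones.\<close>

definition jacobi_measure :: "real \<Rightarrow> real \<Rightarrow> real measure" where
  "jacobi_measure a b = density (lebesgue_on {0<..<1}) (\<lambda>x. ennreal (wt a b x))"

lemma borel_measurable_lebesgue_on:
  "f \<in> borel_measurable borel \<Longrightarrow> f \<in> borel_measurable (lebesgue_on S)"
  by (intro measurable_restrict_space1 measurable_completion) simp

lemma wt_measurable: "wt a b \<in> borel_measurable borel"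
  unfolding wt_def by measurable

lemma ennreal_wt_measurable: "(\<lambda>x. ennreal (wt a b x)) \<in> borel_measurable (lebesgue_on S)"
  by (intro measurable_compose[OF borel_measurable_lebesgue_on[OF wt_measurable]]) auto

lemma wt_pos: "x \<in> {0<..<1} \<Longrightarrow> wt a b x > 0"
  by (simp add: wt_def)

lemma wt_nonneg: "x \<in> {0<..<1} \<Longrightarrow> wt a b x \<ge> 0"
  by (simp add: wt_def)

lemma space_jacobi_measure [simp]: "space (jacobi_measure a b) = {0<..<1}"
  by (simp add: jacobi_measure_def)

lemma sets_jacobi_measure: "sets (jacobi_measure a b) = sets (lebesgue_on {0<..<1})"
  by (simp add: jacobi_measure_def)

lemma borel_measurable_jacobi_measure:
  "borel_measurable (jacobi_measure a b) = borel_measurable (lebesgue_on {0<..<1})"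
  by (intro measurable_cong_sets sets_jacobi_measure refl)

lemma AE_jacobi_measure_iff:
  "(AE x in jacobi_measure a b. P x) \<longleftrightarrow> (AE x in lebesgue_on {0<..<1}. P x)"
proof -
  have "(AE x in jacobi_measure a b. P x) \<longleftrightarrow> (AE x in lebesgue_on {0<..<1}. 0 < ennreal (wt a b x) \<longrightarrow> P x)"
    unfolding jacobi_measure_def
    by (subst AE_density) (auto intro: ennreal_wt_measurable)
  also have "\<dots> \<longleftrightarrow> (AE x in lebesgue_on {0<..<1}. P x)"
    by (intro AE_cong) (auto simp: wt_pos)
  finally show ?thesis .
qed

lemma integral_jacobi_measure:
  fixes f :: "real \<Rightarrow> real"
  assumes "f \<in> borel_measurable (lebesgue_on {0<..<1})"
  shows "(\<integral>x. f x \<partial>jacobi_measure a b) = (\<integral>x. wt a b x * f x \<partial>lebesgue_on {0<..<1})"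
  unfolding jacobi_measure_def
  using assms by (subst integral_density)
    (auto intro!: borel_measurable_lebesgue_on wt_measurable AE_I2 wt_nonneg)

lemma integrable_jacobi_measure_iff:
  fixes f :: "real \<Rightarrow> real"
  assumes "f \<in> borel_measurable (lebesgue_on {0<..<1})"
  shows "integrable (jacobi_measure a b) f \<longleftrightarrow> integrable (lebesgue_on {0<..<1}) (\<lambda>x. wt a b x * f x)"
  unfolding jacobi_measure_def
  using assms by (subst integrable_density)
    (auto intro!: borel_measurable_lebesgue_on wt_measurable AE_I2 wt_nonneg)

lemma nn_integral_lebesgue_on:
  assumes "S \<in> sets lebesgue"
  shows "(\<integral>\<^sup>+x. f x \<partial>lebesgue_on S) = (\<integral>\<^sup>+x. f x * indicator S x \<partial>lborel)"
  using assms by (simp add: nn_integral_restrict_space nn_integral_completion)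

lemma nn_integral_wt:
  assumes "a > -1" "b > -1"
  shows "(\<integral>\<^sup>+x. ennreal (wt a b x) \<partial>lebesgue_on {0<..<1}) = ennreal (Beta (b + 1) (a + 1))"
proof -
  have "((\<lambda>t. wt a b t) has_integral Beta (b + 1) (a + 1)) {0<..<1}"
    using has_integral_Beta_real[of "b + 1" "a + 1"] assms
    by (simp add: has_integral_Icc_iff_Ioo wt_def mult.commute)
  from nn_integral_has_integral_lebesgue[OF _ this]
  have "(\<integral>\<^sup>+x. ennreal (indicator {0<..<1} x * wt a b x) \<partial>lborel) = ennreal (Beta (b + 1) (a + 1))"
    by (simp add: wt_nonneg)
  also have "(\<integral>\<^sup>+x. ennreal (indicator {0<..<1} x * wt a b x) \<partial>lborel)
      = (\<integral>\<^sup>+x. ennreal (wt a b x) * indicator {0<..<1} x \<partial>lborel)"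
    by (intro nn_integral_cong) (auto split: split_indicator)
  finally show ?thesis by (simp add: nn_integral_lebesgue_on)
qed

lemma emeasure_jacobi_measure:
  assumes "a > -1" "b > -1"
  shows "emeasure (jacobi_measure a b) {0<..<1} = ennreal (Beta (b + 1) (a + 1))"
proof -
  have "emeasure (jacobi_measure a b) {0<..<1}
      = (\<integral>\<^sup>+x. ennreal (wt a b x) * indicator {0<..<1} x \<partial>lebesgue_on {0<..<1})"
    unfolding jacobi_measure_def
    by (rule emeasure_density)
       (auto intro: ennreal_wt_measurable simp: sets_restrict_space)
  also have "\<dots> = (\<integral>\<^sup>+x. ennreal (wt a b x) \<partial>lebesgue_on {0<..<1})"
    by (intro nn_integral_cong) auto
  finally show ?thesis using nn_integral_wt[OF assms] by simp
qed

lemma finite_measure_jacobi: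
  assumes "a > -1" "b > -1"
  shows "finite_measure (jacobi_measure a b)"
  by (rule finite_measureI) (simp add: emeasure_jacobi_measure[OF assms])

lemma poly_bounded_unit_interval:
  fixes P :: "real poly"
  obtains B where "B \<ge> 0" "\<And>x. x \<in> {0..1} \<Longrightarrow> \<bar>poly P x\<bar> \<le> B"
proof -
  have "bounded (poly P ` {0..1})"
    by (intro compact_imp_bounded compact_continuous_image continuous_intros) auto
  then obtain B where "\<And>x. x \<in> {0..1} \<Longrightarrow> \<bar>poly P x\<bar> \<le> B"
    unfolding bounded_iff by force
  from this that[of B] this[of 0] show thesis by force
qed

lemma poly_measurable: "poly P \<in> borel_measurable (borel :: real measure)"
  for P :: "real poly"
  by (intro borel_measurable_continuous_onI continuous_intros)

lemma integrable_bounded_jacobi: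
  assumes "a > -1" "b > -1" "f \<in> borel_measurable (lebesgue_on {0<..<1})"
    "\<And>x. x \<in> {0<..<1} \<Longrightarrow> \<bar>f x\<bar> \<le> (B :: real)"
  shows "integrable (jacobi_measure a b) f"
proof -
  interpret finite_measure "jacobi_measure a b" by (rule finite_measure_jacobi) fact+
  show ?thesis using assms(3,4)
    by (intro integrable_const_bound[of _ B]) (auto simp: borel_measurable_jacobi_measure)
qed

lemma integrable_poly_jacobi:
  assumes "a > -1" "b > -1"
  shows "integrable (jacobi_measure a b) (poly P)"
proof -
  obtain B where "B \<ge> 0" "\<And>x. x \<in> {0..1} \<Longrightarrow> \<bar>poly P x\<bar> \<le> B"
    by (rule poly_bounded_unit_interval[of P]) blast
  then show ?thesis using assms
    by (intro integrable_bounded_jacobi[where B = B] borel_measurable_lebesgue_on poly_measurable) auto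
qed

abbreviation jint :: "real \<Rightarrow> real \<Rightarrow> real poly \<Rightarrow> real" where
  "jint a b P \<equiv> \<integral>x. poly P x \<partial>jacobi_measure a b"

lemma jint_add:
  assumes "a > -1" "b > -1"
  shows "jint a b (P + Q) = jint a b P + jint a b Q"
  using integrable_poly_jacobi[OF assms] by simp

lemma jint_smult: "jint a b (smult c P) = c * jint a b P"
  by simp

lemma jint_one: 
  assumes "a > -1" "b > -1"
  shows "jint a b 1 = Beta (b + 1) (a + 1)"
  using emeasure_jacobi_measure[OF assms] assms
  by (simp add: measure_def Beta_def Gamma_real_pos divide_nonneg_pos)

section \<open>Jacobi polynomials\<close>

definition jacobi_poly :: "nat \<Rightarrow> real \<Rightarrow> real \<Rightarrow> real poly" where
  "jacobi_poly n a b =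
     (\<Sum>s\<le>n. smult (((real n + a) gchoose (n - s)) * ((real n + b) gchoose s)) ([:-1, 1:] ^ s * [:0, 1:] ^ (n - s)))"

lemma poly_jacobi_poly: "poly (jacobi_poly n a b) x = jacobi_G n a b x"
proof -
  have *: "(2 * x - 1 - 1) / 2 = x - 1" "(2 * x - 1 + 1) / 2 = x" by simp_all
  show ?thesis
    unfolding jacobi_poly_def jacobi_G_def jacobi_P_def * by (simp add: poly_sum mult.assoc)
qed

lemma degree_jacobi_poly: "degree (jacobi_poly n a b) \<le> n"
  unfolding jacobi_poly_def
proof (intro degree_sum_le order_trans[OF degree_smult_le])
  fix s assume "s \<in> {..n}"
  have "degree ([:-1, 1:] ^ s * [:0, 1:] ^ (n - s) :: real poly) \<le> 1 * s + 1 * (n - s)"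
    by (intro order_trans[OF degree_mult_le] add_mono order_trans[OF degree_power_le]) simp_all
  then show "degree ([:-1, 1:] ^ s * [:0, 1:] ^ (n - s) :: real poly) \<le> n"
    using \<open>s \<in> {..n}\<close> by simp
qed simp

text \<open>The operator \<open>x * (1 - x) * d/dx\<close> acts on the products \<open>(x - 1) ^ s * x ^ k\<close> by raising one exponent at a time.\<close>

lemma power_basis_deriv:
  fixes x :: real
  shows "x * (1 - x) * poly (pderiv ([:-1, 1:] ^ s * [:0, 1:] ^ k)) x
       = - real s * (x - 1) ^ s * x ^ Suc k - real k * (x - 1) ^ Suc s * x ^ k"
proof -
  have "poly (pderiv ([:-1, 1:] ^ s)) x = real s * (x - 1) ^ (s - 1)"
    unfolding pderiv_power by (simp add: pderiv_pCons)
  then have 1: "poly (pderiv ([:-1, 1:] ^ s)) x * (1 - x) = - real s * (x - 1) ^ s"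
    by (cases s) (simp_all add: algebra_simps)
  have "poly (pderiv ([:0, 1:] ^ k)) x = real k * x ^ (k - 1)"
    unfolding pderiv_power by (simp add: pderiv_pCons)
  then have 2: "poly (pderiv ([:0, 1:] ^ k)) x * x = real k * x ^ k"
    by (cases k) (simp_all add: algebra_simps)
  have "x * (1 - x) * poly (pderiv ([:-1, 1:] ^ s * [:0, 1:] ^ k)) x
     = (poly (pderiv ([:-1, 1:] ^ s)) x * (1 - x)) * x * x ^ k
       + (poly (pderiv ([:0, 1:] ^ k)) x * x) * (1 - x) * (x - 1) ^ s"
    by (simp add: pderiv_mult algebra_simps)
  also have "\<dots> = - real s * (x - 1) ^ s * x ^ Suc k - real k * (x - 1) ^ Suc s * x ^ k"
    unfolding 1 2 by (simp add: algebra_simps)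
  finally show ?thesis .
qed

lemma gchoose_absorb: "(z - real k) * (z gchoose k) = real (Suc k) * (z gchoose Suc k)" for z :: real
  using gbinomial_absorb_comp[of z k] gbinomial_absorption[of k z] by (simp add: mult_ac)

lemma pderiv_sum: "pderiv (sum f A) = (\<Sum>x\<in>A. pderiv (f x))"
  using higher_pderiv_sum[of 1 f A] by simp

text \<open>This is Rodrigues' formula in one step: the left-hand side is the derivative of \<open>wt (a + 1) (b + 1)\<close> times the
polynomial, divided by \<open>wt a b\<close>. In the basis \<open>(x - 1) ^ t * x ^ (n + 1 - t)\<close> the coefficient receives the two
contributions \<open>n + 1 - t\<close> and \<open>t\<close>, by the absorption identities for binomial coefficients.\<close>

lemma jacobi_poly_raise:
  "[:b + 1, - (a + b + 2):] * jacobi_poly n (a + 1) (b + 1) + [:0, 1, -1:] * pderiv (jacobi_poly n (a + 1) (b + 1))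
    = smult (- real (Suc n)) (jacobi_poly (Suc n) a b)"
proof (rule poly_eq_poly_eq_iff[THEN iffD1], rule ext)
  fix x :: real
  define A where "A t = ((real (Suc n) + a) gchoose (Suc n - t))" for t
  define B where "B t = ((real (Suc n) + b) gchoose t)" for t
  define E where "E t = (x - 1) ^ t * x ^ (Suc n - t)" for t
  let ?T = "\<lambda>s. [:-1, 1:] ^ s * [:0, 1:] ^ (n - s) :: real poly"
  have J: "jacobi_poly n (a + 1) (b + 1) = (\<Sum>s\<le>n. smult (A (Suc s) * B s) (?T s))"
    unfolding jacobi_poly_def A_def B_def by (simp add: algebra_simps)
  have A_rec: "(a + 1 + real s) * A (Suc s) = (real (Suc n) - real s) * A s" if "s \<le> n" for s
    using gchoose_absorb[of "real (Suc n) + a" "n - s"] that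
    by (simp add: A_def of_nat_diff Suc_diff_le algebra_simps)
  have B_rec: "(b + 1 + real n - real s) * B s = real (Suc s) * B (Suc s)" for s
    using gchoose_absorb[of "real (Suc n) + b" s] by (simp add: B_def algebra_simps)
  have "poly ([:b + 1, - (a + b + 2):] * jacobi_poly n (a + 1) (b + 1)
          + [:0, 1, -1:] * pderiv (jacobi_poly n (a + 1) (b + 1))) x
     = (\<Sum>s\<le>n. A (Suc s) * B s * (((b + 1) * (1 - x) - (a + 1) * x) * poly (?T s) x
          + x * (1 - x) * poly (pderiv (?T s)) x))"
    unfolding J pderiv_sum pderiv_smult
    by (simp add: poly_sum sum_distrib_left sum.distrib[symmetric] algebra_simps del: poly_mult poly_power)
  also have "\<dots> = (\<Sum>s\<le>n. - (real (Suc n) - real s) * (A s * B s * E s) - real (Suc s) * (A (Suc s) * B (Suc s) * E (Suc s)))"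
  proof (rule sum.cong[OF refl])
    fix s assume "s \<in> {..n}"
    then have s: "s \<le> n" by simp
    have E1: "E s = (x - 1) ^ s * x ^ Suc (n - s)" using s by (simp add: E_def Suc_diff_le)
    have E2: "E (Suc s) = (x - 1) ^ Suc s * x ^ (n - s)" by (simp add: E_def)
    have "((b + 1) * (1 - x) - (a + 1) * x) * poly (?T s) x + x * (1 - x) * poly (pderiv (?T s)) x
       = - (a + 1 + real s) * E s - (b + 1 + real n - real s) * E (Suc s)"
      unfolding power_basis_deriv E1 E2 using s by (simp add: of_nat_diff algebra_simps)
    then have "A (Suc s) * B s * (((b + 1) * (1 - x) - (a + 1) * x) * poly (?T s) x + x * (1 - x) * poly (pderiv (?T s)) x)
       = - ((a + 1 + real s) * A (Suc s)) * B s * E s - A (Suc s) * ((b + 1 + real n - real s) * B s) * E (Suc s)"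
      by (simp only:) (simp add: algebra_simps)
    also have "\<dots> = - (real (Suc n) - real s) * (A s * B s * E s) - real (Suc s) * (A (Suc s) * B (Suc s) * E (Suc s))"
      unfolding A_rec[OF s] B_rec by (simp add: algebra_simps)
    finally show "A (Suc s) * B s * (((b + 1) * (1 - x) - (a + 1) * x) * poly (?T s) x + x * (1 - x) * poly (pderiv (?T s)) x)
       = - (real (Suc n) - real s) * (A s * B s * E s) - real (Suc s) * (A (Suc s) * B (Suc s) * E (Suc s))" .
  qed
  also have "\<dots> = - (\<Sum>s\<le>n. (real (Suc n) - real s) * (A s * B s * E s)) - (\<Sum>s\<le>n. real (Suc s) * (A (Suc s) * B (Suc s) * E (Suc s)))"
    by (simp only: sum_subtractf mult_minus_left sum_negf)
  also have "(\<Sum>s\<le>n. (real (Suc n) - real s) * (A s * B s * E s)) = (\<Sum>s\<le>Suc n. (real (Suc n) - real s) * (A s * B s * E s))"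
    by simp
  also have "(\<Sum>s\<le>n. real (Suc s) * (A (Suc s) * B (Suc s) * E (Suc s))) = (\<Sum>s\<le>Suc n. real s * (A s * B s * E s))"
    by (subst sum.atMost_Suc_shift) simp
  also have "- (\<Sum>s\<le>Suc n. (real (Suc n) - real s) * (A s * B s * E s)) - (\<Sum>s\<le>Suc n. real s * (A s * B s * E s))
     = - real (Suc n) * (\<Sum>s\<le>Suc n. A s * B s * E s)"
    unfolding sum_distrib_left sum_negf[symmetric] sum_subtractf[symmetric]
    by (intro sum.cong refl) (simp add: algebra_simps)
  also have "\<dots> = poly (smult (- real (Suc n)) (jacobi_poly (Suc n) a b)) x"
    unfolding jacobi_poly_def A_def B_def E_def by (simp add: poly_sum mult.assoc del: sum.atMost_Suc)
  finally show "poly ([:b + 1, - (a + b + 2):] * jacobi_poly n (a + 1) (b + 1)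
          + [:0, 1, -1:] * pderiv (jacobi_poly n (a + 1) (b + 1))) x
     = poly (smult (- real (Suc n)) (jacobi_poly (Suc n) a b)) x" .
qed

lemma wt_poly_has_derivative:
  assumes x: "x \<in> {0<..<1}"
  shows "((\<lambda>x. wt (a + 1) (b + 1) x * poly P x) has_real_derivative
     wt a b x * poly ([:b + 1, - (a + b + 2):] * P + [:0, 1, -1:] * pderiv P) x) (at x)"
proof -
  have pw: "(1 - x) powr (a + 1) = (1 - x) powr a * (1 - x)" "x powr (b + 1) = x powr b * x"
    using x by (simp_all add: powr_add)
  have "((\<lambda>x. (1 - x) powr (a + 1) * x powr (b + 1) * poly P x) has_real_derivative
     (- ((a + 1) * (1 - x) powr a) * x powr (b + 1) + (1 - x) powr (a + 1) * ((b + 1) * x powr b)) * poly P x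
      + (1 - x) powr (a + 1) * x powr (b + 1) * poly (pderiv P) x) (at x)"
    using x by (auto intro!: derivative_eq_intros poly_DERIV simp: algebra_simps)
  also have "(- ((a + 1) * (1 - x) powr a) * x powr (b + 1) + (1 - x) powr (a + 1) * ((b + 1) * x powr b)) * poly P x
      + (1 - x) powr (a + 1) * x powr (b + 1) * poly (pderiv P) x
     = wt a b x * poly ([:b + 1, - (a + b + 2):] * P + [:0, 1, -1:] * pderiv P) x"
    unfolding pw wt_def by (simp add: algebra_simps)
  finally show ?thesis by (simp add: wt_def)
qed

lemma wt_jacobi_poly_has_derivative:
  assumes "x \<in> {0<..<1}"
  shows "((\<lambda>x. wt (a + 1) (b + 1) x * poly (jacobi_poly n (a + 1) (b + 1)) x) has_real_derivative
     - real (Suc n) * (wt a b x * poly (jacobi_poly (Suc n) a b) x)) (at x)"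
  using wt_poly_has_derivative[OF assms, of a b "jacobi_poly n (a + 1) (b + 1)"]
  unfolding jacobi_poly_raise by (simp add: mult_ac)

lemma continuous_on_wt_poly:
  assumes "a > 0" "b > 0"
  shows "continuous_on {0..1} (\<lambda>x. wt a b x * poly P x)"
  unfolding wt_def using assms by (intro continuous_intros continuous_on_powr') auto

text \<open>The boundary terms vanish because the raised weight is 0 at both endpoints.\<close>

lemma integration_by_parts_jacobi:
  assumes ab: "a > -1" "b > -1"
    and R: "R = [:b + 1, - (a + b + 2):] * P + [:0, 1, -1:] * pderiv P"
  shows "jint a b (R * Q) = - jint (a + 1) (b + 1) (P * pderiv Q)"
proof -
  let ?\<mu> = "lebesgue_on {0<..<1::real}"
  let ?h = "\<lambda>x. wt (a + 1) (b + 1) x * poly (P * Q) x"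
  let ?h' = "\<lambda>x. wt a b x * poly (R * Q) x + wt (a + 1) (b + 1) x * poly (P * pderiv Q) x"
  have i1: "integrable ?\<mu> (\<lambda>x. wt a b x * poly (R * Q) x)"
    using ab by (subst integrable_jacobi_measure_iff[symmetric])
      (auto intro!: borel_measurable_lebesgue_on poly_measurable integrable_poly_jacobi simp del: poly_mult)
  have i2: "integrable ?\<mu> (\<lambda>x. wt (a + 1) (b + 1) x * poly (P * pderiv Q) x)"
    using ab by (subst integrable_jacobi_measure_iff[symmetric])
      (auto intro!: borel_measurable_lebesgue_on poly_measurable integrable_poly_jacobi simp del: poly_mult)
  have "(?h' has_integral (?h 1 - ?h 0)) {0..1}"
  proof (rule fundamental_theorem_of_calculus_interior)
    show "continuous_on {0..1} ?h" using ab by (intro continuous_on_wt_poly) auto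
    fix x :: real assume x: "x \<in> {0<..<1}"
    have "((\<lambda>x. (wt (a + 1) (b + 1) x * poly P x) * poly Q x) has_real_derivative
      wt a b x * poly R x * poly Q x + (wt (a + 1) (b + 1) x * poly P x) * poly (pderiv Q) x) (at x)"
      using DERIV_mult[OF wt_poly_has_derivative[OF x, of a b P] poly_DERIV[of Q x]]
      unfolding R by (simp add: algebra_simps)
    then show "(?h has_vector_derivative ?h' x) (at x)"
      by (simp add: has_real_derivative_iff_has_vector_derivative[symmetric] mult.assoc)
  qed auto
  then have "(?h' has_integral 0) {0<..<1}"
    by (simp add: has_integral_Icc_iff_Ioo wt_def)
  then have "(\<integral>x. ?h' x \<partial>?\<mu>) = 0"
    using lebesgue_integral_eq_integral[OF Bochner_Integration.integrable_add[OF i1 i2]]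
    by (simp add: integral_unique)
  then have "(\<integral>x. wt a b x * poly (R * Q) x \<partial>?\<mu>) = - (\<integral>x. wt (a + 1) (b + 1) x * poly (P * pderiv Q) x \<partial>?\<mu>)"
    by (subst (asm) Bochner_Integration.integral_add[OF i1 i2]) simp
  then show ?thesis
    by (simp only: integral_jacobi_measure borel_measurable_lebesgue_on poly_measurable)
qed

lemma jint_jacobi_poly_Suc:
  assumes "a > -1" "b > -1"
  shows "real (Suc n) * jint a b (jacobi_poly (Suc n) a b * Q)
       = jint (a + 1) (b + 1) (jacobi_poly n (a + 1) (b + 1) * pderiv Q)"
proof -
  have "- real (Suc n) * jint a b (jacobi_poly (Suc n) a b * Q)
       = - jint (a + 1) (b + 1) (jacobi_poly n (a + 1) (b + 1) * pderiv Q)"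
    using integration_by_parts_jacobi[OF assms jacobi_poly_raise[symmetric], of n Q]
    by (simp only: mult_smult_left jint_smult)
  then show ?thesis by (simp only: mult_minus_left neg_equal_iff_equal)
qed

text \<open>Integration by parts trades one degree of the Jacobi polynomial against one derivative of \<open>Q\<close> and raises both
exponents of the weight, so \<open>Q\<close> is differentiated away.\<close>

theorem jacobi_poly_orthogonal:
  assumes "a > -1" "b > -1" "degree Q < n"
  shows "jint a b (jacobi_poly n a b * Q) = 0"
  using assms
proof (induction n arbitrary: a b Q)
  case (Suc n)
  have "jint (a + 1) (b + 1) (jacobi_poly n (a + 1) (b + 1) * pderiv Q) = 0"
  proof (cases "degree Q = 0")
    case True
    then have "pderiv Q = 0" by (simp add: pderiv_eq_0_iff)
    then show ?thesis by simp
  next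
    case False
    then show ?thesis using Suc.prems by (intro Suc.IH) (auto simp: degree_pderiv)
  qed
  then show ?case using jint_jacobi_poly_Suc[of a b n Q] Suc.prems by simp
qed simp

abbreviation jacobi_lc :: "nat \<Rightarrow> real \<Rightarrow> real \<Rightarrow> real" where
  "jacobi_lc n a b \<equiv> coeff (jacobi_poly n a b) n"

lemma jacobi_lc_Suc:
  "real (Suc n) * jacobi_lc (Suc n) a b = (real n + a + b + 2) * jacobi_lc n (a + 1) (b + 1)"
proof -
  let ?P = "jacobi_poly n (a + 1) (b + 1)"
  have "coeff ?P (Suc n) = 0" "coeff ?P (Suc (Suc n)) = 0"
    using degree_jacobi_poly[of n "a + 1" "b + 1"] by (auto intro!: coeff_eq_0)
  then have "coeff ([:b + 1, - (a + b + 2):] * ?P + [:0, 1, -1:] * pderiv ?P) (Suc n)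
      = - (real n + a + b + 2) * coeff ?P n"
    by (cases n) (simp_all add: coeff_pderiv algebra_simps)
  then have "- real (Suc n) * jacobi_lc (Suc n) a b = - (real n + a + b + 2) * jacobi_lc n (a + 1) (b + 1)"
    unfolding jacobi_poly_raise by (simp only: coeff_smult)
  then show ?thesis by (simp only: mult_minus_left neg_equal_iff_equal)
qed

lemma jacobi_lc_pos:
  assumes "a > -1" "b > -1"
  shows "jacobi_lc n a b > 0"
  using assms
proof (induction n arbitrary: a b)
  case 0
  then show ?case by (simp add: jacobi_poly_def)
next
  case (Suc n)
  have "0 < (real n + a + b + 2) * jacobi_lc n (a + 1) (b + 1)"
    using Suc by (intro mult_pos_pos Suc.IH) auto
  then have "0 < real (Suc n) * jacobi_lc (Suc n) a b" by (simp only: jacobi_lc_Suc)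
  then show ?case by (simp add: zero_less_mult_iff)
qed

lemma degree_diff_less_if_same_coeff:
  fixes P Q :: "real poly"
  assumes "degree Q \<le> n" "degree P \<le> n" "coeff Q n = coeff P n" "Q \<noteq> P"
  shows "degree (Q - P) < n"
proof (rule ccontr)
  assume "\<not> degree (Q - P) < n"
  moreover have "degree (Q - P) \<le> n" using assms by (intro degree_diff_le) auto
  ultimately have "degree (Q - P) = n" by simp
  then have "lead_coeff (Q - P) = 0" using assms by simp
  then have "Q - P = 0" by (simp only: leading_coeff_0_iff)
  then show False using assms by simp
qed

text \<open>By orthogonality, the inner product with a Jacobi polynomial sees only the leading coefficient.\<close>

lemma jint_jacobi_poly:
  assumes ab: "a > -1" "b > -1" and "degree Q \<le> n"
  shows "jint a b (jacobi_poly n a b * Q)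
       = coeff Q n / jacobi_lc n a b * jint a b (jacobi_poly n a b * jacobi_poly n a b)"
proof -
  let ?J = "jacobi_poly n a b" and ?c = "coeff Q n / jacobi_lc n a b"
  have lc: "jacobi_lc n a b \<noteq> 0" using jacobi_lc_pos[OF ab, of n] by simp
  have "jint a b (?J * (Q - smult ?c ?J)) = 0"
  proof (cases "Q = smult ?c ?J")
    case False
    then show ?thesis using assms lc degree_jacobi_poly[of n a b]
      by (intro jacobi_poly_orthogonal degree_diff_less_if_same_coeff)
         (auto intro: order_trans[OF degree_smult_le])
  qed simp
  moreover have "?J * Q = ?J * (Q - smult ?c ?J) + smult ?c (?J * ?J)"
    by (simp add: algebra_simps)
  ultimately show ?thesis
    using jint_add[OF ab, of "?J * (Q - smult ?c ?J)" "smult ?c (?J * ?J)"] jint_smult[of a b ?c "?J * ?J"] by simp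
qed

text \<open>Integration by parts leaves the inner product with the derivative of a Jacobi polynomial, of which only the leading
coefficient matters.\<close>

lemma jacobi_norm_Suc:
  assumes ab: "a > -1" "b > -1"
  shows "real (Suc n) * jint a b (jacobi_poly (Suc n) a b * jacobi_poly (Suc n) a b)
     = (real n + a + b + 2) * jint (a + 1) (b + 1) (jacobi_poly n (a + 1) (b + 1) * jacobi_poly n (a + 1) (b + 1))"
proof -
  let ?J = "jacobi_poly (Suc n) a b" and ?h = "jint (a + 1) (b + 1) (jacobi_poly n (a + 1) (b + 1) * jacobi_poly n (a + 1) (b + 1))"
  have lc: "jacobi_lc n (a + 1) (b + 1) > 0" using ab by (intro jacobi_lc_pos) auto
  have "real (Suc n) * jint a b (?J * ?J) = jint (a + 1) (b + 1) (jacobi_poly n (a + 1) (b + 1) * pderiv ?J)"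
    by (rule jint_jacobi_poly_Suc[OF ab])
  also have "\<dots> = coeff (pderiv ?J) n / jacobi_lc n (a + 1) (b + 1) * ?h"
    using ab degree_jacobi_poly[of "Suc n" a b] by (intro jint_jacobi_poly) (auto simp: degree_pderiv)
  also have "coeff (pderiv ?J) n = (real n + a + b + 2) * jacobi_lc n (a + 1) (b + 1)"
    using jacobi_lc_Suc[of n a b] by (simp add: coeff_pderiv)
  finally show ?thesis using lc by simp
qed

lemma jacobi_norm_pos:
  assumes "a > -1" "b > -1"
  shows "jint a b (jacobi_poly n a b * jacobi_poly n a b) > 0"
  using assms
proof (induction n arbitrary: a b)
  case 0
  then have "jint a b 1 > 0"
    by (subst jint_one) (auto simp: Beta_def intro!: divide_pos_pos mult_pos_pos)
  then show ?case by (simp add: jacobi_poly_def)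
next
  case (Suc n)
  have "0 < (real n + a + b + 2) * jint (a + 1) (b + 1) (jacobi_poly n (a + 1) (b + 1) * jacobi_poly n (a + 1) (b + 1))"
    using Suc by (intro mult_pos_pos Suc.IH) auto
  then have "0 < real (Suc n) * jint a b (jacobi_poly (Suc n) a b * jacobi_poly (Suc n) a b)"
    by (simp only: jacobi_norm_Suc[OF Suc.prems])
  then show ?case by (simp add: zero_less_mult_iff)
qed

section \<open>Abel integrals of Jacobi weights\<close>

lemma Gamma_reflection_real:
  assumes "0 < x" "x < 1"
  shows "Gamma x * Gamma (1 - x) = pi / sin (pi * x)"
proof -
  have "Gamma (complex_of_real x) * Gamma (complex_of_real (1 - x)) = complex_of_real pi / sin (complex_of_real (pi * x))"
    using Gamma_reflection_complex[of "complex_of_real x"] by simp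
  then have "complex_of_real (Gamma x * Gamma (1 - x)) = complex_of_real (pi / sin (pi * x))"
    by (simp only: Gamma_complex_of_real sin_of_real of_real_mult[symmetric] of_real_divide[symmetric])
  then show ?thesis by (simp only: of_real_eq_iff)
qed

text \<open>The three exponents add up to \<open>- 2\<close>, so Moebius transformations change the integrand, together with \<open>dt\<close>, only by
a constant factor. The one that fixes 0 and 1 and moves the pole \<open>1 / y\<close> to infinity, \<open>t = v / (1 - y + y * v)\<close>,
leaves a Beta integral.\<close>

lemma nn_integral_beta_moebius:
  fixes q \<sigma> y :: real
  assumes q: "q > -1" and \<sigma>: "\<sigma> > 0" and y: "0 < y" "y < 1"
  shows "(\<integral>\<^sup>+t. ennreal (t powr q * (1 - t) powr (\<sigma> - 1) * (1 - y * t) powr (- q - \<sigma> - 1)) * indicator {0<..<1} t \<partial>lborel)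
     = ennreal ((1 - y) powr (- q - 1) * Beta (q + 1) \<sigma>)"
proof -
  let ?f = "\<lambda>t. t powr q * (1 - t) powr (\<sigma> - 1) * (1 - y * t) powr (- q - \<sigma> - 1)"
  define d where "d v = 1 - y + y * v" for v
  let ?g = "\<lambda>v. v / d v" and ?g' = "\<lambda>v. (1 - y) / (d v)\<^sup>2"
  have d_pos: "d v > 0" if "v \<ge> 0" for v using that y by (simp add: d_def add_pos_nonneg)
  have g01: "?g 0 = 0" "?g 1 = 1" by (simp_all add: d_def)
  have [measurable]: "?f \<in> borel_measurable borel" by measurable
  have "(\<integral>\<^sup>+t. ennreal (?f t) * indicator {0<..<1} t \<partial>lborel) = (\<integral>\<^sup>+t. ennreal (?f t * indicator {?g 0..?g 1} t) \<partial>lborel)"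
    unfolding g01 by (intro nn_integral_cong) (auto split: split_indicator)
  also have "\<dots> = (\<integral>\<^sup>+v. ennreal (?f (?g v) * ?g' v * indicator {0..1} v) \<partial>lborel)"
  proof (rule nn_integral_substitution)
    show "set_borel_measurable borel {?g 0..?g 1} ?f"
      unfolding set_borel_measurable_def by measurable
    fix v :: real assume "v \<in> {0..1}"
    then have "d v > 0" using d_pos by auto
    then show "(?g has_real_derivative ?g' v) (at v)"
      unfolding d_def by (auto intro!: derivative_eq_intros simp: power2_eq_square field_simps)
    show "0 \<le> ?g' v" using y by simp
  next
    show "continuous_on {0..1} ?g'"
      using d_pos unfolding d_def by (intro continuous_intros) (auto simp: less_le)
  qed auto
  also have "\<dots> = (\<integral>\<^sup>+v. ennreal ((1 - y) powr (- q - 1)) * ennreal (indicator {0<..<1} v * (v powr q * (1 - v) powr (\<sigma> - 1))) \<partial>lborel)"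
  proof (rule nn_integral_cong)
    fix v :: real
    show "ennreal (?f (?g v) * ?g' v * indicator {0..1} v) =
      ennreal ((1 - y) powr (- q - 1)) * ennreal (indicator {0<..<1} v * (v powr q * (1 - v) powr (\<sigma> - 1)))"
    proof (cases "v \<in> {0<..<1}")
      case True
      then have v: "0 < v" "v < 1" and dv: "d v > 0" using d_pos by auto
      have e1: "1 - ?g v = (1 - y) * (1 - v) / d v"
        using dv by (simp add: d_def field_simps)
      have e2: "1 - y * ?g v = (1 - y) / d v"
        using dv by (simp add: d_def field_simps)
      have "?f (?g v) * ?g' v
          = (v powr q / d v powr q) * (((1 - y) powr (\<sigma> - 1) * (1 - v) powr (\<sigma> - 1)) / d v powr (\<sigma> - 1))
             * ((1 - y) powr (- q - \<sigma> - 1) / d v powr (- q - \<sigma> - 1)) * ((1 - y) powr 1 / d v powr 2)"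
        unfolding e1 e2 using v dv y by (simp add: powr_divide powr_mult powr_numeral)
      also have "\<dots> = (v powr q * (1 - v) powr (\<sigma> - 1)) *
          ((1 - y) powr (\<sigma> - 1) * (1 - y) powr (- q - \<sigma> - 1) * (1 - y) powr 1) /
          (d v powr q * d v powr (\<sigma> - 1) * d v powr (- q - \<sigma> - 1) * d v powr 2)"
        by simp
      also have "(1 - y) powr (\<sigma> - 1) * (1 - y) powr (- q - \<sigma> - 1) * (1 - y) powr 1 = (1 - y) powr (- q - 1)"
        unfolding powr_add[symmetric] by (rule arg_cong2[where f = "(powr)"]) simp_all
      also have "d v powr q * d v powr (\<sigma> - 1) * d v powr (- q - \<sigma> - 1) * d v powr 2 = 1"
        unfolding powr_add[symmetric] using dv by simp
      finally have "?f (?g v) * ?g' v = (1 - y) powr (- q - 1) * (v powr q * (1 - v) powr (\<sigma> - 1))"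
        by simp
      then show ?thesis using True by (simp add: ennreal_mult)
    next
      case False
      then show ?thesis by (cases "v = 0 \<or> v = 1") (auto simp: indicator_def d_def)
    qed
  qed
  also have "\<dots> = ennreal ((1 - y) powr (- q - 1)) * (\<integral>\<^sup>+v. ennreal (indicator {0<..<1} v * (v powr q * (1 - v) powr (\<sigma> - 1))) \<partial>lborel)"
    by (rule nn_integral_cmult) measurable
  also have "(\<integral>\<^sup>+v. ennreal (indicator {0<..<1} v * (v powr q * (1 - v) powr (\<sigma> - 1))) \<partial>lborel) = ennreal (Beta (q + 1) \<sigma>)"
    using has_integral_Beta_real[of "q + 1" \<sigma>] assms
    by (intro nn_integral_has_integral_lebesgue) (auto simp: has_integral_Icc_iff_Ioo)
  finally show ?thesis by (simp only: ennreal_mult'[OF powr_ge_zero])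
qed

text \<open>The left-sided Abel integral of the weight at \<open>x\<close>, without the Gamma factor, of the order \<open>- p - q\<close> that
matches the exponents of the weight.\<close>

definition abel_integral :: "real \<Rightarrow> real \<Rightarrow> real \<Rightarrow> ennreal" where
  "abel_integral p q x = (\<integral>\<^sup>+s. ennreal (wt p q s * (x - s) powr (- p - q - 1)) * indicator {0<..<x} s \<partial>lborel)"

lemma abel_integral_scaled:
  assumes x: "0 < x" "x < 1"
  shows "abel_integral p q x
    = (\<integral>\<^sup>+t. ennreal (t powr q * (1 - t) powr (- p - q - 1) * (x powr (- p) * (1 - x * t) powr p)) * indicator {0<..<1} t \<partial>lborel)"
proof -
  let ?F = "\<lambda>s. ennreal (wt p q s * (x - s) powr (- p - q - 1)) * indicator {0<..<x} s"
  have [measurable]: "wt p q \<in> borel_measurable borel" by (rule wt_measurable)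
  have "abel_integral p q x = ennreal \<bar>x\<bar> * (\<integral>\<^sup>+t. ?F (0 + x * t) \<partial>lborel)"
    unfolding abel_integral_def using x by (intro nn_integral_real_affine) auto
  also have "\<dots> = (\<integral>\<^sup>+t. ennreal \<bar>x\<bar> * ?F (0 + x * t) \<partial>lborel)"
    by (rule nn_integral_cmult[symmetric]) measurable
  also have "\<dots> = (\<integral>\<^sup>+t. ennreal (t powr q * (1 - t) powr (- p - q - 1) * (x powr (- p) * (1 - x * t) powr p)) * indicator {0<..<1} t \<partial>lborel)"
  proof (rule nn_integral_cong)
    fix t :: real
    show "ennreal \<bar>x\<bar> * ?F (0 + x * t) =
      ennreal (t powr q * (1 - t) powr (- p - q - 1) * (x powr (- p) * (1 - x * t) powr p)) * indicator {0<..<1} t"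
    proof (cases "t \<in> {0<..<1}")
      case True
      have "x - x * t = x * (1 - t)" by (simp add: algebra_simps)
      then have "x * (wt p q (x * t) * (x - x * t) powr (- p - q - 1))
         = (1 - x * t) powr p * (t powr q * (1 - t) powr (- p - q - 1)) * (x powr 1 * x powr q * x powr (- p - q - 1))"
        using x True by (simp add: wt_def powr_mult)
      also have "x powr 1 * x powr q * x powr (- p - q - 1) = x powr (- p)"
        unfolding powr_add[symmetric] by simp
      finally show ?thesis using x True by (simp add: ennreal_mult'[symmetric] mult_ac)
    next
      case False
      then have "x * t \<notin> {0<..<x}" using x by (auto simp: zero_less_mult_iff)
      then show ?thesis using False by simp
    qed
  qed
  finally show ?thesis .
qed

text \<open>Writing the factor \<open>x powr (- p) * (1 - x * t) powr p\<close> as an integral over \<open>y\<close> lowers the third exponent from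
\<open>p\<close> to \<open>p - 1\<close>, which is what the Moebius substitution requires.\<close>

lemma nn_integral_power_ratio:
  assumes p: "p < 0" and x: "0 < x" "x < 1" and t: "0 < t" "t < 1"
  shows "(\<integral>\<^sup>+y. ennreal (- p * y powr (- p - 1) * (1 - y * t) powr (p - 1)) * indicator {0<..<x} y \<partial>lborel)
    = ennreal (x powr (- p) * (1 - x * t) powr p)"
proof -
  let ?h = "\<lambda>y. y powr (- p) * (1 - y * t) powr p"
  let ?h' = "\<lambda>y. - p * y powr (- p - 1) * (1 - y * t) powr (p - 1)"
  have yt: "y * t < 1" if "0 \<le> y" "y \<le> x" for y
  proof -
    have "y * t \<le> x * 1" using that x t by (intro mult_mono) auto
    then show ?thesis using x by simp
  qed
  have "(?h' has_integral (?h x - ?h 0)) {0..x}"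
  proof (rule fundamental_theorem_of_calculus_interior)
    show "continuous_on {0..x} ?h"
      using p yt by (intro continuous_intros continuous_on_powr') force+
    fix y assume y: "y \<in> {0<..<x}"
    then have pos: "1 - y * t > 0" "y > 0" using yt[of y] by auto
    have pw: "(1 - y * t) powr p = (1 - y * t) powr (p - 1) * (1 - y * t)" "y powr (- p) = y powr (- p - 1) * y"
      using powr_add[of "1 - y * t" "p - 1" 1] powr_add[of y "- p - 1" 1] pos by simp_all
    have "(?h has_real_derivative
       (- p * y powr (- p - 1) * (1 - y * t) powr p + (p * (1 - y * t) powr (p - 1) * (- t)) * y powr (- p))) (at y)"
      using pos by (auto intro!: derivative_eq_intros)
    also have "- p * y powr (- p - 1) * (1 - y * t) powr p + (p * (1 - y * t) powr (p - 1) * (- t)) * y powr (- p) = ?h' y"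
      unfolding pw by (simp add: algebra_simps)
    finally show "(?h has_vector_derivative ?h' y) (at y)"
      by (simp add: has_real_derivative_iff_has_vector_derivative)
  qed (use x in auto)
  then have "(?h' has_integral ?h x) {0<..<x}" by (simp add: has_integral_Icc_iff_Ioo)
  from nn_integral_has_integral_lebesgue[OF _ this]
  have "(\<integral>\<^sup>+y. ennreal (indicator {0<..<x} y * ?h' y) \<partial>lborel) = ennreal (?h x)"
    using p by (simp add: mult_nonpos_nonneg)
  also have "(\<integral>\<^sup>+y. ennreal (indicator {0<..<x} y * ?h' y) \<partial>lborel) = (\<integral>\<^sup>+y. ennreal (?h' y) * indicator {0<..<x} y \<partial>lborel)"
    by (intro nn_integral_cong) (auto split: split_indicator)
  finally show ?thesis .
qed

text \<open>After scaling to the unit interval and expanding the last factor as an integral over \<open>y\<close>, Tonelli's theorem brings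
the Beta integral with a Moebius factor inside.\<close>

theorem abel_integral_incomplete_beta:
  assumes p: "p < 0" and q: "q > -1" and \<sigma>: "p + q < 0" and x: "0 < x" "x < 1"
  shows "abel_integral p q x
    = ennreal (- p * Beta (q + 1) (- p - q)) * (\<integral>\<^sup>+y. ennreal (wt (- q - 1) (- p - 1) y) * indicator {0<..<x} y \<partial>lborel)"
proof -
  let ?a = "\<lambda>t. t powr q * (1 - t) powr (- p - q - 1)"
  let ?b = "\<lambda>y t. - p * y powr (- p - 1) * (1 - y * t) powr (p - 1)"
  let ?F = "\<lambda>t y. ennreal (?a t) * indicator {0<..<1} t * (ennreal (?b y t) * indicator {0<..<x} y)"
  have [measurable]: "wt a b \<in> borel_measurable borel" for a b by (rule wt_measurable)
  have B: "Beta (q + 1) (- p - q) \<ge> 0"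
    using q \<sigma> by (simp add: Beta_def less_imp_le Gamma_real_pos)
  have "abel_integral p q x = (\<integral>\<^sup>+t. \<integral>\<^sup>+y. ?F t y \<partial>lborel \<partial>lborel)"
    unfolding abel_integral_scaled[OF x]
  proof (rule nn_integral_cong)
    fix t :: real
    have "(\<integral>\<^sup>+y. ?F t y \<partial>lborel) = ennreal (?a t) * indicator {0<..<1} t * (\<integral>\<^sup>+y. ennreal (?b y t) * indicator {0<..<x} y \<partial>lborel)"
      by (rule nn_integral_cmult) measurable
    also have "\<dots> = ennreal (?a t * (x powr (- p) * (1 - x * t) powr p)) * indicator {0<..<1} t"
      using nn_integral_power_ratio[OF p x, of t] by (auto simp: ennreal_mult' split: split_indicator)
    finally show "ennreal (?a t * (x powr (- p) * (1 - x * t) powr p)) * indicator {0<..<1} t = (\<integral>\<^sup>+y. ?F t y \<partial>lborel)" ..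
  qed
  also have "\<dots> = (\<integral>\<^sup>+y. \<integral>\<^sup>+t. ?F t y \<partial>lborel \<partial>lborel)"
    by (rule lborel_pair.Fubini'[symmetric]) measurable
  also have "\<dots> = (\<integral>\<^sup>+y. ennreal (- p * Beta (q + 1) (- p - q)) * (ennreal (wt (- q - 1) (- p - 1) y) * indicator {0<..<x} y) \<partial>lborel)"
  proof (rule nn_integral_cong)
    fix y :: real
    show "(\<integral>\<^sup>+t. ?F t y \<partial>lborel) = ennreal (- p * Beta (q + 1) (- p - q)) * (ennreal (wt (- q - 1) (- p - 1) y) * indicator {0<..<x} y)"
    proof (cases "y \<in> {0<..<x}")
      case True
      then have y: "0 < y" "y < 1" using x by auto
      define c where "c = - p * y powr (- p - 1)"
      have c: "c \<ge> 0" using p by (simp add: c_def mult_nonpos_nonneg)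
      have b: "?b y t = c * (1 - y * t) powr (p - 1)" for t by (simp add: c_def)
      have pB: "- p * Beta (q + 1) (- p - q) \<ge> 0" using p B by (intro mult_nonneg_nonneg) auto
      have "(\<integral>\<^sup>+t. ?F t y \<partial>lborel)
        = (\<integral>\<^sup>+t. ennreal c * (ennreal (t powr q * (1 - t) powr ((- p - q) - 1) * (1 - y * t) powr (- q - (- p - q) - 1)) * indicator {0<..<1} t) \<partial>lborel)"
        unfolding b using True c
        by (intro nn_integral_cong) (auto simp: ennreal_mult'[symmetric] mult_ac split: split_indicator)
      also have "\<dots> = ennreal c * ennreal ((1 - y) powr (- q - 1) * Beta (q + 1) (- p - q))"
        using nn_integral_beta_moebius[OF q _ y, of "- p - q"] \<sigma>
        by (subst nn_integral_cmult) auto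
      also have "\<dots> = ennreal (- p * Beta (q + 1) (- p - q)) * ennreal (wt (- q - 1) (- p - 1) y)"
        unfolding ennreal_mult'[OF c, symmetric] ennreal_mult'[OF pB, symmetric]
        by (simp add: c_def wt_def mult_ac)
      finally show ?thesis using True by simp
    qed simp
  qed
  also have "\<dots> = ennreal (- p * Beta (q + 1) (- p - q)) * (\<integral>\<^sup>+y. ennreal (wt (- q - 1) (- p - 1) y) * indicator {0<..<x} y \<partial>lborel)"
    by (rule nn_integral_cmult) measurable
  finally show ?thesis .
qed

text \<open>At the endpoint \<open>p = 0\<close> of the parameter range the incomplete Beta integral diverges while its coefficient
vanishes; the Abel integral is then constant by scaling.\<close>

lemma abel_integral_p_zero:
  assumes q: "-1 < q" "q < 0" and x: "0 < x" "x < 1"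
  shows "abel_integral 0 q x = ennreal (Beta (q + 1) (- q))"
proof -
  have "abel_integral 0 q x = (\<integral>\<^sup>+t. ennreal (indicator {0<..<1} t * (t powr q * (1 - t) powr (- q - 1))) \<partial>lborel)"
    unfolding abel_integral_scaled[OF x]
  proof (rule nn_integral_cong)
    fix t :: real
    have "x * t < 1 * 1" if "0 < t" "t < 1" using x that by (intro mult_strict_mono) auto
    then show "ennreal (t powr q * (1 - t) powr (- 0 - q - 1) * (x powr (- 0) * (1 - x * t) powr 0)) * indicator {0<..<1} t
      = ennreal (indicator {0<..<1} t * (t powr q * (1 - t) powr (- q - 1)))"
      using x by (auto split: split_indicator)
  qed
  also have "\<dots> = ennreal (Beta (q + 1) (- q))"
    using has_integral_Beta_real[of "q + 1" "- q"] assms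
    by (intro nn_integral_has_integral_lebesgue) (auto simp: has_integral_Icc_iff_Ioo)
  finally show ?thesis .
qed

lemma nn_integral_reflect:
  fixes f :: "real \<Rightarrow> ennreal"
  assumes "f \<in> borel_measurable borel"
  shows "(\<integral>\<^sup>+s. f s \<partial>lborel) = (\<integral>\<^sup>+s. f (1 - s) \<partial>lborel)"
  using nn_integral_real_affine[OF assms, of "-1" 1] by simp

lemma abel_integral_right:
  "(\<integral>\<^sup>+s. ennreal (wt p q s * (s - x) powr (- p - q - 1)) * indicator {x<..<1} s \<partial>lborel) = abel_integral q p (1 - x)"
proof -
  have [measurable]: "wt a b \<in> borel_measurable borel" for a b by (rule wt_measurable)
  have "(\<integral>\<^sup>+s. ennreal (wt p q s * (s - x) powr (- p - q - 1)) * indicator {x<..<1} s \<partial>lborel)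
    = (\<integral>\<^sup>+s. ennreal (wt p q (1 - s) * (1 - s - x) powr (- p - q - 1)) * indicator {x<..<1} (1 - s) \<partial>lborel)"
    by (rule nn_integral_reflect) measurable
  also have "\<dots> = abel_integral q p (1 - x)"
    unfolding abel_integral_def
  proof (rule nn_integral_cong)
    fix s :: real
    have "1 - s - x = 1 - x - s" "- p - q - 1 = - q - p - 1" "wt p q (1 - s) = wt q p s"
      by (simp_all add: wt_def)
    moreover have "indicator {x<..<1} (1 - s) = (indicator {0<..<1 - x} s :: ennreal)"
      by (auto simp: indicator_def)
    ultimately show "ennreal (wt p q (1 - s) * (1 - s - x) powr (- p - q - 1)) * indicator {x<..<1} (1 - s)
      = ennreal (wt q p s * (1 - x - s) powr (- q - p - 1)) * indicator {0<..<1 - x} s"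
      by (simp only:)
  qed
  finally show ?thesis .
qed

section \<open>Two-sided Riesz potentials of Jacobi weights\<close>

text \<open>Convolution with this kernel is \<open>r\<close> times the left plus \<open>1 - r\<close> times the right fractional integral of order \<open>\<sigma>\<close>.\<close>

definition riesz_kernel :: "real \<Rightarrow> real \<Rightarrow> real \<Rightarrow> real" where
  "riesz_kernel r \<sigma> z = (if 0 < z then r * z powr (\<sigma> - 1) else if z < 0 then (1 - r) * (- z) powr (\<sigma> - 1) else 0) / Gamma \<sigma>"

text \<open>The last condition is the prescribed relation between \<open>r\<close> and the exponents, cleared of denominators. In this form
it is visibly invariant under interchanging \<open>p\<close> and \<open>q\<close> while replacing \<open>r\<close> by \<open>1 - r\<close>, and it covers the
one-sided cases \<open>r = 0\<close> and \<open>r = 1\<close>.\<close>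

definition admissible :: "real \<Rightarrow> real \<Rightarrow> real \<Rightarrow> bool" where
  "admissible r p q \<longleftrightarrow> -1 < p \<and> p \<le> 0 \<and> -1 < q \<and> q \<le> 0 \<and> -1 < p + q \<and> p + q < 0 \<and> 0 \<le> r \<and> r \<le> 1 \<and>
     r * sin (pi * p) = (1 - r) * sin (pi * q)"

lemma admissible_swap: "admissible r p q \<Longrightarrow> admissible (1 - r) q p"
  by (auto simp: admissible_def)

lemma admissibleD:
  assumes "admissible r p q"
  shows "-1 < p" "p \<le> 0" "-1 < q" "q \<le> 0" "0 < - p - q" "- p - q < 1" "0 \<le> r" "r \<le> 1"
  using assms by (auto simp: admissible_def)

lemma riesz_kernel_measurable [measurable]: "riesz_kernel r \<sigma> \<in> borel_measurable borel"
  unfolding riesz_kernel_def by measurable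

lemma riesz_kernel_nonneg:
  assumes "0 \<le> r" "r \<le> 1" "0 < \<sigma>"
  shows "riesz_kernel r \<sigma> z \<ge> 0"
  using assms by (auto simp: riesz_kernel_def Gamma_real_pos intro!: divide_nonneg_pos)

lemma riesz_kernel_uminus: "riesz_kernel r \<sigma> (- z) = riesz_kernel (1 - r) \<sigma> z"
  by (simp add: riesz_kernel_def)

lemma sin_pi_neg: "-1 < t \<Longrightarrow> t < 0 \<Longrightarrow> sin (pi * t) < 0"
  using sin_gt_zero[of "pi * (- t)"] mult_strict_left_mono[of "- t" 1 pi] mult_pos_pos[of pi "- t"] by simp

lemma admissible_edge:
  assumes "admissible r p q"
  shows "p = 0 \<Longrightarrow> r = 1" "q = 0 \<Longrightarrow> r = 0"
  using assms sin_pi_neg[of p] sin_pi_neg[of q] by (auto simp: admissible_def)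

text \<open>Both sides reduce to \<open>Gamma (q + 1) * Gamma (- q)\<close> and \<open>Gamma (p + 1) * Gamma (- p)\<close>, which the reflection formula
turns into the sines of the condition on \<open>r\<close>.\<close>

lemma Beta_balance:
  assumes adm: "admissible r p q" and neg: "p < 0" "q < 0"
  shows "r * (- p * Beta (q + 1) (- p - q)) = (1 - r) * (- q * Beta (p + 1) (- q - p))"
proof -
  note * = admissibleD[OF adm]
  have nz: "sin (pi * p) \<noteq> 0" "sin (pi * q) \<noteq> 0"
    using sin_pi_neg[of p] sin_pi_neg[of q] * neg by auto
  have B: "- s * Beta (t + 1) (- s - t) = Gamma (- s - t) * Gamma (t + 1) / Gamma (- s)" 
    if "s < 0" for s t :: real
  proof -
    have "Gamma (1 - s) = - s * Gamma (- s)"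
      using Gamma_plus1[of "- s"] that nonpos_Ints_nonpos[of "- s"] by force
    moreover have "Gamma (- s) > 0" using that by (intro Gamma_real_pos) auto
    ultimately show ?thesis using that by (simp add: Beta_def field_simps)
  qed
  have refl: "Gamma (t + 1) * Gamma (- t) = - pi / sin (pi * t)" if "-1 < t" "t < 0" for t :: real
    using Gamma_reflection_real[of "- t"] that by (simp add: mult.commute add.commute)
  have pos: "Gamma (- p) > 0" "Gamma (- q) > 0" using neg by (auto intro!: Gamma_real_pos)
  have "r * (Gamma (q + 1) * Gamma (- q)) = (1 - r) * (Gamma (p + 1) * Gamma (- p))"
  proof -
    have "r * (- pi / sin (pi * q)) = (r * sin (pi * p)) * (- pi / (sin (pi * p) * sin (pi * q)))"
      using nz by simp
    also have "r * sin (pi * p) = (1 - r) * sin (pi * q)" using adm by (simp add: admissible_def)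
    also have "(1 - r) * sin (pi * q) * (- pi / (sin (pi * p) * sin (pi * q))) = (1 - r) * (- pi / sin (pi * p))"
      using nz by simp
    finally show ?thesis using refl[of p] refl[of q] * neg by (simp only:)
  qed
  then have "r * (Gamma (q + 1) / Gamma (- p)) = (1 - r) * (Gamma (p + 1) / Gamma (- q))"
    using pos by (simp add: field_simps)
  moreover have "r * (- p * Beta (q + 1) (- p - q)) = Gamma (- p - q) * (r * (Gamma (q + 1) / Gamma (- p)))"
    unfolding B[OF neg(1)] by simp
  moreover have "(1 - r) * (- q * Beta (p + 1) (- q - p)) = Gamma (- p - q) * ((1 - r) * (Gamma (p + 1) / Gamma (- q)))"
  proof -
    have "- q - p = - p - q" by simp
    then show ?thesis using B[OF neg(2), of p] by (simp only:) simp
  qed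
  ultimately show ?thesis by simp
qed

lemma nn_integral_jacobi:
  assumes [measurable]: "f \<in> borel_measurable borel"
  shows "(\<integral>\<^sup>+s. f s \<partial>jacobi_measure p q) = (\<integral>\<^sup>+s. ennreal (wt p q s) * f s * indicator {0<..<1} s \<partial>lborel)"
proof -
  have "(\<integral>\<^sup>+s. f s \<partial>jacobi_measure p q) = (\<integral>\<^sup>+s. ennreal (wt p q s) * f s \<partial>lebesgue_on {0<..<1})"
    unfolding jacobi_measure_def
    by (rule nn_integral_density[OF ennreal_wt_measurable])
       (intro measurable_restrict_space1 measurable_completion, simp)
  then show ?thesis by (simp add: nn_integral_lebesgue_on)
qed

lemma riesz_potential_split:
  assumes adm: "admissible r p q" and x: "0 < x" "x < 1"
  shows "(\<integral>\<^sup>+s. ennreal (riesz_kernel r (- p - q) (x - s)) \<partial>jacobi_measure p q)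
    = ennreal (r / Gamma (- p - q)) * abel_integral p q x + ennreal ((1 - r) / Gamma (- p - q)) * abel_integral q p (1 - x)"
proof -
  note * = admissibleD[OF adm]
  let ?\<sigma> = "- p - q"
  have [measurable]: "wt a b \<in> borel_measurable borel" for a b by (rule wt_measurable)
  have G: "Gamma ?\<sigma> > 0" using * by (intro Gamma_real_pos) auto
  let ?l = "\<lambda>s. ennreal (wt p q s * (x - s) powr (?\<sigma> - 1)) * indicator {0<..<x} s"
  let ?r = "\<lambda>s. ennreal (wt p q s * (s - x) powr (?\<sigma> - 1)) * indicator {x<..<1} s"
  have "(\<integral>\<^sup>+s. ennreal (riesz_kernel r ?\<sigma> (x - s)) \<partial>jacobi_measure p q)
    = (\<integral>\<^sup>+s. ennreal (wt p q s) * ennreal (riesz_kernel r ?\<sigma> (x - s)) * indicator {0<..<1} s \<partial>lborel)"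
    by (rule nn_integral_jacobi) measurable
  also have "\<dots> = (\<integral>\<^sup>+s. ennreal (r / Gamma ?\<sigma>) * ?l s + ennreal ((1 - r) / Gamma ?\<sigma>) * ?r s \<partial>lborel)"
  proof (rule nn_integral_cong)
    fix s :: real
    consider "s \<in> {0<..<x}" | "s = x" | "s \<in> {x<..<1}" | "s \<notin> {0<..<1}" by force
    then show "ennreal (wt p q s) * ennreal (riesz_kernel r ?\<sigma> (x - s)) * indicator {0<..<1} s
      = ennreal (r / Gamma ?\<sigma>) * ?l s + ennreal ((1 - r) / Gamma ?\<sigma>) * ?r s"
    proof cases
      case 1
      then show ?thesis using x * G
        by (simp add: riesz_kernel_def ennreal_mult'[symmetric] wt_nonneg mult_ac)
    next
      case 2
      then show ?thesis by (simp add: riesz_kernel_def)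
    next
      case 3
      then show ?thesis using x * G
        by (simp add: riesz_kernel_def ennreal_mult'[symmetric] wt_nonneg mult_ac)
    next
      case 4
      then have "indicator {0<..<1} s = (0 :: ennreal)" "indicator {0<..<x} s = (0 :: ennreal)"
        "indicator {x<..<1} s = (0 :: ennreal)" using x by (auto simp: indicator_def)
      then show ?thesis by (simp only:) simp
    qed
  qed
  also have "\<dots> = ennreal (r / Gamma ?\<sigma>) * (\<integral>\<^sup>+s. ?l s \<partial>lborel) + ennreal ((1 - r) / Gamma ?\<sigma>) * (\<integral>\<^sup>+s. ?r s \<partial>lborel)"
    by (simp add: nn_integral_add nn_integral_cmult)
  finally show ?thesis by (simp only: abel_integral_right) (simp add: abel_integral_def)
qed

lemma incomplete_beta_split:
  assumes pq: "p < 0" "q < 0" and x: "0 < x" "x < 1"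
  shows "(\<integral>\<^sup>+y. ennreal (wt (- q - 1) (- p - 1) y) * indicator {0<..<x} y \<partial>lborel)
       + (\<integral>\<^sup>+y. ennreal (wt (- p - 1) (- q - 1) y) * indicator {0<..<1 - x} y \<partial>lborel) = ennreal (Beta (- p) (- q))"
proof -
  have [measurable]: "wt a b \<in> borel_measurable borel" for a b by (rule wt_measurable)
  let ?w = "wt (- q - 1) (- p - 1)"
  have "(\<integral>\<^sup>+y. ennreal (wt (- p - 1) (- q - 1) y) * indicator {0<..<1 - x} y \<partial>lborel)
    = (\<integral>\<^sup>+y. ennreal (wt (- p - 1) (- q - 1) (1 - y)) * indicator {0<..<1 - x} (1 - y) \<partial>lborel)"
    by (rule nn_integral_reflect) measurable
  also have "\<dots> = (\<integral>\<^sup>+y. ennreal (?w y) * indicator {x<..<1} y \<partial>lborel)"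
  proof (rule nn_integral_cong)
    fix y :: real
    have "wt (- p - 1) (- q - 1) (1 - y) = ?w y" by (simp add: wt_def)
    moreover have "indicator {0<..<1 - x} (1 - y) = (indicator {x<..<1} y :: ennreal)"
      by (auto simp: indicator_def)
    ultimately show "ennreal (wt (- p - 1) (- q - 1) (1 - y)) * indicator {0<..<1 - x} (1 - y)
      = ennreal (?w y) * indicator {x<..<1} y" by (simp only:)
  qed
  finally have "(\<integral>\<^sup>+y. ennreal (?w y) * indicator {0<..<x} y \<partial>lborel)
       + (\<integral>\<^sup>+y. ennreal (wt (- p - 1) (- q - 1) y) * indicator {0<..<1 - x} y \<partial>lborel)
     = (\<integral>\<^sup>+y. ennreal (?w y) * indicator {0<..<x} y + ennreal (?w y) * indicator {x<..<1} y \<partial>lborel)"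
    by (simp add: nn_integral_add)
  also have "\<dots> = (\<integral>\<^sup>+y. ennreal (?w y) * indicator {0<..<1} y \<partial>lborel)"
  proof (rule nn_integral_cong_AE)
    have "AE y in lborel. y \<noteq> x" by (rule AE_lborel_singleton)
    then show "AE y in lborel. ennreal (?w y) * indicator {0<..<x} y + ennreal (?w y) * indicator {x<..<1} y
        = ennreal (?w y) * indicator {0<..<1} y"
      by eventually_elim (use x in \<open>auto split: split_indicator\<close>)
  qed
  also have "\<dots> = ennreal (Beta (- p) (- q))"
    using nn_integral_wt[of "- q - 1" "- p - 1"] pq by (simp add: nn_integral_lebesgue_on)
  finally show ?thesis .
qed

text \<open>For \<open>p\<close>, \<open>q\<close> both negative the left and the right part are the same multiple of the incomplete Beta integrals over
\<open>(0, x)\<close> and \<open>(x, 1)\<close>. If one of the exponents is 0, only one part is present and is constant by itself.\<close>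

theorem riesz_potential_constant:
  assumes adm: "admissible r p q"
  obtains C where "C > 0"
    "\<And>x. 0 < x \<Longrightarrow> x < 1 \<Longrightarrow> (\<integral>\<^sup>+s. ennreal (riesz_kernel r (- p - q) (x - s)) \<partial>jacobi_measure p q) = ennreal C"
proof -
  note * = admissibleD[OF adm]
  let ?\<sigma> = "- p - q"
  have G: "Gamma ?\<sigma> > 0" using * by (intro Gamma_real_pos) auto
  consider "p = 0" | "q = 0" | "p < 0" "q < 0" using * by force
  then show thesis
  proof cases
    case 1
    then have q: "-1 < q" "q < 0" and r: "r = 1" using * admissible_edge[OF adm] by auto
    have "Beta (q + 1) (- q) > 0" using q by (simp add: Beta_def Gamma_real_pos)
    show thesis
    proof (rule that[of "1 / Gamma ?\<sigma> * Beta (q + 1) (- q)"])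
      show "1 / Gamma ?\<sigma> * Beta (q + 1) (- q) > 0" using G \<open>Beta (q + 1) (- q) > 0\<close> by simp
      fix x :: real assume x: "0 < x" "x < 1"
      show "(\<integral>\<^sup>+s. ennreal (riesz_kernel r ?\<sigma> (x - s)) \<partial>jacobi_measure p q) = ennreal (1 / Gamma ?\<sigma> * Beta (q + 1) (- q))"
        unfolding riesz_potential_split[OF adm x] unfolding 1 r
        using G 1 by (simp add: abel_integral_p_zero[OF q x] ennreal_mult'[symmetric])
    qed
  next
    case 2
    then have p: "-1 < p" "p < 0" and r: "r = 0" using * admissible_edge[OF adm] by auto
    have "Beta (p + 1) (- p) > 0" using p by (simp add: Beta_def Gamma_real_pos)
    show thesis
    proof (rule that[of "1 / Gamma ?\<sigma> * Beta (p + 1) (- p)"])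
      show "1 / Gamma ?\<sigma> * Beta (p + 1) (- p) > 0" using G \<open>Beta (p + 1) (- p) > 0\<close> by simp
      fix x :: real assume x: "0 < x" "x < 1"
      have x': "0 < 1 - x" "1 - x < 1" using x by auto
      show "(\<integral>\<^sup>+s. ennreal (riesz_kernel r ?\<sigma> (x - s)) \<partial>jacobi_measure p q) = ennreal (1 / Gamma ?\<sigma> * Beta (p + 1) (- p))"
        unfolding riesz_potential_split[OF adm x] unfolding 2 r
        using G 2 by (simp add: abel_integral_p_zero[OF p x'] ennreal_mult'[symmetric])
    qed
  next
    case 3
    define c where "c = r / Gamma ?\<sigma> * (- p * Beta (q + 1) (- p - q))"
    have c': "c = (1 - r) / Gamma ?\<sigma> * (- q * Beta (p + 1) (- q - p))"
      using Beta_balance[OF adm 3] by (simp add: c_def)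
    have "r \<noteq> 0" using adm 3 * sin_pi_neg[of q] by (auto simp: admissible_def)
    then have r: "r > 0" using * by simp
    have B: "Beta (q + 1) (- p - q) > 0" "Beta (p + 1) (- q - p) > 0" "Beta (- p) (- q) > 0"
      using 3 * by (simp_all add: Beta_def Gamma_real_pos)
    have c: "c > 0" unfolding c_def using r B G 3 by (intro mult_pos_pos divide_pos_pos) auto
    show thesis
    proof (rule that[of "c * Beta (- p) (- q)"])
      show "c * Beta (- p) (- q) > 0" using c B by simp
      fix x :: real assume x: "0 < x" "x < 1"
      have x': "0 < 1 - x" "1 - x < 1" using x by auto
      have n1: "- p * Beta (q + 1) (- p - q) \<ge> 0" and n2: "- q * Beta (p + 1) (- q - p) \<ge> 0"
        by (rule mult_nonneg_nonneg; use 3 B in simp)+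
      have e1: "ennreal (r / Gamma ?\<sigma>) * ennreal (- p * Beta (q + 1) (- p - q)) = ennreal c"
        using r G unfolding c_def by (intro ennreal_mult'[symmetric]) auto
      have e2: "ennreal ((1 - r) / Gamma ?\<sigma>) * ennreal (- q * Beta (p + 1) (- q - p)) = ennreal c"
        using * G unfolding c' by (intro ennreal_mult'[symmetric]) auto
      show "(\<integral>\<^sup>+s. ennreal (riesz_kernel r ?\<sigma> (x - s)) \<partial>jacobi_measure p q) = ennreal (c * Beta (- p) (- q))"
      proof -
        let ?D = "\<integral>\<^sup>+y. ennreal (wt (- q - 1) (- p - 1) y) * indicator {0<..<x} y \<partial>lborel"
        let ?D' = "\<integral>\<^sup>+y. ennreal (wt (- p - 1) (- q - 1) y) * indicator {0<..<1 - x} y \<partial>lborel"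
        have "(\<integral>\<^sup>+s. ennreal (riesz_kernel r ?\<sigma> (x - s)) \<partial>jacobi_measure p q)
          = ennreal (r / Gamma ?\<sigma>) * (ennreal (- p * Beta (q + 1) (- p - q)) * ?D)
            + ennreal ((1 - r) / Gamma ?\<sigma>) * (ennreal (- q * Beta (p + 1) (- q - p)) * ?D')"
          unfolding riesz_potential_split[OF adm x]
          using 3 * x x' abel_integral_incomplete_beta[of p q x] abel_integral_incomplete_beta[of q p "1 - x"]
          by simp
        also have "\<dots> = ennreal c * ?D + ennreal c * ?D'"
          unfolding mult.assoc[symmetric] e1 e2 ..
        also have "\<dots> = ennreal c * (?D + ?D')" by (rule distrib_left[symmetric])
        also have "\<dots> = ennreal (c * Beta (- p) (- q))"
          unfolding incomplete_beta_split[OF 3 x] using c by (intro ennreal_mult'[symmetric]) simp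
        finally show ?thesis .
      qed
    qed
  qed
qed

section \<open>Duality and multiplication by the variable\<close>

definition riesz_potential :: "real \<Rightarrow> real \<Rightarrow> real \<Rightarrow> (real \<Rightarrow> real) \<Rightarrow> real \<Rightarrow> real" where
  "riesz_potential r p q \<phi> x = (\<integral>s. \<phi> s * riesz_kernel r (- p - q) (x - s) \<partial>jacobi_measure p q)"

lemma ident_measurable_jacobi: "(\<lambda>x. x) \<in> borel_measurable (jacobi_measure p q)"
  by (simp add: borel_measurable_jacobi_measure borel_measurable_lebesgue_on)

lemma riesz_kernel_shift_measurable:
  "(\<lambda>s. riesz_kernel r \<sigma> (x - s)) \<in> borel_measurable (jacobi_measure p q)"
  by (simp add: borel_measurable_jacobi_measure borel_measurable_lebesgue_on)

lemma integrable_riesz_potential: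
  assumes adm: "admissible r p q" and x: "0 < x" "x < 1"
    and \<phi>: "\<phi> \<in> borel_measurable (lebesgue_on {0<..<1})" and B: "\<And>s. s \<in> {0<..<1} \<Longrightarrow> \<bar>\<phi> s\<bar> \<le> B"
  shows "integrable (jacobi_measure p q) (\<lambda>s. \<phi> s * riesz_kernel r (- p - q) (x - s))"
proof -
  note * = admissibleD[OF adm]
  obtain C where C: "(\<integral>\<^sup>+s. ennreal (riesz_kernel r (- p - q) (x - s)) \<partial>jacobi_measure p q) = ennreal C"
    using riesz_potential_constant[OF adm] x by metis
  have k: "riesz_kernel r (- p - q) z \<ge> 0" for z using * by (intro riesz_kernel_nonneg) auto
  have "integrable (jacobi_measure p q) (\<lambda>s. riesz_kernel r (- p - q) (x - s))"
    using C k by (intro integrableI_bounded riesz_kernel_shift_measurable) auto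
  then have "integrable (jacobi_measure p q) (\<lambda>s. B * riesz_kernel r (- p - q) (x - s))" by simp
  then show ?thesis
  proof (rule Bochner_Integration.integrable_bound)
    show "AE s in jacobi_measure p q. norm (\<phi> s * riesz_kernel r (- p - q) (x - s)) \<le> norm (B * riesz_kernel r (- p - q) (x - s))"
    proof (rule AE_I2)
      fix s assume "s \<in> space (jacobi_measure p q)"
      then have "\<bar>\<phi> s\<bar> \<le> \<bar>B\<bar>" using B[of s] by auto
      then show "norm (\<phi> s * riesz_kernel r (- p - q) (x - s)) \<le> norm (B * riesz_kernel r (- p - q) (x - s))"
        by (simp add: abs_mult mult_right_mono)
    qed
    show "(\<lambda>s. \<phi> s * riesz_kernel r (- p - q) (x - s)) \<in> borel_measurable (jacobi_measure p q)"
      using \<phi> riesz_kernel_shift_measurable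
      by (intro borel_measurable_times) (simp_all only: borel_measurable_jacobi_measure)
  qed
qed

lemma riesz_potential_bound:
  assumes adm: "admissible r p q" 
    and \<phi>: "\<phi> \<in> borel_measurable (lebesgue_on {0<..<1})" and B: "\<And>s. s \<in> {0<..<1} \<Longrightarrow> \<bar>\<phi> s\<bar> \<le> B"
  obtains D where "\<And>x. 0 < x \<Longrightarrow> x < 1 \<Longrightarrow> (\<integral>s. \<bar>\<phi> s * riesz_kernel r (- p - q) (x - s)\<bar> \<partial>jacobi_measure p q) \<le> D"
proof -
  note * = admissibleD[OF adm]
  obtain C where C: "C > 0" "\<And>x. 0 < x \<Longrightarrow> x < 1 \<Longrightarrow> (\<integral>\<^sup>+s. ennreal (riesz_kernel r (- p - q) (x - s)) \<partial>jacobi_measure p q) = ennreal C"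
    using riesz_potential_constant[OF adm] by metis
  have k: "riesz_kernel r (- p - q) z \<ge> 0" for z using * by (intro riesz_kernel_nonneg) auto
  show thesis
  proof (rule that[of "B * C"])
    fix x :: real assume x: "0 < x" "x < 1"
    have "(\<integral>s. \<bar>\<phi> s * riesz_kernel r (- p - q) (x - s)\<bar> \<partial>jacobi_measure p q)
      \<le> (\<integral>s. B * riesz_kernel r (- p - q) (x - s) \<partial>jacobi_measure p q)"
    proof (rule integral_mono)
      have "integrable (jacobi_measure p q) (\<lambda>s. 1 * riesz_kernel r (- p - q) (x - s))"
        by (rule integrable_riesz_potential[OF adm x, of _ 1]) auto
      then show "integrable (jacobi_measure p q) (\<lambda>s. B * riesz_kernel r (- p - q) (x - s))" by simp
      fix s assume "s \<in> space (jacobi_measure p q)"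
      then show "\<bar>\<phi> s * riesz_kernel r (- p - q) (x - s)\<bar> \<le> B * riesz_kernel r (- p - q) (x - s)"
        using B[of s] k by (simp add: abs_mult mult_right_mono)
    qed (intro integrable_abs integrable_riesz_potential[OF adm x \<phi> B])
    also have "\<dots> = B * (\<integral>s. riesz_kernel r (- p - q) (x - s) \<partial>jacobi_measure p q)" by simp
    also have "(\<integral>s. riesz_kernel r (- p - q) (x - s) \<partial>jacobi_measure p q) = C"
      using C(1) C(2)[OF x] k
      by (subst integral_eq_nn_integral) (auto intro: riesz_kernel_shift_measurable)
    finally show "(\<integral>s. \<bar>\<phi> s * riesz_kernel r (- p - q) (x - s)\<bar> \<partial>jacobi_measure p q) \<le> B * C" .
  qed
qed

text \<open>With a Jacobi measure for \<open>N\<close> this is duality; with Lebesgue measure on a subinterval and \<open>\<psi> = 1\<close> it computes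
the primitive of a potential. The absolute integrability needed for Fubini's theorem comes from the constancy of the
potential of 1.\<close>

lemma riesz_potential_fubini:
  fixes \<psi> :: "real \<Rightarrow> real"
  assumes adm: "admissible r p q"
    and \<phi>: "\<phi> \<in> borel_measurable (lebesgue_on {0<..<1})" and B: "\<And>s. s \<in> {0<..<1} \<Longrightarrow> \<bar>\<phi> s\<bar> \<le> B"
    and N: "sigma_finite_measure N" "(\<lambda>x. x) \<in> borel_measurable N" "\<And>x. x \<in> space N \<Longrightarrow> 0 < x \<and> x < 1"
    and \<psi>: "integrable N \<psi>"
  shows "(\<integral>x. \<psi> x * riesz_potential r p q \<phi> x \<partial>N)
    = (\<integral>s. \<phi> s * (\<integral>x. \<psi> x * riesz_kernel r (- p - q) (x - s) \<partial>N) \<partial>jacobi_measure p q)"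
proof -
  note * = admissibleD[OF adm]
  let ?M = "jacobi_measure p q" and ?k = "riesz_kernel r (- p - q)"
  interpret M: finite_measure ?M using * by (intro finite_measure_jacobi) auto
  interpret N: sigma_finite_measure N by fact
  interpret pair_sigma_finite N ?M ..
  have [measurable]: "\<phi> \<in> borel_measurable ?M" "(\<lambda>x. x) \<in> borel_measurable ?M" "(\<lambda>x. x) \<in> borel_measurable N"
    "\<psi> \<in> borel_measurable N"
    using \<phi> N(2) \<psi> ident_measurable_jacobi by (auto simp: borel_measurable_jacobi_measure)
  have [measurable]: "(\<lambda>z. fst z) \<in> borel_measurable (N \<Otimes>\<^sub>M ?M)"
    using measurable_compose[OF measurable_fst N(2), of ?M] by simp
  have [measurable]: "(\<lambda>z. snd z) \<in> borel_measurable (N \<Otimes>\<^sub>M ?M)"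
    using measurable_compose[OF measurable_snd ident_measurable_jacobi, of N] by simp
  have m1: "(\<lambda>z. \<phi> (snd z)) \<in> borel_measurable (N \<Otimes>\<^sub>M ?M)"
    using \<phi> by (intro measurable_compose[OF measurable_snd]) (simp add: borel_measurable_jacobi_measure)
  have m2: "(\<lambda>z. \<psi> (fst z)) \<in> borel_measurable (N \<Otimes>\<^sub>M ?M)"
    using \<psi> by (intro measurable_compose[OF measurable_fst]) auto
  let ?f = "\<lambda>z. \<psi> (fst z) * (\<phi> (snd z) * ?k (fst z - snd z))"
  have meas: "?f \<in> borel_measurable (N \<Otimes>\<^sub>M ?M)"
    using m1 m2 by measurable
  obtain D where D: "\<And>x. 0 < x \<Longrightarrow> x < 1 \<Longrightarrow> (\<integral>s. \<bar>\<phi> s * ?k (x - s)\<bar> \<partial>?M) \<le> D"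
    using riesz_potential_bound[OF adm \<phi> B] by blast
  have int: "integrable (N \<Otimes>\<^sub>M ?M) ?f"
  proof (rule Fubini_integrable[OF meas])
    have "(\<lambda>x. \<integral>s. norm (?f (x, s)) \<partial>?M) \<in> borel_measurable N"
      using meas by (intro M.borel_measurable_lebesgue_integral) (simp add: split_beta')
    then show "integrable N (\<lambda>x. \<integral>s. norm (?f (x, s)) \<partial>?M)"
    proof (rule Bochner_Integration.integrable_bound[rotated])
      show "integrable N (\<lambda>x. D * \<psi> x)" using \<psi> by simp
      show "AE x in N. norm (\<integral>s. norm (?f (x, s)) \<partial>?M) \<le> norm (D * \<psi> x)"
      proof (rule AE_I2)
        fix x assume "x \<in> space N"
        then have x: "0 < x" "x < 1" using N(3) by auto
        have "norm (\<integral>s. norm (?f (x, s)) \<partial>?M) = (\<integral>s. norm (?f (x, s)) \<partial>?M)"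
          by (simp add: integral_nonneg_AE)
        also have "\<dots> = \<bar>\<psi> x\<bar> * (\<integral>s. \<bar>\<phi> s * ?k (x - s)\<bar> \<partial>?M)"
          by (simp add: abs_mult)
        also have "\<dots> \<le> \<bar>\<psi> x\<bar> * \<bar>D\<bar>" using D[OF x] by (intro mult_left_mono) auto
        finally show "norm (\<integral>s. norm (?f (x, s)) \<partial>?M) \<le> norm (D * \<psi> x)"
          by (simp add: abs_mult mult.commute)
      qed
    qed
    show "AE x in N. integrable ?M (\<lambda>s. ?f (x, s))"
    proof (rule AE_I2)
      fix x assume "x \<in> space N"
      then have x: "0 < x" "x < 1" using N(3) by auto
      show "integrable ?M (\<lambda>s. ?f (x, s))"
        using integrable_riesz_potential[OF adm x \<phi> B] by simp
    qed
  qed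
  have "(\<integral>x. \<psi> x * riesz_potential r p q \<phi> x \<partial>N) = (\<integral>x. (\<integral>s. \<psi> x * (\<phi> s * ?k (x - s)) \<partial>?M) \<partial>N)"
    by (simp add: riesz_potential_def)
  also have "\<dots> = (\<integral>s. (\<integral>x. \<psi> x * (\<phi> s * ?k (x - s)) \<partial>N) \<partial>?M)"
    using int by (intro Fubini_integral[symmetric]) (simp add: split_beta')
  also have "\<dots> = (\<integral>s. \<phi> s * (\<integral>x. \<psi> x * ?k (x - s) \<partial>N) \<partial>?M)"
    by (simp add: mult.left_commute[of "\<psi> _"])
  finally show ?thesis .
qed

lemma poly_borel_unit: "poly P \<in> borel_measurable (lebesgue_on {0<..<1})" for P :: "real poly"
  by (intro borel_measurable_lebesgue_on poly_measurable)

theorem riesz_potential_adjoint: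
  assumes adm: "admissible r p q"
  shows "(\<integral>x. poly \<psi> x * riesz_potential r p q (poly \<phi>) x \<partial>jacobi_measure q p)
       = (\<integral>s. poly \<phi> s * riesz_potential (1 - r) q p (poly \<psi>) s \<partial>jacobi_measure p q)"
proof -
  note * = admissibleD[OF adm]
  interpret finite_measure "jacobi_measure q p" using * by (intro finite_measure_jacobi) auto
  obtain B where B: "\<And>s. s \<in> {0..1} \<Longrightarrow> \<bar>poly \<phi> s\<bar> \<le> B" using poly_bounded_unit_interval[of \<phi>] by metis
  have "riesz_kernel r (- p - q) (x - s) = riesz_kernel (1 - r) (- q - p) (s - x)" for x s
  proof -
    have "- q - p = - p - q" by simp
    then show ?thesis using riesz_kernel_uminus[of r "- p - q" "s - x"] by (simp only: minus_diff_eq)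
  qed
  moreover have "(\<integral>x. poly \<psi> x * riesz_potential r p q (poly \<phi>) x \<partial>jacobi_measure q p)
    = (\<integral>s. poly \<phi> s * (\<integral>x. poly \<psi> x * riesz_kernel r (- p - q) (x - s) \<partial>jacobi_measure q p) \<partial>jacobi_measure p q)"
  proof (rule riesz_potential_fubini[OF adm poly_borel_unit])
    show "integrable (jacobi_measure q p) (poly \<psi>)" using * by (intro integrable_poly_jacobi) auto
    show "\<bar>poly \<phi> s\<bar> \<le> B" if "s \<in> {0<..<1}" for s using B that by simp
  qed (auto intro: sigma_finite_measure_axioms ident_measurable_jacobi)
  ultimately show ?thesis by (simp only: riesz_potential_def)
qed

text \<open>The function \<open>z * riesz_kernel r \<sigma> z\<close> is continuous because \<open>\<sigma> > 0\<close>, and its derivative away from 0 is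
\<open>\<sigma> * riesz_kernel r \<sigma> z\<close>. The single exceptional point does not affect the fundamental theorem of calculus.\<close>

lemma riesz_kernel_primitive:
  assumes \<sigma>: "0 < \<sigma>" and r: "0 \<le> r" "r \<le> 1" and yx: "y \<le> x"
  shows "\<sigma> * (\<integral>z. riesz_kernel r \<sigma> (z - s) \<partial>lebesgue_on {y<..<x})
     = (x - s) * riesz_kernel r \<sigma> (x - s) - (y - s) * riesz_kernel r \<sigma> (y - s)"
proof -
  let ?k = "riesz_kernel r \<sigma>"
  define G where "G z = (r * (max z 0) powr \<sigma> - (1 - r) * (max (- z) 0) powr \<sigma>) / Gamma \<sigma>" for z
  have G0: "Gamma \<sigma> > 0" using \<sigma> by (rule Gamma_real_pos)
  have pw: "z powr \<sigma> = z * z powr (\<sigma> - 1)" if "z > 0" for z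
    using that powr_add[of z 1 "\<sigma> - 1"] by simp
  have G: "G z = z * ?k z" for z
    using \<sigma> pw[of z] pw[of "- z"] by (cases z "0::real" rule: linorder_cases) (simp_all add: G_def riesz_kernel_def)
  have der: "(G has_real_derivative \<sigma> * ?k z) (at z)" if "z \<noteq> 0" for z
  proof (cases "z > 0")
    case True
    have "((\<lambda>z. r * z powr \<sigma> / Gamma \<sigma>) has_real_derivative \<sigma> * ?k z) (at z)"
      using True G0 by (auto intro!: derivative_eq_intros simp: riesz_kernel_def)
    then show ?thesis
      by (rule has_field_derivative_transform_within_open[of _ _ _ "{0<..}"]) (use True in \<open>auto simp: G_def\<close>)
  next
    case False
    then have z: "z < 0" using that by simp
    have "((\<lambda>z. - ((1 - r) * (- z) powr \<sigma>) / Gamma \<sigma>) has_real_derivative \<sigma> * ?k z) (at z)"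
      using z G0 by (auto intro!: derivative_eq_intros simp: riesz_kernel_def)
    then show ?thesis
      by (rule has_field_derivative_transform_within_open[of _ _ _ "{..<0}"]) (use z in \<open>auto simp: G_def\<close>)
  qed
  have contG: "continuous_on S G" for S
  proof -
    have "continuous_on S (\<lambda>z. max z 0 powr \<sigma>)" "continuous_on S (\<lambda>z. max (- z) 0 powr \<sigma>)"
      using \<sigma> by (intro continuous_on_powr' continuous_on_max continuous_intros; simp)+
    then show ?thesis
      unfolding G_def divide_inverse by (intro continuous_on_mult continuous_on_diff continuous_on_const)
  qed
  have "((\<lambda>z. \<sigma> * ?k (z - s)) has_integral (G (x - s) - G (y - s))) {y..x}"
  proof (rule fundamental_theorem_of_calculus_interior_strong[where S = "{s}" and f = "\<lambda>z. G (z - s)"])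
    fix z assume "z \<in> {y<..<x} - {s}"
    then have "(G has_real_derivative \<sigma> * ?k (z - s)) (at (z - s))" by (intro der) auto
    then have "((\<lambda>z. G (z - s)) has_real_derivative \<sigma> * ?k (z - s) * 1) (at z)"
      by (rule DERIV_chain2) (auto intro!: derivative_eq_intros)
    then show "((\<lambda>z. G (z - s)) has_vector_derivative \<sigma> * ?k (z - s)) (at z)"
      by (simp add: has_real_derivative_iff_has_vector_derivative)
  next
    show "continuous_on {y..x} (\<lambda>z. G (z - s))"
      by (rule continuous_on_compose2[OF contG[of UNIV]]) (auto intro!: continuous_intros)
  qed (use yx in auto)
  then have hi: "((\<lambda>z. \<sigma> * ?k (z - s)) has_integral (G (x - s) - G (y - s))) {y<..<x}"
    by (simp add: has_integral_Icc_iff_Ioo)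
  then have "(\<lambda>z. \<sigma> * ?k (z - s)) absolutely_integrable_on {y<..<x}"
    using \<sigma> r by (intro nonnegative_absolutely_integrable_1) (auto simp: riesz_kernel_nonneg)
  then have "integrable (lebesgue_on {y<..<x}) (\<lambda>z. \<sigma> * ?k (z - s))"
    using integrable_restrict_space[of "{y<..<x}" lebesgue "\<lambda>z. \<sigma> * ?k (z - s)"]
    unfolding set_integrable_def by simp
  then have "(\<integral>z. \<sigma> * ?k (z - s) \<partial>lebesgue_on {y<..<x}) = integral {y<..<x} (\<lambda>z. \<sigma> * ?k (z - s))"
    by (rule lebesgue_integral_eq_integral) simp
  also have "\<dots> = G (x - s) - G (y - s)" by (rule integral_unique[OF hi])
  finally show ?thesis by (simp add: G)
qed

text \<open>Integrating the potential over \<open>(y, x)\<close> under the integral sign produces \<open>(x - s) * k (x - s)\<close>, and the factor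
\<open>x - s\<close> splits into multiplication by \<open>x\<close> outside and by \<open>s\<close> inside the potential.\<close>

lemma riesz_potential_times_x_diff:
  assumes adm: "admissible r p q" and yx: "0 < y" "y \<le> x" "x < 1"
  shows "(- p - q) * (\<integral>z. riesz_potential r p q (poly \<phi>) z \<partial>lebesgue_on {y<..<x})
     = (x * riesz_potential r p q (poly \<phi>) x - riesz_potential r p q (poly ([:0, 1:] * \<phi>)) x)
       - (y * riesz_potential r p q (poly \<phi>) y - riesz_potential r p q (poly ([:0, 1:] * \<phi>)) y)"
proof -
  note * = admissibleD[OF adm]
  let ?k = "riesz_kernel r (- p - q)" and ?M = "jacobi_measure p q"
  have bnd: "\<exists>B. \<forall>s\<in>{0<..<1}. \<bar>poly P s\<bar> \<le> B" for P :: "real poly"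
    using poly_bounded_unit_interval[of P] by (metis greaterThanLessThan_subseteq_atLeastAtMost_iff subset_iff order_refl)
  obtain B where B: "\<And>s. s \<in> {0<..<1} \<Longrightarrow> \<bar>poly \<phi> s\<bar> \<le> B" using bnd[of \<phi>] by blast
  have int: "integrable ?M (\<lambda>s. poly P s * ?k (z - s))" if "0 < z" "z < 1" for P z
    using bnd[of P] integrable_riesz_potential[OF adm that poly_borel_unit] by blast
  interpret fm: finite_measure "lebesgue_on {y<..<x}"
    by (rule finite_measure_lebesgue_on) auto
  have "(\<integral>z. 1 * riesz_potential r p q (poly \<phi>) z \<partial>lebesgue_on {y<..<x})
     = (\<integral>s. poly \<phi> s * (\<integral>z. 1 * ?k (z - s) \<partial>lebesgue_on {y<..<x}) \<partial>?M)"
    using yx B by (intro riesz_potential_fubini[OF adm poly_borel_unit, where B = B])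
      (auto intro: fm.sigma_finite_measure_axioms borel_measurable_lebesgue_on)
  then have "(- p - q) * (\<integral>z. riesz_potential r p q (poly \<phi>) z \<partial>lebesgue_on {y<..<x})
     = (\<integral>s. poly \<phi> s * ((- p - q) * (\<integral>z. ?k (z - s) \<partial>lebesgue_on {y<..<x})) \<partial>?M)"
    by (simp only: mult_1 mult.left_commute[of "poly \<phi> _"] integral_mult_right_zero)
  also have "\<dots> = (\<integral>s. (x * (poly \<phi> s * ?k (x - s)) - poly ([:0, 1:] * \<phi>) s * ?k (x - s))
       - (y * (poly \<phi> s * ?k (y - s)) - poly ([:0, 1:] * \<phi>) s * ?k (y - s)) \<partial>?M)"
    using * yx by (subst riesz_kernel_primitive) (auto simp: algebra_simps)
  also have "\<dots> = (x * (\<integral>s. poly \<phi> s * ?k (x - s) \<partial>?M) - (\<integral>s. poly ([:0, 1:] * \<phi>) s * ?k (x - s) \<partial>?M))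
       - (y * (\<integral>s. poly \<phi> s * ?k (y - s) \<partial>?M) - (\<integral>s. poly ([:0, 1:] * \<phi>) s * ?k (y - s) \<partial>?M))"
    using int[of x \<phi>] int[of x "[:0, 1:] * \<phi>"] int[of y \<phi>] int[of y "[:0, 1:] * \<phi>"] yx
    by (simp del: poly_mult)
  finally show ?thesis by (simp only: riesz_potential_def)
qed

section \<open>Riesz potentials of polynomials\<close>

lemma riesz_potential_one:
  assumes adm: "admissible r p q"
  obtains C where "C > 0" "\<And>x. 0 < x \<Longrightarrow> x < 1 \<Longrightarrow> riesz_potential r p q (poly 1) x = C"
proof -
  note * = admissibleD[OF adm]
  obtain C where C: "C > 0" "\<And>x. 0 < x \<Longrightarrow> x < 1 \<Longrightarrow> (\<integral>\<^sup>+s. ennreal (riesz_kernel r (- p - q) (x - s)) \<partial>jacobi_measure p q) = ennreal C"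
    using riesz_potential_constant[OF adm] by metis
  have k: "riesz_kernel r (- p - q) z \<ge> 0" for z using * by (intro riesz_kernel_nonneg) auto
  show thesis
  proof (rule that[OF C(1)])
    fix x :: real assume x: "0 < x" "x < 1"
    have "riesz_potential r p q (poly 1) x = (\<integral>s. riesz_kernel r (- p - q) (x - s) \<partial>jacobi_measure p q)"
      by (simp add: riesz_potential_def)
    also have "\<dots> = enn2real (ennreal C)"
      unfolding C(2)[OF x, symmetric] using k
      by (intro integral_eq_nn_integral) (auto intro: riesz_kernel_shift_measurable)
    finally show "riesz_potential r p q (poly 1) x = C" using C(1) by simp
  qed
qed

lemma riesz_potential_poly_add:
  assumes adm: "admissible r p q" and x: "0 < x" "x < 1"
  shows "riesz_potential r p q (poly (P + Q)) x = riesz_potential r p q (poly P) x + riesz_potential r p q (poly Q) x"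
proof -
  have int: "integrable (jacobi_measure p q) (\<lambda>s. poly P s * riesz_kernel r (- p - q) (x - s))" for P
  proof -
    obtain B where "\<And>s. s \<in> {0..1} \<Longrightarrow> \<bar>poly P s\<bar> \<le> B" using poly_bounded_unit_interval[of P] by metis
    then show ?thesis by (intro integrable_riesz_potential[OF adm x poly_borel_unit, of _ B]) auto
  qed
  show ?thesis
    unfolding riesz_potential_def poly_add distrib_right by (rule Bochner_Integration.integral_add[OF int int])
qed

lemma riesz_potential_poly_smult:
  "riesz_potential r p q (poly (smult c P)) x = c * riesz_potential r p q (poly P) x"
  by (simp add: riesz_potential_def mult.assoc)

definition poly_primitive :: "real poly \<Rightarrow> real poly" where
  "poly_primitive P = (\<Sum>i\<le>degree P. monom (coeff P i / real (Suc i)) (Suc i))"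

lemma pderiv_poly_primitive: "pderiv (poly_primitive P) = P"
proof -
  have "pderiv (poly_primitive P) = (\<Sum>i\<le>degree P. monom (coeff P i) i)"
    unfolding poly_primitive_def pderiv_sum by (intro sum.cong refl) (simp add: pderiv_monom)
  then show ?thesis by (simp add: poly_as_sum_of_monoms)
qed

lemma degree_poly_primitive: "degree (poly_primitive P) \<le> Suc (degree P)"
  unfolding poly_primitive_def
  by (intro degree_sum_le) (auto intro: order_trans[OF degree_monom_le])

lemma coeff_poly_primitive: "coeff (poly_primitive P) (Suc n) = coeff P n / real (Suc n)"
  using arg_cong[OF pderiv_poly_primitive[of P], of "\<lambda>R. coeff R n"] by (simp add: coeff_pderiv field_simps)

lemma integral_poly_lebesgue_on:
  assumes "y \<le> x"
  shows "(\<integral>z. poly P z \<partial>lebesgue_on {y<..<x}) = poly (poly_primitive P) x - poly (poly_primitive P) y"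
proof -
  have "(poly P has_integral (poly (poly_primitive P) x - poly (poly_primitive P) y)) {y..x}"
  proof (rule fundamental_theorem_of_calculus[OF assms])
    fix z
    have "(poly (poly_primitive P) has_real_derivative poly P z) (at z within {y..x})"
      using poly_DERIV[of "poly_primitive P" z] by (simp add: pderiv_poly_primitive has_field_derivative_at_within)
    then show "(poly (poly_primitive P) has_vector_derivative poly P z) (at z within {y..x})"
      by (simp add: has_real_derivative_iff_has_vector_derivative)
  qed
  then have hi: "(poly P has_integral (poly (poly_primitive P) x - poly (poly_primitive P) y)) {y<..<x}"
    by (simp add: has_integral_Icc_iff_Ioo)
  have "set_integrable lborel {y..x} (poly P)"
    by (intro borel_integrable_atLeastAtMost' continuous_intros)
  then have "set_integrable lborel {y<..<x} (poly P)"
    by (rule set_integrable_subset) auto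
  then have "set_integrable lebesgue {y<..<x} (poly P)"
    unfolding set_integrable_def by (subst integrable_completion) (auto intro: poly_measurable)
  then have "integrable (lebesgue_on {y<..<x}) (poly P)"
    using integrable_restrict_space[of "{y<..<x}" lebesgue "poly P"] unfolding set_integrable_def by simp
  from lebesgue_integral_eq_integral[OF this] hi show ?thesis by (simp add: integral_unique)
qed

definition riesz_multiplier :: "real \<Rightarrow> real \<Rightarrow> nat \<Rightarrow> real" where
  "riesz_multiplier C \<sigma> n = C * (\<Prod>i<n. (real (Suc i) - \<sigma>) / real (Suc i))"

lemma riesz_multiplier_pos:
  assumes "C > 0" "\<sigma> < 1"
  shows "riesz_multiplier C \<sigma> n > 0"
  unfolding riesz_multiplier_def using assms by (intro mult_pos_pos prod_pos divide_pos_pos) auto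

text \<open>Passing from \<open>n\<close> to \<open>n + 1\<close> multiplies the right-hand side by \<open>(n + 2 - \<sigma>) / (n + 1)\<close>, which is at least 1.\<close>

lemma riesz_multiplier_lower_bound:
  assumes C: "C > 0" and \<sigma>: "\<sigma> < 1"
  shows "C * (1 - \<sigma>) \<le> real (Suc n) * riesz_multiplier C \<sigma> (Suc n)"
proof (induction n)
  case 0
  then show ?case by (simp add: riesz_multiplier_def)
next
  case (Suc n)
  have "real (Suc n) * riesz_multiplier C \<sigma> (Suc n) \<le> (real (Suc (Suc n)) - \<sigma>) * riesz_multiplier C \<sigma> (Suc n)"
    using riesz_multiplier_pos[OF C \<sigma>, of "Suc n"] \<sigma> by (intro mult_right_mono) auto
  also have "\<dots> = real (Suc (Suc n)) * riesz_multiplier C \<sigma> (Suc (Suc n))"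
    unfolding riesz_multiplier_def prod.lessThan_Suc[of _ "Suc n"] by simp
  finally show ?case using Suc by simp
qed

text \<open>In the induction step \<open>\<phi> = c + s * \<psi>\<close>. The potential of \<open>s * \<psi>\<close> equals \<open>x\<close> times that of \<open>\<psi>\<close> minus \<open>\<sigma>\<close> times a
primitive of it, up to an additive constant. The leading coefficient thereby acquires the factor \<open>1 - \<sigma> / (n + 1)\<close>.\<close>

theorem riesz_potential_poly:
  assumes adm: "admissible r p q"
    and C: "\<And>x. 0 < x \<Longrightarrow> x < 1 \<Longrightarrow> riesz_potential r p q (poly 1) x = C"
    and deg: "degree \<phi> \<le> n"
  shows "\<exists>P. degree P \<le> n \<and> coeff P n = riesz_multiplier C (- p - q) n * coeff \<phi> n \<and>
    (\<forall>x. 0 < x \<longrightarrow> x < 1 \<longrightarrow> riesz_potential r p q (poly \<phi>) x = poly P x)"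
  using deg
proof (induction n arbitrary: \<phi>)
  case 0
  then obtain c where \<phi>: "\<phi> = [:c:]" using degree0_coeffs by auto
  have "\<phi> = smult c 1" by (simp add: \<phi>)
  then have T: "riesz_potential r p q (poly \<phi>) x = poly [:C * c:] x" if "0 < x" "x < 1" for x
    using riesz_potential_poly_smult[of r p q c 1 x] C[OF that] by (simp only:) simp
  show ?case
  proof (intro exI[of _ "[:C * c:]"] conjI allI impI)
    show "coeff [:C * c:] 0 = riesz_multiplier C (- p - q) 0 * coeff \<phi> 0"
      by (simp add: riesz_multiplier_def \<phi>)
  qed (simp, rule T)
next
  case (Suc n)
  let ?T = "\<lambda>\<phi>. riesz_potential r p q (poly \<phi>)" and ?\<sigma> = "- p - q"
  obtain c \<psi> where \<phi>: "\<phi> = pCons c \<psi>" by (cases \<phi>) auto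
  have "degree \<psi> \<le> n" using Suc.prems by (auto simp: \<phi> split: if_splits)
  from Suc.IH[OF this] obtain P where P: "degree P \<le> n" "coeff P n = riesz_multiplier C ?\<sigma> n * coeff \<psi> n"
    "\<And>x. 0 < x \<Longrightarrow> x < 1 \<Longrightarrow> ?T \<psi> x = poly P x" by blast
  let ?Q = "poly_primitive P"
  define R where "R = [:0, 1:] * P - smult ?\<sigma> ?Q"
  define g where "g x = ?T ([:0, 1:] * \<psi>) x - poly R x" for x
  have g_eq: "g x = g y" if yx: "0 < y" "y \<le> x" "x < 1" for x y
  proof -
    have "(\<integral>z. ?T \<psi> z \<partial>lebesgue_on {y<..<x}) = (\<integral>z. poly P z \<partial>lebesgue_on {y<..<x})"
      using yx by (intro Bochner_Integration.integral_cong refl P(3)) auto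
    also have "\<dots> = poly ?Q x - poly ?Q y" by (rule integral_poly_lebesgue_on[OF yx(2)])
    finally have "?\<sigma> * (poly ?Q x - poly ?Q y)
        = (x * poly P x - ?T ([:0, 1:] * \<psi>) x) - (y * poly P y - ?T ([:0, 1:] * \<psi>) y)"
      using riesz_potential_times_x_diff[OF adm yx, of \<psi>] P(3)[of x] P(3)[of y] yx by (simp only:)
    then show ?thesis unfolding g_def R_def by (simp add: algebra_simps)
  qed
  have g_const: "g x = g (1/2)" if "0 < x" "x < 1" for x
  proof (cases "x \<le> 1/2")
    case True
    then show ?thesis using g_eq[of x "1/2"] that by simp
  next
    case False
    then show ?thesis using g_eq[of "1/2" x] that by simp
  qed
  let ?S = "R + [:g (1/2) + c * C:]"
  have "?T \<phi> x = poly ?S x" if x: "0 < x" "x < 1" for x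
  proof -
    have "\<phi> = [:0, 1:] * \<psi> + smult c 1" by (simp add: \<phi> one_pCons)
    then have "?T \<phi> x = ?T ([:0, 1:] * \<psi>) x + c * C"
      using riesz_potential_poly_add[OF adm x, of "[:0, 1:] * \<psi>" "smult c 1"]
        riesz_potential_poly_smult[of r p q c 1 x] C[OF x] by (simp only:)
    also have "?T ([:0, 1:] * \<psi>) x = g (1/2) + poly R x" using g_const[OF x] by (simp add: g_def)
    finally show ?thesis by simp
  qed
  moreover have "degree R \<le> Suc n"
    unfolding R_def using P(1) degree_poly_primitive[of P]
    by (intro degree_diff_le order_trans[OF degree_mult_le] order_trans[OF degree_smult_le]) auto
  then have "degree ?S \<le> Suc n" by (intro degree_add_le) auto
  moreover have "coeff ?S (Suc n) = riesz_multiplier C ?\<sigma> (Suc n) * coeff \<phi> (Suc n)"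
  proof -
    have "coeff ?S (Suc n) = coeff P n - ?\<sigma> * (coeff P n / real (Suc n))"
      by (simp add: R_def coeff_poly_primitive)
    also have "\<dots> = (real (Suc n) - ?\<sigma>) / real (Suc n) * coeff P n"
      by (simp add: field_simps)
    finally show ?thesis by (simp add: P(2) \<phi> riesz_multiplier_def)
  qed
  ultimately show ?case by (intro exI[of _ ?S] conjI allI impI)
qed

text \<open>Moving the potential to the other factor of the inner product leaves a Jacobi polynomial paired with a polynomial
whose degree does not exceed that of \<open>\<psi>\<close>. This gives orthogonality for smaller degrees; for the image itself it gives the norm as
the product of the two leading-coefficient multipliers with the norm of the Jacobi polynomial. The last conclusion
compares the norm for the raised weight with that of the image under the operator, whose factor \<open>Suc n\<close> comes from
differentiating.\<close>

theorem riesz_potential_jacobi: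
  assumes adm: "admissible r p q"
  obtains P :: "nat \<Rightarrow> real poly" and c :: real where
    "c > 0"
    "\<And>n. degree (P n) \<le> n" "\<And>n. coeff (P n) n > 0"
    "\<And>n x. 0 < x \<Longrightarrow> x < 1 \<Longrightarrow> riesz_potential r p q (poly (jacobi_poly n p q)) x = poly (P n) x"
    "\<And>n \<psi>. degree \<psi> < n \<Longrightarrow> jint q p (\<psi> * P n) = 0"
    "\<And>n. jint q p (P n * P n) > 0"
    "\<And>n. c * jint (p + 1) (q + 1) (jacobi_poly n (p + 1) (q + 1) * jacobi_poly n (p + 1) (q + 1))
       \<le> (real (Suc n))\<^sup>2 * jint q p (P (Suc n) * P (Suc n))"
proof -
  note * = admissibleD[OF adm]
  let ?\<sigma> = "- p - q"
  let ?J = "\<lambda>n. jacobi_poly n p q"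
  obtain C where C: "C > 0" "\<And>x. 0 < x \<Longrightarrow> x < 1 \<Longrightarrow> riesz_potential r p q (poly 1) x = C"
    using riesz_potential_one[OF adm] by metis
  obtain C' where C': "C' > 0" "\<And>x. 0 < x \<Longrightarrow> x < 1 \<Longrightarrow> riesz_potential (1 - r) q p (poly 1) x = C'"
    using riesz_potential_one[OF admissible_swap[OF adm]] by metis
  define \<kappa> where "\<kappa> = riesz_multiplier C ?\<sigma>"
  define \<kappa>' where "\<kappa>' = riesz_multiplier C' (- q - p)"
  have \<kappa>_pos: "\<kappa> n > 0" "\<kappa>' n > 0" for n
    unfolding \<kappa>_def \<kappa>'_def using * C C' by (auto intro!: riesz_multiplier_pos)
  have pq: "p > -1" "q > -1" using * by auto
  have lc: "jacobi_lc n p q > 0" for n by (rule jacobi_lc_pos[OF pq])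
  have "\<exists>P. degree P \<le> n \<and> coeff P n = \<kappa> n * jacobi_lc n p q \<and>
    (\<forall>x. 0 < x \<longrightarrow> x < 1 \<longrightarrow> riesz_potential r p q (poly (?J n)) x = poly P x)" for n
    unfolding \<kappa>_def by (rule riesz_potential_poly[OF adm C(2) degree_jacobi_poly])
  then obtain P where P: "\<And>n. degree (P n) \<le> n" "\<And>n. coeff (P n) n = \<kappa> n * jacobi_lc n p q"
    "\<And>n x. 0 < x \<Longrightarrow> x < 1 \<Longrightarrow> riesz_potential r p q (poly (?J n)) x = poly (P n) x"
    by metis
  have dual: "\<exists>Q. degree Q \<le> m \<and> coeff Q m = \<kappa>' m * coeff \<psi> m \<and> jint q p (\<psi> * P n) = jint p q (?J n * Q)"
    if deg: "degree \<psi> \<le> m" for \<psi> m n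
  proof -
    obtain Q where Q: "degree Q \<le> m" "coeff Q m = \<kappa>' m * coeff \<psi> m"
      "\<And>x. 0 < x \<Longrightarrow> x < 1 \<Longrightarrow> riesz_potential (1 - r) q p (poly \<psi>) x = poly Q x"
      using riesz_potential_poly[OF admissible_swap[OF adm] C'(2) deg] unfolding \<kappa>'_def by blast
    have "jint q p (\<psi> * P n) = (\<integral>x. poly \<psi> x * riesz_potential r p q (poly (?J n)) x \<partial>jacobi_measure q p)"
      by (intro Bochner_Integration.integral_cong refl) (simp add: P(3))
    also have "\<dots> = (\<integral>x. poly (?J n) x * riesz_potential (1 - r) q p (poly \<psi>) x \<partial>jacobi_measure p q)"
      by (rule riesz_potential_adjoint[OF adm])
    also have "\<dots> = jint p q (?J n * Q)"
      by (intro Bochner_Integration.integral_cong refl) (simp add: Q(3))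
    finally show ?thesis using Q by blast
  qed
  have orth: "jint q p (\<psi> * P n) = 0" if "degree \<psi> < n" for \<psi> n
  proof -
    obtain Q where Q: "degree Q \<le> degree \<psi>" "jint q p (\<psi> * P n) = jint p q (?J n * Q)"
      using dual[of \<psi> "degree \<psi>" n] by blast
    have "degree Q < n" using Q(1) that by simp
    then show ?thesis unfolding Q(2) by (rule jacobi_poly_orthogonal[OF pq])
  qed
  have norm: "jint q p (P n * P n) = \<kappa> n * \<kappa>' n * jint p q (?J n * ?J n)" for n
  proof -
    obtain Q where Q: "degree Q \<le> n" "coeff Q n = \<kappa>' n * coeff (P n) n" "jint q p (P n * P n) = jint p q (?J n * Q)"
      using dual[OF P(1), of n n] by blast
    show ?thesis unfolding Q(3) jint_jacobi_poly[OF pq Q(1)] using lc[of n] by (simp add: Q(2) P(2) del: poly_mult)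
  qed
  have c: "C * (1 - ?\<sigma>) > 0" "C' * (1 - ?\<sigma>) > 0" using C C' * by auto
  show thesis
  proof (rule that[of "C * (1 - ?\<sigma>) * (C' * (1 - ?\<sigma>))" P])
    show "C * (1 - ?\<sigma>) * (C' * (1 - ?\<sigma>)) > 0" using c by (rule mult_pos_pos)
    show "coeff (P n) n > 0" for n unfolding P(2) using \<kappa>_pos lc by (intro mult_pos_pos) auto
    show "jint q p (P n * P n) > 0" for n
      unfolding norm by (intro mult_pos_pos \<kappa>_pos jacobi_norm_pos pq)
    fix n
    let ?h = "jint p q (?J (Suc n) * ?J (Suc n))"
    let ?h' = "jint (p + 1) (q + 1) (jacobi_poly n (p + 1) (q + 1) * jacobi_poly n (p + 1) (q + 1))"
    have h'_pos: "?h' > 0" using pq by (intro jacobi_norm_pos) auto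
    have "real (Suc n) * ?h' \<le> (real n + p + q + 2) * ?h'"
      using * h'_pos by (intro mult_right_mono less_imp_le[OF h'_pos]) auto
    also have "\<dots> = real (Suc n) * ?h" by (rule jacobi_norm_Suc[OF pq, symmetric])
    finally have h: "?h' \<le> ?h" by (rule mult_left_le_imp_le) simp
    have "C * (1 - ?\<sigma>) * (C' * (1 - ?\<sigma>)) \<le> (real (Suc n) * \<kappa> (Suc n)) * (real (Suc n) * \<kappa>' (Suc n))"
    proof (rule mult_mono)
      show "C * (1 - ?\<sigma>) \<le> real (Suc n) * \<kappa> (Suc n)"
        unfolding \<kappa>_def using C(1) * by (intro riesz_multiplier_lower_bound) auto
      have "C' * (1 - (- q - p)) \<le> real (Suc n) * \<kappa>' (Suc n)"
        unfolding \<kappa>'_def using C'(1) * by (intro riesz_multiplier_lower_bound) auto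
      then show "C' * (1 - ?\<sigma>) \<le> real (Suc n) * \<kappa>' (Suc n)" by (simp add: algebra_simps)
    qed (use c \<kappa>_pos[of "Suc n"] in auto)
    then have "C * (1 - ?\<sigma>) * (C' * (1 - ?\<sigma>)) * ?h' \<le> (real (Suc n) * \<kappa> (Suc n)) * (real (Suc n) * \<kappa>' (Suc n)) * ?h"
    proof (rule mult_mono[OF _ h])
      show "0 \<le> real (Suc n) * \<kappa> (Suc n) * (real (Suc n) * \<kappa>' (Suc n))"
        using \<kappa>_pos[of "Suc n"] by simp
      show "0 \<le> ?h'" by (rule less_imp_le[OF h'_pos])
    qed
    then show "C * (1 - ?\<sigma>) * (C' * (1 - ?\<sigma>)) * ?h' \<le> (real (Suc n))\<^sup>2 * jint q p (P (Suc n) * P (Suc n))"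
      unfolding norm by (simp only: power2_eq_square mult_ac)
  qed (use P orth in auto)
qed

section \<open>The fractional operator on truncated expansions\<close>

lemma integrable_lebesgue_on_subset:
  fixes f :: "real \<Rightarrow> real"
  assumes "S \<in> sets lebesgue" "T \<in> sets lebesgue" "S \<subseteq> T" "integrable (lebesgue_on T) f"
  shows "integrable (lebesgue_on S) f"
proof -
  have "set_integrable lebesgue T f"
    using assms integrable_restrict_space[of T lebesgue f] by (simp add: set_integrable_def)
  then have "set_integrable lebesgue S f" by (rule set_integrable_subset) (use assms in auto)
  then show ?thesis
    using assms integrable_restrict_space[of S lebesgue f] by (simp add: set_integrable_def)
qed

lemma integral_lebesgue_on_split:
  fixes h :: "real \<Rightarrow> real"
  assumes h: "integrable (lebesgue_on {0<..<1}) h" and x: "0 < x" "x < 1"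
  shows "(\<integral>s. h s \<partial>lebesgue_on {0<..<1}) = (\<integral>s. h s \<partial>lebesgue_on {0<..<x}) + (\<integral>s. h s \<partial>lebesgue_on {x<..<1})"
proof -
  have l: "integrable (lebesgue_on {0<..<x}) h" and r: "integrable (lebesgue_on {x<..<1}) h"
    by (rule integrable_lebesgue_on_subset[OF _ _ _ h]; use x in force)+
  have eq: "(\<integral>s. h s \<partial>lebesgue_on S) = (\<integral>s. indicator S s * h s \<partial>lebesgue)" if "S \<in> sets lebesgue" for S
    using that integral_restrict_space[of S lebesgue h] by simp
  have i: "integrable lebesgue (\<lambda>s. indicator S s * h s)" if "S \<in> sets lebesgue" "integrable (lebesgue_on S) h" for S
    using that integrable_restrict_space[of S lebesgue h] by simp
  have "(\<integral>s. h s \<partial>lebesgue_on {0<..<x}) + (\<integral>s. h s \<partial>lebesgue_on {x<..<1})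
    = (\<integral>s. indicator {0<..<x} s * h s + indicator {x<..<1} s * h s \<partial>lebesgue)"
    using i[OF _ l] i[OF _ r] by (simp add: eq)
  also have "\<dots> = (\<integral>s. indicator {0<..<1} s * h s \<partial>lebesgue)"
  proof (rule integral_cong_AE)
    have "AE s in lborel. s \<noteq> x" by (rule AE_lborel_singleton)
    then have "AE s in lebesgue. s \<noteq> x" by (rule AE_completion)
    then show "AE s in lebesgue. indicator {0<..<x} s * h s + indicator {x<..<1} s * h s = indicator {0<..<1} s * h s"
      by eventually_elim (use x in \<open>auto split: split_indicator\<close>)
    show "(\<lambda>s. indicator {0<..<x} s * h s + indicator {x<..<1} s * h s) \<in> borel_measurable lebesgue"
      using i[OF _ l] i[OF _ r] by (intro borel_measurable_add) auto
    show "(\<lambda>s. indicator {0<..<1} s * h s) \<in> borel_measurable lebesgue"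
      using i[OF _ h] by auto
  qed
  finally show ?thesis by (simp add: eq)
qed

text \<open>Multiplying by \<open>r\<close> and \<open>1 - r\<close> under the two integral signs merges them into one integral over \<open>(0, 1)\<close>,
which is the potential of the derivative of \<open>u\<close> stripped of its weight.\<close>

lemma L_op_eq_riesz_potential:
  assumes adm: "admissible r p q" and \<alpha>: "2 - \<alpha> = - p - q"
    and u: "\<And>s. s \<in> {0<..<1} \<Longrightarrow> deriv u s = wt p q s * poly \<phi> s"
    and x: "0 < x" "x < 1"
  shows "L_op r \<alpha> u x = - riesz_potential r p q (poly \<phi>) x"
proof -
  let ?\<sigma> = "- p - q" and ?k = "riesz_kernel r (- p - q)"
  let ?h = "\<lambda>s. wt p q s * (poly \<phi> s * ?k (x - s))"
  obtain B where B: "\<And>s. s \<in> {0..1} \<Longrightarrow> \<bar>poly \<phi> s\<bar> \<le> B" using poly_bounded_unit_interval[of \<phi>] by metis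
  have "integrable (jacobi_measure p q) (\<lambda>s. poly \<phi> s * ?k (x - s))"
    using B by (intro integrable_riesz_potential[OF adm x poly_borel_unit, where B = B]) auto
  moreover have meas: "(\<lambda>s. poly \<phi> s * ?k (x - s)) \<in> borel_measurable (lebesgue_on {0<..<1})"
  proof (rule borel_measurable_lebesgue_on)
    have [measurable]: "poly \<phi> \<in> borel_measurable borel" by (rule poly_measurable)
    show "(\<lambda>s. poly \<phi> s * ?k (x - s)) \<in> borel_measurable borel" by measurable
  qed
  ultimately have h: "integrable (lebesgue_on {0<..<1}) ?h"
    by (simp add: integrable_jacobi_measure_iff)
  have "r * frac_int_left (2 - \<alpha>) (deriv u) x
    = (\<integral>s. r / Gamma ?\<sigma> * (deriv u s * (x - s) powr (?\<sigma> - 1)) \<partial>lebesgue_on {0<..<x})"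
    unfolding frac_int_left_def \<alpha> by simp
  also have "\<dots> = (\<integral>s. ?h s \<partial>lebesgue_on {0<..<x})"
    using x by (intro Bochner_Integration.integral_cong refl) (auto simp: u riesz_kernel_def)
  finally have left: "r * frac_int_left (2 - \<alpha>) (deriv u) x = (\<integral>s. ?h s \<partial>lebesgue_on {0<..<x})" .
  have "(1 - r) * frac_int_right (2 - \<alpha>) (deriv u) x
    = (\<integral>s. (1 - r) / Gamma ?\<sigma> * (deriv u s * (s - x) powr (?\<sigma> - 1)) \<partial>lebesgue_on {x<..<1})"
    unfolding frac_int_right_def \<alpha> by simp
  also have "\<dots> = (\<integral>s. ?h s \<partial>lebesgue_on {x<..<1})"
    using x by (intro Bochner_Integration.integral_cong refl) (auto simp: u riesz_kernel_def)
  finally have right: "(1 - r) * frac_int_right (2 - \<alpha>) (deriv u) x = (\<integral>s. ?h s \<partial>lebesgue_on {x<..<1})" .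
  have "riesz_potential r p q (poly \<phi>) x = (\<integral>s. ?h s \<partial>lebesgue_on {0<..<1})"
    unfolding riesz_potential_def by (rule integral_jacobi_measure[OF meas])
  also have "\<dots> = r * frac_int_left (2 - \<alpha>) (deriv u) x + (1 - r) * frac_int_right (2 - \<alpha>) (deriv u) x"
    unfolding left right by (rule integral_lebesgue_on_split[OF h x])
  finally show ?thesis by (simp add: L_op_def)
qed

lemma truncation_eq_wt_poly:
  assumes "\<alpha> - \<beta> = p + 1" "\<beta> = q + 1"
  shows "truncation \<alpha> \<beta> c N x = wt (p + 1) (q + 1) x * poly (\<Sum>j\<le>N. smult (c j) (jacobi_poly j (p + 1) (q + 1))) x"
  unfolding truncation_def assms(1) unfolding assms(2) by (simp add: poly_sum poly_jacobi_poly)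

lemma deriv_truncation:
  assumes "\<alpha> - \<beta> = p + 1" "\<beta> = q + 1" and s: "s \<in> {0<..<1}"
  shows "deriv (truncation \<alpha> \<beta> c N) s
    = wt p q s * poly (\<Sum>j\<le>N. smult (- (c j * real (Suc j))) (jacobi_poly (Suc j) p q)) s"
proof (rule DERIV_imp_deriv)
  have "((\<lambda>x. \<Sum>j\<le>N. c j * (wt (p + 1) (q + 1) x * poly (jacobi_poly j (p + 1) (q + 1)) x)) has_real_derivative
     (\<Sum>j\<le>N. c j * (- real (Suc j) * (wt p q s * poly (jacobi_poly (Suc j) p q) s)))) (at s)"
    by (intro DERIV_sum DERIV_cmult wt_jacobi_poly_has_derivative[OF s])
  also have "(\<lambda>x. \<Sum>j\<le>N. c j * (wt (p + 1) (q + 1) x * poly (jacobi_poly j (p + 1) (q + 1)) x)) = truncation \<alpha> \<beta> c N"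
    by (rule ext) (simp only: truncation_eq_wt_poly[OF assms(1,2)] poly_sum poly_smult sum_distrib_left mult.left_commute)
  also have "(\<Sum>j\<le>N. c j * (- real (Suc j) * (wt p q s * poly (jacobi_poly (Suc j) p q) s)))
    = wt p q s * poly (\<Sum>j\<le>N. smult (- (c j * real (Suc j))) (jacobi_poly (Suc j) p q)) s"
    unfolding poly_sum sum_distrib_left by (intro sum.cong refl) (simp add: algebra_simps)
  finally show "(truncation \<alpha> \<beta> c N has_real_derivative
    wt p q s * poly (\<Sum>j\<le>N. smult (- (c j * real (Suc j))) (jacobi_poly (Suc j) p q)) s) (at s)" .
qed

lemma riesz_potential_poly_sum:
  assumes adm: "admissible r p q" and x: "0 < x" "x < 1" and "finite I"
  shows "riesz_potential r p q (poly (\<Sum>j\<in>I. smult (c j) (Q j))) x = (\<Sum>j\<in>I. c j * riesz_potential r p q (poly (Q j)) x)"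
  using \<open>finite I\<close>
proof (induction I rule: finite_induct)
  case empty
  then show ?case by (simp add: riesz_potential_def)
next
  case (insert j I)
  then show ?case
    by (simp only: sum.insert[OF insert(1,2)] riesz_potential_poly_add[OF adm x] riesz_potential_poly_smult)
qed

lemma L_op_truncation:
  assumes adm: "admissible r p q" and ab: "\<alpha> - \<beta> = p + 1" "\<beta> = q + 1"
    and P: "\<And>n x. 0 < x \<Longrightarrow> x < 1 \<Longrightarrow> riesz_potential r p q (poly (jacobi_poly n p q)) x = poly (P n) x"
    and x: "0 < x" "x < 1"
  shows "L_op r \<alpha> (truncation \<alpha> \<beta> c N) x = (\<Sum>j\<le>N. c j * real (Suc j) * poly (P (Suc j)) x)"
proof -
  have "2 - \<alpha> = - p - q" using ab by simp
  from L_op_eq_riesz_potential[OF adm this deriv_truncation[OF ab] x]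
  show ?thesis
    by (simp only: riesz_potential_poly_sum[OF adm x finite_atMost] P[OF x])
       (simp only: sum_negf[symmetric] mult_minus_left minus_minus)
qed

lemma w_L2_iff: "g \<in> w_L2 a b \<longleftrightarrow> square_integrable (jacobi_measure a b) g"
proof (cases "g \<in> borel_measurable (lebesgue_on {0<..<1})")
  case True
  then have "integrable (jacobi_measure a b) (\<lambda>x. g x * g x) \<longleftrightarrow> integrable (lebesgue_on {0<..<1}) (\<lambda>x. wt a b x * (g x * g x))"
    by (intro integrable_jacobi_measure_iff) auto
  with True show ?thesis by (simp add: w_L2_def square_integrable_def borel_measurable_jacobi_measure mult.assoc)
next
  case False
  then show ?thesis by (simp add: w_L2_def square_integrable_def borel_measurable_jacobi_measure)
qed

lemma w_norm_eq:
  assumes "g \<in> borel_measurable (lebesgue_on {0<..<1})"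
  shows "w_norm a b g = sqrt (\<integral>x. (g x)\<^sup>2 \<partial>jacobi_measure a b)"
proof -
  have "(\<integral>x. (g x)\<^sup>2 \<partial>jacobi_measure a b) = (\<integral>x. wt a b x * (g x)\<^sup>2 \<partial>lebesgue_on {0<..<1})"
    using assms by (intro integral_jacobi_measure) auto
  then show ?thesis by (simp add: w_norm_def w_inner_def power2_eq_square mult.assoc)
qed

lemma converges_in_w_L2I:
  assumes "\<And>n. square_integrable (jacobi_measure a b) (g n)" "square_integrable (jacobi_measure a b) h"
    "(\<lambda>n. \<integral>x. (g n x - h x)\<^sup>2 \<partial>jacobi_measure a b) \<longlonglongrightarrow> 0"
  shows "converges_in_w_L2 a b g h"
proof -
  have "w_norm a b (\<lambda>x. g n x - h x) = sqrt (\<integral>x. (g n x - h x)\<^sup>2 \<partial>jacobi_measure a b)" for n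
    using assms(1)[of n] assms(2) by (intro w_norm_eq) (auto simp: square_integrable_def borel_measurable_jacobi_measure)
  moreover have "(\<lambda>n. sqrt (\<integral>x. (g n x - h x)\<^sup>2 \<partial>jacobi_measure a b)) \<longlonglongrightarrow> sqrt 0"
    by (intro tendsto_intros assms)
  ultimately show ?thesis using assms(1,2) by (simp add: converges_in_w_L2_def w_L2_iff)
qed

lemma square_integrable_cong:
  assumes "\<And>x. x \<in> space M \<Longrightarrow> f x = g x"
  shows "square_integrable M f \<longleftrightarrow> square_integrable M g"
  unfolding square_integrable_def
  using assms by (intro conj_cong measurable_cong Bochner_Integration.integrable_cong) auto

lemma square_integrable_poly_jacobi:
  assumes "a > -1" "b > -1"
  shows "square_integrable (jacobi_measure a b) (poly P)"
  using integrable_poly_jacobi[OF assms, of "P * P"] poly_borel_unit[of P]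
  by (simp add: poly_mult[abs_def] square_integrable_def borel_measurable_jacobi_measure)

lemma wt_uminus: "x \<in> {0<..<1} \<Longrightarrow> wt (- a) (- b) x * wt a b x = 1"
  by (simp add: wt_def powr_minus field_simps)

text \<open>Multiplication by the weight is an isometry onto the space with the reciprocal weight.\<close>

lemma square_integrable_wt_mult:
  assumes "F \<in> borel_measurable (lebesgue_on {0<..<1})"
  shows "(\<integral>x. (wt a b x * F x)\<^sup>2 \<partial>jacobi_measure (- a) (- b)) = (\<integral>x. (F x)\<^sup>2 \<partial>jacobi_measure a b)"
    and "square_integrable (jacobi_measure (- a) (- b)) (\<lambda>x. wt a b x * F x) \<longleftrightarrow> square_integrable (jacobi_measure a b) F"
proof -
  have [measurable]: "wt a b \<in> borel_measurable (lebesgue_on {0<..<1})" "F \<in> borel_measurable (lebesgue_on {0<..<1})"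
    using assms by (auto intro: borel_measurable_lebesgue_on wt_measurable)
  have eq: "wt (- a) (- b) x * (wt a b x * F x)\<^sup>2 = wt a b x * (F x)\<^sup>2" if "x \<in> space (lebesgue_on {0<..<1})" for x
  proof -
    have "wt (- a) (- b) x * (wt a b x * F x)\<^sup>2 = (wt (- a) (- b) x * wt a b x) * wt a b x * (F x)\<^sup>2"
      by (simp add: power2_eq_square)
    also have "wt (- a) (- b) x * wt a b x = 1" using that by (intro wt_uminus) simp
    finally show ?thesis by simp
  qed
  have m: "(\<lambda>x. (wt a b x * F x)\<^sup>2) \<in> borel_measurable (lebesgue_on {0<..<1})"
    "(\<lambda>x. (F x)\<^sup>2) \<in> borel_measurable (lebesgue_on {0<..<1})"
    "(\<lambda>x. wt a b x * F x) \<in> borel_measurable (lebesgue_on {0<..<1})" by measurable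
  show "(\<integral>x. (wt a b x * F x)\<^sup>2 \<partial>jacobi_measure (- a) (- b)) = (\<integral>x. (F x)\<^sup>2 \<partial>jacobi_measure a b)"
    unfolding integral_jacobi_measure[OF m(1)] integral_jacobi_measure[OF m(2)]
    by (intro Bochner_Integration.integral_cong refl eq)
  have "integrable (jacobi_measure (- a) (- b)) (\<lambda>x. (wt a b x * F x)\<^sup>2) \<longleftrightarrow> integrable (jacobi_measure a b) (\<lambda>x. (F x)\<^sup>2)"
    unfolding integrable_jacobi_measure_iff[OF m(1)] integrable_jacobi_measure_iff[OF m(2)]
    by (intro Bochner_Integration.integrable_cong refl eq)
  then show "square_integrable (jacobi_measure (- a) (- b)) (\<lambda>x. wt a b x * F x) \<longleftrightarrow> square_integrable (jacobi_measure a b) F"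
    using m(3) assms by (simp add: square_integrable_def borel_measurable_jacobi_measure power2_eq_square)
qed

text \<open>Polynomials of every exact degree span all polynomials, so \<open>wt a b * h\<close> has vanishing moments.\<close>

lemma jacobi_complete:
  fixes P :: "nat \<Rightarrow> real poly"
  assumes ab: "a > -1" "b > -1"
    and P: "\<And>n. degree (P n) \<le> n" "\<And>n. coeff (P n) n \<noteq> 0"
    and h: "square_integrable (jacobi_measure a b) h"
    and orth: "\<And>n. (\<integral>x. h x * poly (P n) x \<partial>jacobi_measure a b) = 0"
  shows "AE x in jacobi_measure a b. h x = 0"
proof -
  let ?M = "jacobi_measure a b"
  have int: "integrable ?M (\<lambda>x. h x * poly Q x)" for Q
    by (intro integrable_mult_square_integrable h square_integrable_poly_jacobi ab)
  have lin: "(\<integral>x. h x * poly (R + smult c Q) x \<partial>?M) = (\<integral>x. h x * poly R x \<partial>?M) + c * (\<integral>x. h x * poly Q x \<partial>?M)" for R c Q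
  proof -
    have "(\<integral>x. h x * poly (R + smult c Q) x \<partial>?M) = (\<integral>x. h x * poly R x + c * (h x * poly Q x) \<partial>?M)"
      by (simp add: algebra_simps)
    then show ?thesis using int[of R] int[of Q] by simp
  qed
  have deg: "degree Q < n \<or> Q = 0 \<Longrightarrow> (\<integral>x. h x * poly Q x \<partial>?M) = 0" for Q n
  proof (induction n arbitrary: Q)
    case (Suc n)
    let ?c = "coeff Q n / coeff (P n) n"
    let ?R = "Q - smult ?c (P n)"
    have "degree ?R < n \<or> ?R = 0"
    proof (cases "?R = 0")
      case False
      have "degree Q \<le> n" using Suc.prems by auto
      then have "degree ?R < n"
        using False P[of n] by (intro degree_diff_less_if_same_coeff) (auto intro: order_trans[OF degree_smult_le])
      then show ?thesis ..
    qed simp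
    from Suc.IH[OF this] orth[of n] show ?case using lin[of ?R ?c "P n"] by simp
  qed simp
  have moments: "(\<integral>x. h x * poly Q x \<partial>?M) = 0" for Q
    by (rule deg[of Q "Suc (degree Q)"]) simp
  have [measurable]: "h \<in> borel_measurable (lebesgue_on {0<..<1})"
    using h by (simp add: square_integrable_def borel_measurable_jacobi_measure)
  have hm: "(\<lambda>x. h x * poly Q x) \<in> borel_measurable (lebesgue_on {0<..<1})" for Q
    using poly_borel_unit[of Q] by measurable
  have "AE x in lebesgue_on {0<..<1}. wt a b x * h x = 0"
  proof (rule all_moments_zero_imp_AE_zero)
    show "integrable (lebesgue_on {0<..<1}) (\<lambda>x. wt a b x * h x)"
      using int[of 1] by (simp add: integrable_jacobi_measure_iff)
    show "(\<integral>x. wt a b x * h x * poly Q x \<partial>lebesgue_on {0<..<1}) = 0" for Q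
      using moments[of Q] unfolding integral_jacobi_measure[OF hm] by (simp add: mult.assoc)
  qed
  then have "AE x in lebesgue_on {0<..<1}. h x = 0"
  proof (rule AE_mp, intro AE_I2 impI)
    fix x assume "x \<in> space (lebesgue_on {0<..<1::real})" "wt a b x * h x = 0"
    then show "h x = 0" using wt_pos[of x a b] by auto
  qed
  then show ?thesis by (simp add: AE_jacobi_measure_iff)
qed

section \<open>The primitive of the right-hand side\<close>

lemma integrable_wt:
  assumes "a > -1" "b > -1"
  shows "integrable (lebesgue_on {0<..<1}) (wt a b)"
proof -
  interpret finite_measure "jacobi_measure a b" by (rule finite_measure_jacobi[OF assms])
  have "integrable (jacobi_measure a b) (\<lambda>x. 1 :: real)" by simp
  then show ?thesis by (subst (asm) integrable_jacobi_measure_iff) simp_all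
qed

lemma primitive_measurable:
  fixes f :: "real \<Rightarrow> real"
  assumes f: "f \<in> borel_measurable (lebesgue_on {0<..<1})"
  shows "(\<lambda>x. \<integral>y. f y \<partial>lebesgue_on {0<..<x}) \<in> borel_measurable (lebesgue_on {0<..<1})"
proof -
  let ?\<mu> = "lebesgue_on {0<..<1::real}"
  interpret finite_measure ?\<mu> by (rule finite_measure_lebesgue_on) auto
  have id: "(\<lambda>x. x) \<in> borel_measurable ?\<mu>" by (rule borel_measurable_lebesgue_on) simp
  have [measurable]: "(\<lambda>z. fst z) \<in> borel_measurable (?\<mu> \<Otimes>\<^sub>M ?\<mu>)"
    using measurable_compose[OF measurable_fst id, of ?\<mu>] by simp
  have [measurable]: "(\<lambda>z. snd z) \<in> borel_measurable (?\<mu> \<Otimes>\<^sub>M ?\<mu>)"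
    using measurable_compose[OF measurable_snd id, of ?\<mu>] by simp
  have [measurable]: "(\<lambda>z. f (snd z)) \<in> borel_measurable (?\<mu> \<Otimes>\<^sub>M ?\<mu>)"
    using f by (intro measurable_compose[OF measurable_snd])
  have "(\<lambda>z. if snd z < fst z then f (snd z) else 0) \<in> borel_measurable (?\<mu> \<Otimes>\<^sub>M ?\<mu>)"
    by measurable
  then have "(\<lambda>x. \<integral>y. (if y < x then f y else 0) \<partial>?\<mu>) \<in> borel_measurable ?\<mu>"
    by (intro borel_measurable_lebesgue_integral) (simp add: split_beta')
  moreover have "(\<integral>y. (if y < x then f y else 0) \<partial>?\<mu>) = (\<integral>y. f y \<partial>lebesgue_on {0<..<x})"
    if "x \<in> space ?\<mu>" for x
  proof -
    have "(\<integral>y. (if y < x then f y else 0) \<partial>?\<mu>) = (\<integral>y. indicator {0<..<1} y *\<^sub>R (if y < x then f y else 0) \<partial>lebesgue)"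
      by (rule integral_restrict_space) simp
    also have "\<dots> = (\<integral>y. indicator {0<..<x} y *\<^sub>R f y \<partial>lebesgue)"
      using that by (intro Bochner_Integration.integral_cong) (auto split: split_indicator)
    also have "\<dots> = (\<integral>y. f y \<partial>lebesgue_on {0<..<x})"
      by (rule integral_restrict_space[symmetric]) simp
    finally show ?thesis .
  qed
  ultimately show ?thesis by (subst (asm) measurable_cong)
qed

lemma weighted_young:
  fixes v t z :: real
  assumes "v > 0"
  shows "\<bar>t * z\<bar> \<le> v * z * z + t\<^sup>2 / v"
proof -
  have "0 \<le> (v * \<bar>z\<bar> - \<bar>t\<bar>)\<^sup>2 / v" using assms by simp
  also have "\<dots> = v * z * z - 2 * \<bar>t * z\<bar> + t\<^sup>2 / v"
    using assms by (simp add: power2_diff field_simps power2_eq_square abs_mult)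
  finally show ?thesis by linarith
qed

text \<open>Away from 0, the inequality of arithmetic and geometric means bounds \<open>(1 - y) powr \<epsilon> * \<bar>f y\<bar>\<close> by the integrable function
\<open>wt b a y * f y * f y\<close> plus a constant times \<open>(1 - y) powr (2 * \<epsilon> - b)\<close>, which is integrable since \<open>b \<le> 1\<close>. On
\<open>(0, x)\<close> one has \<open>(1 - x) powr \<epsilon> \<le> (1 - y) powr \<epsilon>\<close>, so this yields the bound for the primitive.\<close>

lemma primitive_bound:
  fixes f :: "real \<Rightarrow> real"
  assumes ab: "a > 0" "a \<le> 1" "b > 0" "b \<le> 1" and f: "f \<in> w_L2 b a" and \<epsilon>: "\<epsilon> > 0"
  shows "\<exists>I. \<forall>x\<in>{0<..<1}. \<bar>\<integral>y. f y \<partial>lebesgue_on {0<..<x}\<bar> \<le> I * (1 - x) powr (- \<epsilon>)"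
proof (cases "\<exists>x0\<in>{0<..<1}. integrable (lebesgue_on {0<..<x0}) f")
  case False
  \<comment> \<open>For a = 1 the function f need not be integrable at 0; its integral is then 0 by convention.\<close>
  then have "(\<integral>y. f y \<partial>lebesgue_on {0<..<x}) = 0" if "x \<in> {0<..<1}" for x
    using that not_integrable_integral_eq by blast
  then show ?thesis by (intro exI[of _ 0]) simp
next
  case True
  then obtain x0 where x0: "0 < x0" "x0 < 1" and int0: "integrable (lebesgue_on {0<..<x0}) f" by auto
  let ?\<mu> = "lebesgue_on {0<..<1::real}"
  have [measurable]: "f \<in> borel_measurable ?\<mu>" and f2: "integrable ?\<mu> (\<lambda>x. wt b a x * f x * f x)"
    using f by (auto simp: w_L2_def)
  define E where "E y = (1 - y) powr \<epsilon> * f y" for y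
  have [measurable]: "(\<lambda>y. (1 - y) powr \<epsilon>) \<in> borel_measurable ?\<mu>"
    by (rule borel_measurable_lebesgue_on) measurable
  have E_meas [measurable]: "E \<in> borel_measurable ?\<mu>" unfolding E_def by measurable
  have i0: "integrable ?\<mu> (\<lambda>y. indicator {0<..<x0} y * \<bar>f y\<bar>)"
  proof -
    have "integrable lebesgue (\<lambda>y. indicator {0<..<x0} y *\<^sub>R \<bar>f y\<bar>)"
      using integrable_abs[OF int0] integrable_restrict_space[of "{0<..<x0}" lebesgue "\<lambda>y. \<bar>f y\<bar>"] by simp
    also have "(\<lambda>y. indicator {0<..<x0} y *\<^sub>R \<bar>f y\<bar>) = (\<lambda>y. indicator {0<..<1} y *\<^sub>R (indicator {0<..<x0} y * \<bar>f y\<bar>))"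
      using x0 by (auto simp: indicator_def fun_eq_iff)
    finally show ?thesis by (subst integrable_restrict_space) simp_all
  qed
  have i1: "integrable ?\<mu> (wt (2 * \<epsilon> - b) 0)"
    using ab \<epsilon> by (intro integrable_wt) auto
  have "integrable ?\<mu> E"
  proof (rule Bochner_Integration.integrable_bound)
    show "integrable ?\<mu> (\<lambda>y. indicator {0<..<x0} y * \<bar>f y\<bar> + wt b a y * f y * f y + x0 powr (- a) * wt (2 * \<epsilon> - b) 0 y)"
      by (intro Bochner_Integration.integrable_add i0 f2 integrable_mult_right i1)
    show "AE y in ?\<mu>. norm (E y) \<le> norm (indicator {0<..<x0} y * \<bar>f y\<bar> + wt b a y * f y * f y + x0 powr (- a) * wt (2 * \<epsilon> - b) 0 y)"
    proof (rule AE_I2)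
      fix y assume "y \<in> space ?\<mu>"
      then have y: "0 < y" "y < 1" by auto
      have nn: "wt b a y * f y * f y \<ge> 0" "x0 powr (- a) * wt (2 * \<epsilon> - b) 0 y \<ge> 0"
        using y by (auto simp: wt_nonneg mult.assoc)
      have "\<bar>E y\<bar> \<le> indicator {0<..<x0} y * \<bar>f y\<bar> + wt b a y * f y * f y + x0 powr (- a) * wt (2 * \<epsilon> - b) 0 y"
      proof (cases "y < x0")
        case True
        have "(1 - y) powr \<epsilon> \<le> 1" using y \<epsilon> by (intro powr_le1) auto
        then have "\<bar>E y\<bar> \<le> \<bar>f y\<bar>" unfolding E_def by (simp add: abs_mult mult_left_le_one_le)
        then show ?thesis using True y nn by simp
      next
        case False
        have "\<bar>E y\<bar> \<le> wt b a y * f y * f y + ((1 - y) powr \<epsilon>)\<^sup>2 / wt b a y"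
          unfolding E_def using y by (intro weighted_young wt_pos) auto
        also have "((1 - y) powr \<epsilon>)\<^sup>2 / wt b a y = (1 - y) powr (2 * \<epsilon> - b) * y powr (- a)"
          using y by (simp add: wt_def powr_diff powr_minus powr_add[symmetric] power2_eq_square divide_simps)
        also have "\<dots> \<le> (1 - y) powr (2 * \<epsilon> - b) * x0 powr (- a)"
          using False x0 y ab by (intro mult_left_mono powr_mono2') auto
        also have "\<dots> = x0 powr (- a) * wt (2 * \<epsilon> - b) 0 y" using y by (simp add: wt_def)
        finally show ?thesis using False nn by simp
      qed
      then show "norm (E y) \<le> norm (indicator {0<..<x0} y * \<bar>f y\<bar> + wt b a y * f y * f y + x0 powr (- a) * wt (2 * \<epsilon> - b) 0 y)"
        by simp
    qed
  qed measurable
  then have E_int: "integrable ?\<mu> (\<lambda>y. \<bar>E y\<bar>)" by simp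
  have "\<bar>\<integral>y. f y \<partial>lebesgue_on {0<..<x}\<bar> \<le> (\<integral>y. \<bar>E y\<bar> \<partial>?\<mu>) * (1 - x) powr (- \<epsilon>)" if "x \<in> {0<..<1}" for x
  proof -
    from that have x: "0 < x" "x < 1" by auto
    have Ex: "integrable (lebesgue_on {0<..<x}) (\<lambda>y. \<bar>E y\<bar>)"
      by (rule integrable_lebesgue_on_subset[OF _ _ _ E_int]) (use x in auto)
    have "\<bar>\<integral>y. f y \<partial>lebesgue_on {0<..<x}\<bar> \<le> (\<integral>y. \<bar>f y\<bar> \<partial>lebesgue_on {0<..<x})"
      by (rule integral_abs_bound)
    also have "\<dots> \<le> (\<integral>y. (1 - x) powr (- \<epsilon>) * \<bar>E y\<bar> \<partial>lebesgue_on {0<..<x})"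
    proof (rule integral_mono')
      show "integrable (lebesgue_on {0<..<x}) (\<lambda>y. (1 - x) powr (- \<epsilon>) * \<bar>E y\<bar>)" using Ex by simp
      fix y assume "y \<in> space (lebesgue_on {0<..<x})"
      then have y: "0 < y" "y < x" by auto
      have "1 = (1 - x) powr (- \<epsilon>) * (1 - x) powr \<epsilon>" using x by (simp add: powr_add[symmetric])
      also have "\<dots> \<le> (1 - x) powr (- \<epsilon>) * (1 - y) powr \<epsilon>"
        using x y \<epsilon> by (intro mult_left_mono powr_mono2) auto
      finally have "1 * \<bar>f y\<bar> \<le> ((1 - x) powr (- \<epsilon>) * (1 - y) powr \<epsilon>) * \<bar>f y\<bar>"
        by (rule mult_right_mono) simp
      then show "\<bar>f y\<bar> \<le> (1 - x) powr (- \<epsilon>) * \<bar>E y\<bar>" by (simp add: E_def abs_mult mult.assoc)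
    qed simp
    also have "\<dots> = (1 - x) powr (- \<epsilon>) * (\<integral>y. \<bar>E y\<bar> \<partial>lebesgue_on {0<..<x})" by simp
    also have "\<dots> \<le> (1 - x) powr (- \<epsilon>) * (\<integral>y. \<bar>E y\<bar> \<partial>?\<mu>)"
      unfolding integral_lebesgue_on_split[OF E_int x]
      by (intro mult_left_mono) (simp_all add: integral_nonneg_AE)
    finally show ?thesis by (simp only: mult.commute)
  qed
  then show ?thesis by blast
qed

text \<open>With the exponent \<open>b / 4\<close> in the bound for the primitive, its square costs only \<open>b / 2\<close> in the exponent of \<open>1 - x\<close>, and
\<open>b - 1 - b / 2 > - 1\<close>.\<close>

lemma square_integrable_primitive_div:
  assumes ab: "a > 0" "a \<le> 1" "b > 0" "b \<le> 1" and f: "f \<in> w_L2 b a"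
    and K: "0 < Km" "\<And>x. x \<in> {0<..<1} \<Longrightarrow> Km \<le> K x" "K \<in> borel_measurable (lebesgue_on {0<..<1})"
  shows "square_integrable (jacobi_measure (b - 1) (a - 1)) (\<lambda>x. 1 / K x * (\<integral>y. f y \<partial>lebesgue_on {0<..<x}))"
proof (rule square_integrableI)
  let ?\<mu> = "lebesgue_on {0<..<1::real}"
  let ?F = "\<lambda>x. \<integral>y. f y \<partial>lebesgue_on {0<..<x}"
  let ?g = "\<lambda>x. 1 / K x * ?F x"
  have [measurable]: "?F \<in> borel_measurable ?\<mu>" "K \<in> borel_measurable ?\<mu>"
    using primitive_measurable f K by (auto simp: w_L2_def)
  have g: "?g \<in> borel_measurable ?\<mu>" "(\<lambda>x. (?g x)\<^sup>2) \<in> borel_measurable ?\<mu>" by measurable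
  show "?g \<in> borel_measurable (jacobi_measure (b - 1) (a - 1))"
    using g by (simp add: borel_measurable_jacobi_measure)
  have "b / 4 > 0" using ab by simp
  from primitive_bound[OF ab f this]
  obtain I where I: "\<And>x. x \<in> {0<..<1} \<Longrightarrow> \<bar>?F x\<bar> \<le> I * (1 - x) powr (- (b / 4))"
    by blast
  have i: "integrable ?\<mu> (wt (b / 2 - 1) (a - 1))"
    using ab by (intro integrable_wt) auto
  show "integrable (jacobi_measure (b - 1) (a - 1)) (\<lambda>x. (?g x)\<^sup>2)"
    unfolding integrable_jacobi_measure_iff[OF g(2)]
  proof (rule Bochner_Integration.integrable_bound)
    show "integrable ?\<mu> (\<lambda>x. (I / Km)\<^sup>2 * wt (b / 2 - 1) (a - 1) x)" using i by simp
    have [measurable]: "wt (b - 1) (a - 1) \<in> borel_measurable ?\<mu>"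
      by (intro borel_measurable_lebesgue_on wt_measurable)
    show "(\<lambda>x. wt (b - 1) (a - 1) x * (?g x)\<^sup>2) \<in> borel_measurable ?\<mu>" by measurable
    show "AE x in ?\<mu>. norm (wt (b - 1) (a - 1) x * (?g x)\<^sup>2) \<le> norm ((I / Km)\<^sup>2 * wt (b / 2 - 1) (a - 1) x)"
    proof (rule AE_I2)
      fix x assume "x \<in> space ?\<mu>"
      then have x: "x \<in> {0<..<1}" "0 < x" "x < 1" by auto
      have "\<bar>?g x\<bar> = \<bar>?F x\<bar> / K x" using K(1) K(2)[OF x(1)] by (simp add: abs_mult)
      also have "\<dots> \<le> (I * (1 - x) powr (- (b / 4))) / Km"
        using I[OF x(1)] K(1) K(2)[OF x(1)] by (intro frac_le) auto
      finally have "\<bar>?g x\<bar>\<^sup>2 \<le> ((I * (1 - x) powr (- (b / 4))) / Km)\<^sup>2" by (intro power_mono) auto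
      then have "wt (b - 1) (a - 1) x * (?g x)\<^sup>2 \<le> wt (b - 1) (a - 1) x * ((I * (1 - x) powr (- (b / 4))) / Km)\<^sup>2"
        using x by (intro mult_left_mono wt_nonneg) (simp_all only: power2_abs)
      also have "\<dots> = (I / Km)\<^sup>2 * (((1 - x) powr (b - 1) * (1 - x) powr (- (b / 4)) * (1 - x) powr (- (b / 4))) * x powr (a - 1))"
        by (simp add: wt_def power2_eq_square)
      also have "(1 - x) powr (b - 1) * (1 - x) powr (- (b / 4)) * (1 - x) powr (- (b / 4)) = (1 - x) powr (b / 2 - 1)"
        unfolding powr_add[symmetric] by (rule arg_cong2[where f = "(powr)"]) simp_all
      finally show "norm (wt (b - 1) (a - 1) x * (?g x)\<^sup>2) \<le> norm ((I / Km)\<^sup>2 * wt (b / 2 - 1) (a - 1) x)"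
        using x wt_nonneg[of x] by (simp add: wt_def abs_mult)
    qed
  qed
qed

section \<open>Solution of the boundary value problem\<close>

text \<open>Expand \<open>g\<close> in the images \<open>P i\<close> of the Jacobi polynomials. The coefficient of the constant \<open>P 0\<close> vanishes, and
for \<open>i = Suc j\<close> the operator maps the \<open>j\<close>-th basis function of the solution space to \<open>Suc j * P i\<close>. This determines
the coefficients of the solution, and the lower bound on the norms of the images makes its expansion converge.\<close>

lemma riesz_equation_solvable:
  assumes adm: "admissible r p q" and ab: "\<alpha> - \<beta> = p + 1" "\<beta> = q + 1"
    and g: "square_integrable (jacobi_measure q p) g" and mean: "(\<integral>x. g x \<partial>jacobi_measure q p) = 0"
  shows "\<exists>u c. is_expansion \<alpha> \<beta> u c \<and>
    converges_in_w_L2 (\<beta> - 1) (\<alpha> - \<beta> - 1) (\<lambda>N. L_op r \<alpha> (truncation \<alpha> \<beta> c N)) g"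
proof -
  note * = admissibleD[OF adm]
  have pq: "q > -1" "p > -1" "p + 1 > -1" "q + 1 > -1" using * by auto
  obtain P :: "nat \<Rightarrow> real poly" and c0 :: real where c0: "c0 > 0"
    and P: "\<And>n. degree (P n) \<le> n" "\<And>n. coeff (P n) n > 0"
    "\<And>n x. 0 < x \<Longrightarrow> x < 1 \<Longrightarrow> riesz_potential r p q (poly (jacobi_poly n p q)) x = poly (P n) x"
    and orth: "\<And>n \<psi>. degree \<psi> < n \<Longrightarrow> jint q p (\<psi> * P n) = 0"
    and pos: "\<And>n. jint q p (P n * P n) > 0"
    and lower: "\<And>n. c0 * jint (p + 1) (q + 1) (jacobi_poly n (p + 1) (q + 1) * jacobi_poly n (p + 1) (q + 1))
       \<le> (real (Suc n))\<^sup>2 * jint q p (P (Suc n) * P (Suc n))"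
    using riesz_potential_jacobi[OF adm] by metis
  let ?M = "jacobi_measure q p" and ?M' = "jacobi_measure (p + 1) (q + 1)"
  let ?e = "\<lambda>n. poly (P n)" and ?J = "\<lambda>n. poly (jacobi_poly n (p + 1) (q + 1))"
  have e_si: "square_integrable ?M (?e n)" for n by (intro square_integrable_poly_jacobi pq)
  have J_si: "square_integrable ?M' (?J n)" for n by (intro square_integrable_poly_jacobi pq)
  have e_orth: "(\<integral>x. ?e i x * ?e j x \<partial>?M) = 0" if "i \<noteq> j" for i j
  proof -
    have "(\<integral>x. ?e i x * ?e j x \<partial>?M) = 0" if "i < j" for i j
      using orth[of "P i" j] P(1)[of i] that by (simp add: poly_mult[abs_def])
    from this[of i j] this[of j i] that show ?thesis by (cases "i < j") (auto simp: mult.commute)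
  qed
  have J_orth: "(\<integral>x. ?J i x * ?J j x \<partial>?M') = 0" if "i \<noteq> j" for i j
  proof -
    have "(\<integral>x. ?J i x * ?J j x \<partial>?M') = 0" if "j < i" for i j
      using jacobi_poly_orthogonal[OF pq(3,4), of "jacobi_poly j (p + 1) (q + 1)" i]
        degree_jacobi_poly[of j "p + 1" "q + 1"] that by (simp add: poly_mult[abs_def])
    from this[of i j] this[of j i] that show ?thesis by (cases "j < i") (auto simp: mult.commute)
  qed
  let ?h = "\<lambda>i. \<integral>x. (?e i x)\<^sup>2 \<partial>?M"
  have h_eq: "?h i = jint q p (P i * P i)" for i by (simp add: poly_mult[abs_def] power2_eq_square)
  have h_pos: "?h i > 0" for i unfolding h_eq by (rule pos)
  define C where "C i = (\<integral>x. g x * ?e i x \<partial>?M) / ?h i" for i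
  have "(\<lambda>n. \<integral>x. ((\<Sum>i\<le>n. C i * ?e i x) - g x)\<^sup>2 \<partial>?M) \<longlonglongrightarrow> 0"
    unfolding C_def
  proof (rule fourier_series_converges[OF e_si e_orth g h_pos])
    fix h assume "square_integrable ?M h" "\<And>i. (\<integral>x. h x * ?e i x \<partial>?M) = 0"
    then show "AE x in ?M. h x = 0"
      using P(1,2) by (intro jacobi_complete[OF pq(1,2)]) (auto simp: less_imp_neq[symmetric])
  qed
  then have lim: "(\<lambda>n. \<integral>x. ((\<Sum>i\<le>Suc n. C i * ?e i x) - g x)\<^sup>2 \<partial>?M) \<longlonglongrightarrow> 0"
    by (rule LIMSEQ_Suc)
  have C_sm: "summable (\<lambda>i. (C i)\<^sup>2 * ?h i)"
    unfolding C_def by (rule fourier_coefficients_square_summable[OF e_si e_orth g h_pos])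
  have "C 0 = 0"
  proof -
    obtain k where "P 0 = [:k:]" using P(1)[of 0] degree0_coeffs by auto
    then show ?thesis using mean by (simp add: C_def)
  qed
  define c where "c j = C (Suc j) / real (Suc j)" for j
  have shift: "(\<Sum>i\<le>Suc N. C i * ?e i x) = (\<Sum>j\<le>N. c j * real (Suc j) * ?e (Suc j) x)" for N x
    by (subst sum.atMost_Suc_shift) (simp add: \<open>C 0 = 0\<close> c_def)
  have c_sm: "summable (\<lambda>j. (c j)\<^sup>2 * (\<integral>x. (?J j x)\<^sup>2 \<partial>?M'))"
  proof (rule summable_comparison_test')
    show "summable (\<lambda>j. ((C (Suc j))\<^sup>2 * ?h (Suc j)) / c0)"
      using C_sm by (intro summable_divide) (subst summable_Suc_iff)
    fix j :: nat
    let ?n = "\<integral>x. (?J j x)\<^sup>2 \<partial>?M'"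
    have n_eq: "?n = jint (p + 1) (q + 1) (jacobi_poly j (p + 1) (q + 1) * jacobi_poly j (p + 1) (q + 1))"
      by (simp add: poly_mult[abs_def] power2_eq_square)
    have nn: "?n \<ge> 0" by (rule integral_nonneg_AE) simp
    have "?n \<le> (real (Suc j))\<^sup>2 * ?h (Suc j) / c0"
      using lower[of j] c0 unfolding n_eq h_eq by (simp add: pos_le_divide_eq mult.commute del: poly_mult)
    then have "(c j)\<^sup>2 * ?n \<le> (c j)\<^sup>2 * ((real (Suc j))\<^sup>2 * ?h (Suc j) / c0)" by (rule mult_left_mono) simp
    also have "\<dots> = ((C (Suc j))\<^sup>2 * ?h (Suc j)) / c0"
      by (simp add: c_def power_divide del: of_nat_Suc)
    finally show "norm ((c j)\<^sup>2 * ?n) \<le> ((C (Suc j))\<^sup>2 * ?h (Suc j)) / c0" using nn by simp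
  qed
  obtain F where F: "square_integrable ?M' F" and F_lim: "(\<lambda>n. \<integral>x. ((\<Sum>i\<le>n. c i * ?J i x) - F x)\<^sup>2 \<partial>?M') \<longlonglongrightarrow> 0"
    by (rule orthogonal_series_converges[OF J_si J_orth c_sm])
  have F_meas: "F \<in> borel_measurable (lebesgue_on {0<..<1})"
    using F by (simp add: square_integrable_def borel_measurable_jacobi_measure)
  let ?S = "\<lambda>N. \<Sum>j\<le>N. smult (c j) (jacobi_poly j (p + 1) (q + 1))"
  have exps: "- (\<alpha> - \<beta>) = - (p + 1)" "- \<beta> = - (q + 1)" "\<beta> - 1 = q" "\<alpha> - \<beta> - 1 = p" using ab by auto
  have trunc: "truncation \<alpha> \<beta> c N = (\<lambda>x. wt (p + 1) (q + 1) x * poly (?S N) x)" for N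
    by (rule ext) (rule truncation_eq_wt_poly[OF ab])
  let ?u = "\<lambda>x. wt (p + 1) (q + 1) x * F x"
  have "is_expansion \<alpha> \<beta> ?u c"
    unfolding is_expansion_def exps
  proof (rule converges_in_w_L2I)
    show "square_integrable (jacobi_measure (- (p + 1)) (- (q + 1))) (truncation \<alpha> \<beta> c N)" for N
      unfolding trunc square_integrable_wt_mult(2)[OF poly_borel_unit] by (intro square_integrable_poly_jacobi pq)
    show "square_integrable (jacobi_measure (- (p + 1)) (- (q + 1))) ?u"
      unfolding square_integrable_wt_mult(2)[OF F_meas] by (rule F)
    have "(\<integral>x. (truncation \<alpha> \<beta> c N x - ?u x)\<^sup>2 \<partial>jacobi_measure (- (p + 1)) (- (q + 1)))
      = (\<integral>x. ((\<Sum>i\<le>N. c i * ?J i x) - F x)\<^sup>2 \<partial>?M')" for N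
    proof -
      have "(\<lambda>x. poly (?S N) x - F x) \<in> borel_measurable (lebesgue_on {0<..<1})"
        using poly_borel_unit F_meas by (rule borel_measurable_diff)
      from square_integrable_wt_mult(1)[OF this, of "p + 1" "q + 1"]
      show ?thesis unfolding trunc by (simp only: right_diff_distrib[symmetric] poly_sum poly_smult)
    qed
    then show "(\<lambda>N. \<integral>x. (truncation \<alpha> \<beta> c N x - ?u x)\<^sup>2 \<partial>jacobi_measure (- (p + 1)) (- (q + 1))) \<longlonglongrightarrow> 0"
      using F_lim by simp
  qed
  moreover have "converges_in_w_L2 (\<beta> - 1) (\<alpha> - \<beta> - 1) (\<lambda>N. L_op r \<alpha> (truncation \<alpha> \<beta> c N)) g"
    unfolding exps
  proof (rule converges_in_w_L2I)
    have L: "L_op r \<alpha> (truncation \<alpha> \<beta> c N) x = (\<Sum>i\<le>Suc N. C i * ?e i x)" if "x \<in> space ?M" for N x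
      unfolding shift using that by (intro L_op_truncation[OF adm ab P(3)]) auto
    show "square_integrable ?M (L_op r \<alpha> (truncation \<alpha> \<beta> c N))" for N
      by (rule iffD2[OF square_integrable_cong[OF L]], assumption)
         (intro square_integrable_sum square_integrable_cmult e_si)
    have "(\<integral>x. (L_op r \<alpha> (truncation \<alpha> \<beta> c N) x - g x)\<^sup>2 \<partial>?M) = (\<integral>x. ((\<Sum>i\<le>Suc N. C i * ?e i x) - g x)\<^sup>2 \<partial>?M)" for N
      by (intro Bochner_Integration.integral_cong refl) (simp only: L)
    then show "(\<lambda>N. \<integral>x. (L_op r \<alpha> (truncation \<alpha> \<beta> c N) x - g x)\<^sup>2 \<partial>?M) \<longlonglongrightarrow> 0"
      using lim by simp
  qed (rule g)
  ultimately show ?thesis by blast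
qed

lemma truncation_boundary:
  assumes "0 < \<alpha> - \<beta>" "0 < \<beta>"
  shows "continuous_on {0..1} (truncation \<alpha> \<beta> c N)" "truncation \<alpha> \<beta> c N 0 = 0" "truncation \<alpha> \<beta> c N 1 = 0"
proof -
  have "truncation \<alpha> \<beta> c N = (\<lambda>x. wt (\<alpha> - \<beta>) \<beta> x * poly (\<Sum>j\<le>N. smult (c j) (jacobi_poly j (\<alpha> - \<beta>) \<beta>)) x)"
    using truncation_eq_wt_poly[of \<alpha> \<beta> "\<alpha> - \<beta> - 1" "\<beta> - 1" c N] by auto
  then show "continuous_on {0..1} (truncation \<alpha> \<beta> c N)" using continuous_on_wt_poly[OF assms] by simp
qed (simp_all add: truncation_def wt_def)

lemma admissible_if_sin_ratio:
  assumes alpha: "1 < \<alpha>" "\<alpha> < 2" and r: "0 \<le> r" "r \<le> 1" and beta: "\<alpha> - 1 \<le> \<beta>" "\<beta> \<le> 1"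
    and ratio: "r = sin (pi * \<beta>) / (sin (pi * (\<alpha> - \<beta>)) + sin (pi * \<beta>))"
  shows "admissible r (\<alpha> - \<beta> - 1) (\<beta> - 1)"
proof -
  have sin_shift: "sin (pi * (t - 1)) = - sin (pi * t)" for t
    by (simp add: right_diff_distrib sin_diff)
  have sin_nn: "0 \<le> sin (pi * t)" if "0 \<le> t" "t \<le> 1" for t
    using that by (intro sin_ge_zero) auto
  have sin_pos: "0 < sin (pi * t)" if "0 < t" "t < 1" for t
    using that by (intro sin_gt_zero) auto
  have "sin (pi * (\<alpha> - \<beta>)) + sin (pi * \<beta>) > 0"
  proof (cases "\<beta> = 1")
    case True
    then show ?thesis using sin_pos[of "\<alpha> - \<beta>"] alpha by simp
  next
    case False
    then show ?thesis using sin_pos[of \<beta>] sin_nn[of "\<alpha> - \<beta>"] alpha beta by simp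
  qed
  then have "r * (sin (pi * (\<alpha> - \<beta>)) + sin (pi * \<beta>)) = sin (pi * \<beta>)" using ratio by simp
  then show ?thesis
    unfolding admissible_def sin_shift using alpha beta r by (simp add: algebra_simps)
qed

theorem theorem3p1:
  fixes \<alpha> \<beta> r Km KM :: real and K f f1 f2 :: "real \<Rightarrow> real"
  assumes alpha: "1 < \<alpha>" "\<alpha> < 2"
    and r: "0 \<le> r" "r \<le> 1"
    and beta: "\<alpha> - 1 \<le> \<beta>" "\<beta> \<le> 1"
      "r = sin (pi * \<beta>) / (sin (pi * (\<alpha> - \<beta>)) + sin (pi * \<beta>))"
    and K_bounds: "0 < Km" "\<And>x. x \<in> {0<..<1} \<Longrightarrow> Km \<le> K x \<and> K x \<le> KM"
    and K_measurable: "K \<in> borel_measurable (lebesgue_on {0<..<1})"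
    and f: "f \<in> w_L2 \<beta> (\<alpha> - \<beta>)"
    and f1: "f1 = (\<lambda>x. 1 / K x * (\<integral>y. f y \<partial>lebesgue_on {0<..<x}))"
    and f2: "f2 = (\<lambda>x. 1 / K x)"
  shows "\<exists>u A. u \<in> w_L2 (- (\<alpha> - \<beta>)) (- \<beta>) \<and>
    solves_problem r \<alpha> \<beta> f1 f2 u A \<and>
    A = w_inner (\<beta> - 1) (\<alpha> - \<beta> - 1) f1 (\<lambda>x. 1) /
        w_inner (\<beta> - 1) (\<alpha> - \<beta> - 1) (\<lambda>x. inverse (K x)) (\<lambda>x. 1) \<and>
    A = w_inner (\<beta> - 1) (\<alpha> - \<beta> - 1) (\<lambda>x. 1 / K x * (\<integral>y. f y \<partial>lebesgue_on {0<..<x})) (\<lambda>x. 1) /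
        w_inner (\<beta> - 1) (\<alpha> - \<beta> - 1) (\<lambda>x. 1 / K x) (\<lambda>x. 1)"
proof -
  define p q where "p = \<alpha> - \<beta> - 1" and "q = \<beta> - 1"
  have adm: "admissible r p q"
    unfolding p_def q_def by (rule admissible_if_sin_ratio[OF alpha r beta])
  note * = admissibleD[OF adm]
  have ab: "\<alpha> - \<beta> = p + 1" "\<beta> = q + 1" and pq: "q > -1" "p > -1"
    using * by (auto simp: p_def q_def)
  let ?M = "jacobi_measure q p"
  have K: "Km \<le> K x" "K x \<le> KM" if "x \<in> {0<..<1}" for x using K_bounds that by auto
  have f1_si: "square_integrable ?M f1"
    unfolding f1 p_def q_def
    using alpha beta by (intro square_integrable_primitive_div[OF _ _ _ _ f K_bounds(1) K(1) K_measurable]) auto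
  interpret finite_measure ?M by (rule finite_measure_jacobi[OF pq])
  have f2_meas: "f2 \<in> borel_measurable (lebesgue_on {0<..<1})" unfolding f2 using K_measurable by measurable
  have f2_bound: "0 \<le> f2 x" "f2 x \<le> 1 / Km" "1 / KM \<le> f2 x" if "x \<in> {0<..<1}" for x
    using K[OF that] K_bounds(1) by (auto simp: f2 frac_le)
  have f2_si: "square_integrable ?M f2"
  proof (rule square_integrableI)
    show "f2 \<in> borel_measurable ?M" using f2_meas by (simp add: borel_measurable_jacobi_measure)
    show "integrable ?M (\<lambda>x. (f2 x)\<^sup>2)"
      using f2_meas f2_bound
      by (intro integrable_bounded_jacobi[OF pq, of _ "(1 / Km)\<^sup>2"]) (auto intro!: power_mono simp del: power_divide)
  qed
  have one_si: "square_integrable ?M (\<lambda>x. 1)"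
    using square_integrable_poly_jacobi[OF pq, of 1] by (simp add: poly_1[abs_def])
  have int: "integrable ?M f1" "integrable ?M f2"
    using integrable_mult_square_integrable[OF f1_si one_si] integrable_mult_square_integrable[OF f2_si one_si] by auto
  have inner: "w_inner (\<beta> - 1) (\<alpha> - \<beta> - 1) h (\<lambda>x. 1) = (\<integral>x. h x \<partial>?M)" if "square_integrable ?M h" for h
    using that integral_jacobi_measure[of h q p]
    by (simp add: w_inner_def square_integrable_def borel_measurable_jacobi_measure p_def q_def)
  define A where "A = (\<integral>x. f1 x \<partial>?M) / (\<integral>x. f2 x \<partial>?M)"
  have "(\<integral>x. f2 x \<partial>?M) > 0"
  proof -
    have "KM > 0" using K[of "1/2"] K_bounds(1) by simp
    moreover have "Beta (p + 1) (q + 1) > 0" using pq by (simp add: Beta_def Gamma_real_pos)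
    ultimately have "0 < 1 / KM * jint q p 1" unfolding jint_one[OF pq] by simp
    also have "\<dots> = (\<integral>x. 1 / KM \<partial>?M)" by simp
    also have "\<dots> \<le> (\<integral>x. f2 x \<partial>?M)" using f2_bound int(2) by (intro integral_mono) auto
    finally show ?thesis .
  qed
  then have mean: "(\<integral>x. f1 x - A * f2 x \<partial>?M) = 0" using int by (simp add: A_def)
  have "square_integrable ?M (\<lambda>x. f1 x - A * f2 x)"
    by (intro square_integrable_diff square_integrable_cmult f1_si f2_si)
  from riesz_equation_solvable[OF adm ab this mean]
  obtain u c where u: "is_expansion \<alpha> \<beta> u c"
    "converges_in_w_L2 (\<beta> - 1) (\<alpha> - \<beta> - 1) (\<lambda>N. L_op r \<alpha> (truncation \<alpha> \<beta> c N)) (\<lambda>x. f1 x - A * f2 x)"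
    by blast
  have "solves_problem r \<alpha> \<beta> f1 f2 u A"
    unfolding solves_problem_def using u truncation_boundary[of \<alpha> \<beta> c] alpha beta by auto
  moreover have "u \<in> w_L2 (- (\<alpha> - \<beta>)) (- \<beta>)"
    using u(1) by (simp add: is_expansion_def converges_in_w_L2_def)
  moreover have "A = w_inner (\<beta> - 1) (\<alpha> - \<beta> - 1) f1 (\<lambda>x. 1) / w_inner (\<beta> - 1) (\<alpha> - \<beta> - 1) f2 (\<lambda>x. 1)"
    by (simp add: A_def inner f1_si f2_si)
  moreover have "(\<lambda>x. inverse (K x)) = f2" by (simp add: f2 inverse_eq_divide)
  ultimately show ?thesis unfolding f1[symmetric] f2[symmetric] by metis
qed

end
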